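(* Let $X$ be a connected, locally path connected Polish space (separable and completely metrizable). Then $\pi_1(X)$ is either countable or of cardinality continuum, and $H_1(X)$ is either countable or of cardinality continuum. *)

theory Defs
  imports "HOL-Analysis.Analysis" "HOL-Algebra.Free_Abelian_Groups" "HOL-Library.Equipollence"
begin

definition Polish_space :: "'a topology \<Rightarrow> bool" where
  "Polish_space X \<longleftrightarrow> separable_space X \<and> completely_metrizable_space X"

definition loops_at :: "'a topology \<Rightarrow> 'a \<Rightarrow> (real \<Rightarrow> 'a) set" where
  "loops_at X x = {p. pathin X p \<and> p 0 = x \<and> p 1 = x}"

definition homotopic_loops_at :: "'a topology \<Rightarrow> 'a \<Rightarrow> (real \<Rightarrow> 'a) \<Rightarrow> (real \<Rightarrow> 'a) \<Rightarrow> bool" where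
  "homotopic_loops_at X x p q \<longleftrightarrow>
     homotopic_with (\<lambda>r. r 0 = x \<and> r 1 = x) (top_of_set {0..1}) X p q"

definition loop_class :: "'a topology \<Rightarrow> 'a \<Rightarrow> (real \<Rightarrow> 'a) \<Rightarrow> (real \<Rightarrow> 'a) set" where
  "loop_class X x p = {q \<in> loops_at X x. homotopic_loops_at X x p q}"

text \<open>Path concatenation (as joinpaths, but for an arbitrary carrier type).\<close>
definition loop_join :: "(real \<Rightarrow> 'a) \<Rightarrow> (real \<Rightarrow> 'a) \<Rightarrow> real \<Rightarrow> 'a" where
  "loop_join p q = (\<lambda>t. if t \<le> 1/2 then p (2 * t) else q (2 * t - 1))"

definition fundamental_group :: "'a topology \<Rightarrow> 'a \<Rightarrow> (real \<Rightarrow> 'a) set monoid" where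
  "fundamental_group X x =
     \<lparr> carrier = loop_class X x ` loops_at X x,
       monoid.mult = (\<lambda>A B. loop_class X x (loop_join (SOME p. p \<in> A) (SOME q. q \<in> B))),
       one = loop_class X x (\<lambda>t. x) \<rparr>"

section \<open>Singular homology (definitions copied from HOL-Homology, Simplices / Homology_Groups)\<close>

type_synonym 'a chain = "((nat \<Rightarrow> real) \<Rightarrow> 'a) \<Rightarrow>\<^sub>0 int"

definition standard_simplex :: "nat \<Rightarrow> (nat \<Rightarrow> real) set" where
  "standard_simplex p \<equiv>
    {x. (\<forall>i. 0 \<le> x i \<and> x i \<le> 1) \<and> (\<forall>i>p. x i = 0) \<and> (\<Sum>i\<le>p. x i) = 1}"

definition simplical_face :: "nat \<Rightarrow> (nat \<Rightarrow> 'a) \<Rightarrow> nat \<Rightarrow> 'a::comm_monoid_add" where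
   "simplical_face k x \<equiv> \<lambda>i. if i < k then x i else if i = k then 0 else x(i -1)"

definition singular_simplex :: "nat \<Rightarrow> 'a topology \<Rightarrow> ((nat \<Rightarrow> real) \<Rightarrow> 'a) \<Rightarrow> bool" where
 "singular_simplex p X f \<equiv>
      continuous_map(subtopology (powertop_real UNIV) (standard_simplex p)) X f
    \<and> f \<in> extensional (standard_simplex p)"

definition singular_face :: "nat \<Rightarrow> nat \<Rightarrow> ((nat \<Rightarrow> real) \<Rightarrow> 'a) \<Rightarrow> (nat \<Rightarrow> real) \<Rightarrow> 'a"
  where "singular_face p k f \<equiv> restrict (f \<circ> simplical_face k) (standard_simplex (p - Suc 0))"

definition singular_chain :: "[nat, 'a topology, 'a chain] \<Rightarrow> bool"
  where "singular_chain p X c \<equiv> Poly_Mapping.keys c \<subseteq> Collect (singular_simplex p X)"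

definition chain_boundary :: "nat \<Rightarrow> ('a chain) \<Rightarrow> 'a chain"
  where "chain_boundary p c \<equiv>
          (if p = 0 then 0 else
           frag_extend (\<lambda>f. (\<Sum>k\<le>p. frag_cmul ((-1) ^ k) (frag_of(singular_face p k f)))) c)"

definition mod_subset
  where "mod_subset p X \<equiv> {(a,b). singular_chain p X (a - b)}"

definition singular_relcycle :: "nat \<Rightarrow> 'a topology \<Rightarrow> 'a set \<Rightarrow> ('a chain) \<Rightarrow> bool"
  where "singular_relcycle \<equiv>
        \<lambda>p X S c. singular_chain p X c \<and> (chain_boundary p c, 0) \<in> mod_subset (p-1) (subtopology X S)"

definition singular_relboundary :: "nat \<Rightarrow> 'a topology \<Rightarrow> 'a set \<Rightarrow> ('a chain) \<Rightarrow> bool"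
  where
  "singular_relboundary p X S \<equiv>
    \<lambda>c. \<exists>d. singular_chain (Suc p) X d \<and> (chain_boundary (Suc p) d, c) \<in> (mod_subset p (subtopology X S))"

definition chain_group :: "nat \<Rightarrow> 'a topology \<Rightarrow> 'a chain monoid"
  where "chain_group p X \<equiv> free_Abelian_group (Collect (singular_simplex p X))"

definition relcycle_group :: "nat \<Rightarrow> 'a topology \<Rightarrow> 'a set \<Rightarrow> ('a chain) monoid"
  where "relcycle_group p X S \<equiv>
        subgroup_generated (chain_group p X) (Collect(singular_relcycle p X S))"

definition homology_group :: "nat \<Rightarrow> 'a topology \<Rightarrow> ('a chain) set monoid"
  where "homology_group p X \<equiv>
        (relcycle_group p X {}) Mod (Collect (singular_relboundary p X {}))"

end

theory Submission
  imports Defs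
begin

text \<open>
  Call two paths congruent if they are homotopic relative to their end points (for \<open>\<pi>\<^sub>1\<close>), or if
  their difference is a singular boundary (for \<open>H\<^sub>1\<close>; every 1-cycle is homologous to a loop).
  If every point has arbitrarily small path connected open neighbourhoods in which paths with
  common end points are congruent, then a loop is determined up to congruence by a finite chain of
  sets from a countable base, so there are only countably many classes.

  Otherwise some point \<open>x\<close> is the base point of arbitrarily small loops \<open>l\<^sub>n\<close> that are not congruent to
  the constant loop. Each binary sequence \<open>a\<close> yields an infinite concatenation of the loops \<open>l\<^sub>n\<close> with
  \<open>a n\<close> true, and congruence of these concatenations is an equivalence relation \<open>E\<close> on Cantor space
  that relates no two sequences differing in exactly one place. As a congruence is witnessed by
  finitely many continuous maps on a compact space satisfying closed conditions, \<open>E\<close> is analytic and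
  has the Baire property. If \<open>E\<close> were comeagre in a cylinder, flipping a single late coordinate of a
  generic pair would give two related sequences that differ in one place. Hence \<open>E\<close> is meagre, and
  there are continuum many pairwise unrelated sequences.
\<close>

section \<open>Baire category in sequence spaces\<close>

text \<open>An analytic equivalence relation may have exactly aleph_1 classes even if the continuum
  is larger, so analyticity alone gives no dichotomy. What excludes this case is that flipping one
  coordinate breaks \<open>E\<close>, and this rests on cancellation: if two concatenations differ
  only in the loop \<open>l n\<close>, the common loops before it and the common tail after it can
  be removed, which would make \<open>l n\<close> trivial. The Baire property enters only as the
  implication from nonmeagre to comeagre in some cylinder, so words and cylinders suffice. A pair of
  binary sequences is coded as one sequence of pairs, so that a relation is again a set in a
  sequence space. The obstacle for H_1 is that a bounding chain has arbitrarily many simplices, with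
  integer coefficients and cancelling faces. All this discrete data is packed into one natural
  number, the type of the witness. For a fixed type only equalities between values of continuous
  maps remain, and these survive limits. This is what lets one pair of locales treat both
  groups.\<close>

definition cylinder :: "'k list \<Rightarrow> (nat \<Rightarrow> 'k) set" where
  "cylinder s = {y. \<forall>i<length s. y i = s ! i}"

text \<open>Cylinders form a base of the product topology with \<open>'k\<close> discrete; density
  is expressed on this base, so that sequences need no topology.\<close>

definition nowhere_dense :: "(nat \<Rightarrow> 'k) set \<Rightarrow> bool" where
  "nowhere_dense A \<longleftrightarrow> (\<forall>s. \<exists>t. cylinder (s @ t) \<inter> A = {})"

definition meagre :: "(nat \<Rightarrow> 'k) set \<Rightarrow> bool" where
  "meagre A \<longleftrightarrow> (\<exists>N :: nat \<Rightarrow> _. (\<forall>n. nowhere_dense (N n)) \<and> A \<subseteq> (\<Union>n. N n))"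

lemma cylinder_Nil [simp]: "cylinder [] = UNIV"
  by (simp add: cylinder_def)

lemma cylinder_append: "cylinder (s @ t) \<subseteq> cylinder s"
  by (auto simp: cylinder_def nth_append)

lemma cylinder_eq_map_upt: "y \<in> cylinder s \<longleftrightarrow> map y [0..<length s] = s"
  unfolding cylinder_def list_eq_iff_nth_eq by simp

lemma in_cylinder_map_upt: "y \<in> cylinder (map z [0..<n]) \<longleftrightarrow> (\<forall>i<n. y i = z i)"
  by (auto simp: cylinder_def)

lemma cylinder_refine:
  assumes "y \<in> cylinder s"
  obtains u where "y \<in> cylinder (s @ u)" "length (s @ u) = length s + n"
proof
  have "s @ map y [length s..<length s + n] = map y [0..<length s + n]"
    using assms unfolding cylinder_eq_map_upt
    by (simp only: upt_add_eq_append[of 0 "length s" n, simplified] map_append)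
  then show "y \<in> cylinder (s @ map y [length s..<length s + n])"
    by (simp add: in_cylinder_map_upt)
qed simp

section \<open>The ideals of nowhere dense and of meagre sets\<close>

lemma nowhere_dense_empty [simp]: "nowhere_dense {}"
  by (simp add: nowhere_dense_def)

lemma nowhere_dense_Un:
  assumes "nowhere_dense A" "nowhere_dense B"
  shows "nowhere_dense (A \<union> B)"
  unfolding nowhere_dense_def
proof
  fix s
  obtain t where t: "cylinder (s @ t) \<inter> A = {}" using assms(1) nowhere_dense_def by blast
  obtain u where "cylinder ((s @ t) @ u) \<inter> B = {}" using assms(2) nowhere_dense_def by blast
  then have "cylinder (s @ (t @ u)) \<inter> (A \<union> B) = {}"
    using t cylinder_append[of "s @ t" u] by auto
  then show "\<exists>t. cylinder (s @ t) \<inter> (A \<union> B) = {}" by blast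
qed

lemma nowhere_dense_UN_finite:
  assumes "finite I" "\<And>i. i \<in> I \<Longrightarrow> nowhere_dense (N i)"
  shows "nowhere_dense (\<Union>i\<in>I. N i)"
  using assms
proof (induction I rule: finite_induct)
  case (insert i I)
  then have "nowhere_dense (N i \<union> (\<Union>i\<in>I. N i))" by (intro nowhere_dense_Un) simp_all
  then show ?case by simp
qed simp

lemma meagre_subset:
  assumes "meagre A" "B \<subseteq> A"
  shows "meagre B"
proof -
  obtain N :: "nat \<Rightarrow> _" where "\<forall>n. nowhere_dense (N n)" "A \<subseteq> (\<Union>n. N n)"
    using assms(1) unfolding meagre_def by (elim exE conjE) (rule that)
  then show ?thesis
    using subset_trans[OF assms(2)] unfolding meagre_def by (intro exI[of _ N] conjI)
qed

lemma nowhere_dense_imp_meagre: "nowhere_dense A \<Longrightarrow> meagre A"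
  unfolding meagre_def by (intro exI[of _ "\<lambda>_. A"] conjI) simp_all

lemma meagre_UN:
  fixes A :: "nat \<Rightarrow> (nat \<Rightarrow> 'k) set"
  assumes "\<And>n. meagre (A n)"
  shows "meagre (\<Union>n. A n)"
proof -
  obtain N :: "nat \<Rightarrow> nat \<Rightarrow> (nat \<Rightarrow> 'k) set"
    where N: "\<And>n m. nowhere_dense (N n m)" "\<And>n. A n \<subseteq> (\<Union>m. N n m)"
    using assms unfolding meagre_def by metis
  define D where "D k = N (fst (prod_decode k)) (snd (prod_decode k))" for k
  have "A n \<subseteq> (\<Union>k. D k)" for n
  proof
    fix y assume "y \<in> A n"
    then obtain m where "y \<in> N n m" using N(2)[of n] by blast
    then have "y \<in> D (prod_encode (n, m))" by (simp add: D_def)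
    then show "y \<in> (\<Union>k. D k)" by blast
  qed
  moreover have "nowhere_dense (D k)" for k by (simp add: D_def N(1))
  ultimately show ?thesis unfolding meagre_def by blast
qed

lemma meagre_UN_countable:
  assumes "countable I" "\<And>i. i \<in> I \<Longrightarrow> meagre (A i)"
  shows "meagre (\<Union>i\<in>I. A i)"
proof (cases "I = {}")
  case True
  then show ?thesis by (simp add: nowhere_dense_imp_meagre)
next
  case False
  then have "(\<Union>i\<in>I. A i) = (\<Union>n. A (from_nat_into I n))"
    using assms(1) by (metis image_image range_from_nat_into)
  moreover have "meagre (\<Union>n. A (from_nat_into I n))"
    using False by (intro meagre_UN assms(2) from_nat_into)
  ultimately show ?thesis by (simp only:)
qed

lemma meagre_Un:
  assumes "meagre A" "meagre B"
  shows "meagre (A \<union> B)"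
proof -
  have "meagre (\<Union>C\<in>{A, B}. C)"
    by (rule meagre_UN_countable) (use assms in auto)
  then show ?thesis by simp
qed

text \<open>The limit reads its \<open>i\<close>-th letter from \<open>P (Suc i)\<close>, which is
  long enough by \<open>len\<close>; as the words are prefixes of one another, every word reaching
  position \<open>i\<close> has the same letter there.\<close>

lemma prefix_chain_limit:
  fixes P :: "nat \<Rightarrow> 'k list"
  assumes P: "\<And>k. \<exists>u. P (Suc k) = P k @ u" and len: "\<And>k. k \<le> length (P k)"
  obtains z where "\<And>k. z \<in> cylinder (P k)"
proof
  have mono: "\<exists>u. P m = P k @ u" if "k \<le> m" for k m
    using that
  proof (induction m rule: dec_induct)
    case base
    show ?case by (rule exI[of _ "[]"]) simp
  next
    case (step m)
    then obtain u where "P m = P k @ u" by blast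
    moreover obtain v where "P (Suc m) = P m @ v" using P by blast
    ultimately show ?case by (intro exI[of _ "u @ v"]) (simp only: append_assoc)
  qed
  have "P (Suc i) ! i = P k ! i" if "i < length (P k)" for i k
  proof (cases "Suc i \<le> k")
    case True
    then obtain u where "P k = P (Suc i) @ u" using mono by blast
    then show ?thesis using len[of "Suc i"] by (simp add: nth_append)
  next
    case False
    then obtain u where "P (Suc i) = P k @ u" using mono[of k "Suc i"] by auto
    then show ?thesis using that by (simp add: nth_append)
  qed
  then show "(\<lambda>i. P (Suc i) ! i) \<in> cylinder (P k)" for k
    by (simp add: cylinder_def)
qed

text \<open>The Baire category theorem: \<open>s\<close> is extended so as to avoid one nowhere
  dense set after another, and the limit of the words lies in none of them.\<close>

theorem meagre_not_supset_cylinder: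
  assumes "meagre A"
  shows "\<not> cylinder s \<subseteq> A"
proof
  assume sA: "cylinder s \<subseteq> A"
  obtain N :: "nat \<Rightarrow> _" where N: "\<And>n. nowhere_dense (N n)" "A \<subseteq> (\<Union>n. N n)"
    using assms unfolding meagre_def by blast
  \<comment> \<open>The additional letter keeps each extension nonempty, so the words grow without
    bound.\<close>
  have ex: "\<exists>u. cylinder ((t @ [undefined]) @ u) \<inter> N n = {}" for t n
    using N(1) nowhere_dense_def by blast
  define e where "e t n = [undefined] @ (SOME u. cylinder ((t @ [undefined]) @ u) \<inter> N n = {})" for t n
  have e: "cylinder (t @ e t n) \<inter> N n = {}" for t n
    using someI_ex[OF ex[of t n]] by (simp add: e_def)
  define P where "P = rec_nat s (\<lambda>n t. t @ e t n)"
  have PS: "P (Suc n) = P n @ e (P n) n" and P0: "P 0 = s" for n by (simp_all add: P_def)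
  have "k \<le> length (P k)" for k
    by (induction k) (auto simp: PS e_def)
  then obtain z where z: "\<And>k. z \<in> cylinder (P k)"
    using prefix_chain_limit[of P] PS by blast
  have "z \<notin> N n" for n using z[of "Suc n"] e[of "P n" n] PS[of n] by auto
  moreover have "z \<in> A" using z[of 0] sA P0 by auto
  ultimately show False using N(2) by blast
qed

section \<open>Local category and the Souslin operation\<close>

definition nonmeagre_points :: "(nat \<Rightarrow> 'k) set \<Rightarrow> (nat \<Rightarrow> 'k) set" where
  "nonmeagre_points A = {y. \<forall>s. y \<in> cylinder s \<longrightarrow> \<not> meagre (A \<inter> cylinder s)}"

text \<open>Otherwise every cylinder inside \<open>cylinder s\<close> contains a point of some
  cylinder on which \<open>A\<close> is meagre. These cylinders then cover \<open>cylinder s\<close>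
  up to a nowhere dense set, and as there are only countably many words, \<open>A\<close> is meagre
  in \<open>cylinder s\<close>.\<close>

lemma nonmeagre_imp_cylinder:
  fixes A :: "(nat \<Rightarrow> 'k::countable) set"
  assumes "\<not> meagre (A \<inter> cylinder s)"
  obtains t where "cylinder (s @ t) \<subseteq> nonmeagre_points A"
proof (rule ccontr)
  assume "\<not> thesis"
  then have *: "\<exists>z\<in>cylinder (s @ t). z \<notin> nonmeagre_points A" for t
    using that by blast
  define S where "S = {t. meagre (A \<inter> cylinder t)}"
  have "nowhere_dense (cylinder s - (\<Union>t\<in>S. cylinder t))"
    unfolding nowhere_dense_def
  proof
    fix r
    show "\<exists>t. cylinder (r @ t) \<inter> (cylinder s - (\<Union>t\<in>S. cylinder t)) = {}"
    proof (cases "cylinder r \<inter> cylinder s = {}")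
      case True
      then show ?thesis by (intro exI[of _ "[]"]) auto
    next
      case False
      then obtain y where y: "y \<in> cylinder r" "y \<in> cylinder s" by blast
      \<comment> \<open>Two lengthenings follow: along \<open>y\<close> until the word extends
        \<open>s\<close>, and later along \<open>z\<close> until its cylinder lies inside
        \<open>cylinder q\<close>.\<close>
      obtain u where u: "y \<in> cylinder (r @ u)" "length (r @ u) = length r + length s"
        using cylinder_refine[OF y(1), where n = "length s"] by blast
      have "take (length s) (r @ u) = s"
      proof (rule nth_equalityI)
        fix i assume "i < length (take (length s) (r @ u))"
        then have i: "i < length s" "i < length (r @ u)" by simp_all
        then have "take (length s) (r @ u) ! i = y i"
          using u(1) unfolding cylinder_def by (metis (mono_tags, lifting) mem_Collect_eq nth_take)
        then show "take (length s) (r @ u) ! i = s ! i"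
          using y(2) i by (simp add: cylinder_def)
      qed (use u(2) in simp)
      then obtain v where v: "r @ u = s @ v" by (metis append_take_drop_id)
      then obtain z where z: "z \<in> cylinder (r @ u)" "z \<notin> nonmeagre_points A" using * by metis
      then obtain q where q: "z \<in> cylinder q" "q \<in> S" by (auto simp: nonmeagre_points_def S_def)
      obtain w where w: "z \<in> cylinder ((r @ u) @ w)" "length ((r @ u) @ w) = length (r @ u) + length q"
        using cylinder_refine[OF z(1), where n = "length q"] by blast
      have "cylinder ((r @ u) @ w) \<subseteq> cylinder q"
      proof
        fix x assume x: "x \<in> cylinder ((r @ u) @ w)"
        have "x i = q ! i" if "i < length q" for i
        proof -
          have "i < length ((r @ u) @ w)" using that w(2) by linarith
          then have "x i = z i" using x w(1) unfolding cylinder_def by auto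
          then show ?thesis using q(1) that by (simp add: cylinder_def)
        qed
        then show "x \<in> cylinder q" by (simp add: cylinder_def)
      qed
      then show ?thesis using q(2) by (intro exI[of _ "u @ w"]) auto
    qed
  qed
  moreover have "meagre (\<Union>t\<in>S. A \<inter> cylinder t)"
    by (rule meagre_UN_countable) (auto simp: S_def)
  ultimately have "meagre ((cylinder s - (\<Union>t\<in>S. cylinder t)) \<union> (\<Union>t\<in>S. A \<inter> cylinder t))"
    by (rule meagre_Un[OF nowhere_dense_imp_meagre])
  then have "meagre (A \<inter> cylinder s)" by (rule meagre_subset) auto
  then show False using assms by simp
qed

text \<open>The error made at one node of a Souslin scheme. If the union is nonmeagre in a cylinder,
  then so is some \<open>A n\<close>, and \<open>nonmeagre_points (A n)\<close> contains a smaller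
  cylinder.\<close>

lemma nowhere_dense_nonmeagre_points_UN:
  fixes A :: "nat \<Rightarrow> (nat \<Rightarrow> 'k::countable) set"
  shows "nowhere_dense (nonmeagre_points (\<Union>n. A n) - (\<Union>n. nonmeagre_points (A n)))"
  unfolding nowhere_dense_def
proof
  fix s
  show "\<exists>t. cylinder (s @ t) \<inter> (nonmeagre_points (\<Union>n. A n) - (\<Union>n. nonmeagre_points (A n))) = {}"
  proof (cases "cylinder s \<inter> nonmeagre_points (\<Union>n. A n) = {}")
    case True
    then show ?thesis by (intro exI[of _ "[]"]) auto
  next
    case False
    then have "\<not> meagre ((\<Union>n. A n) \<inter> cylinder s)" by (auto simp: nonmeagre_points_def)
    then obtain n where "\<not> meagre (A n \<inter> cylinder s)"
      using meagre_UN[of "\<lambda>n. A n \<inter> cylinder s"] by (metis Int_UN_distrib2 UN_extend_simps(4))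
    then obtain t where "cylinder (s @ t) \<subseteq> nonmeagre_points (A n)"
      by (rule nonmeagre_imp_cylinder)
    then show ?thesis by blast
  qed
qed

text \<open>Nikodym's argument that the Souslin operation preserves the Baire property.\<close>
theorem souslin_nonmeagre_imp_comeagre_cylinder:
  fixes A :: "nat list \<Rightarrow> (nat \<Rightarrow> 'k::countable) set"
  assumes cover: "\<And>s. A s \<subseteq> (\<Union>n. A (s @ [n]))"
    and limit: "\<And>b y. (\<And>n m. A (map b [0..<n]) \<inter> cylinder (map y [0..<m]) \<noteq> {}) \<Longrightarrow> y \<in> E"
    and nonmeagre: "\<not> meagre (A [])"
  obtains s where "meagre (cylinder s - E)"
proof -
  \<comment> \<open>The errors at all nodes, countably many. Outside \<open>M\<close>, a point at
    which \<open>A s\<close> is locally nonmeagre can be passed on to a child of \<open>s\<close>,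
    and so along a whole branch.\<close>
  define M where "M = (\<Union>s. nonmeagre_points (\<Union>n. A (s @ [n])) - (\<Union>n. nonmeagre_points (A (s @ [n]))))"
  have M: "meagre M"
    unfolding M_def by (intro meagre_UN_countable nowhere_dense_imp_meagre nowhere_dense_nonmeagre_points_UN) auto
  have mono: "nonmeagre_points (A s) \<subseteq> nonmeagre_points (\<Union>n. A (s @ [n]))" for s
    unfolding nonmeagre_points_def using cover[of s] meagre_subset by (smt (verit) Collect_mono Int_mono order_refl)
  have "y \<in> E" if y: "y \<in> nonmeagre_points (A [])" "y \<notin> M" for y
  proof -
    have step: "\<exists>n. y \<in> nonmeagre_points (A (s @ [n]))" if "y \<in> nonmeagre_points (A s)" for s
      using that y(2) mono[of s] unfolding M_def by blast
    define f where "f s = s @ [SOME n. y \<in> nonmeagre_points (A (s @ [n]))]" for s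
    have f: "y \<in> nonmeagre_points (A (f s))" if "y \<in> nonmeagre_points (A s)" for s
      using someI_ex[OF step[OF that]] by (simp add: f_def)
    define P where "P n = (f ^^ n) []" for n
    have PS: "P (Suc n) = f (P n)" and P0: "P 0 = []" for n by (simp_all add: P_def)
    have len: "length (P n) = n" for n by (induction n) (auto simp: PS P0 f_def)
    then obtain b where b: "\<And>n. b \<in> cylinder (P n)"
      using prefix_chain_limit[of P] PS f_def by (metis order_refl)
    have P: "y \<in> nonmeagre_points (A (P n))" for n
      by (induction n) (use y f in \<open>auto simp: PS P0\<close>)
    have "P n = map b [0..<n]" for n using b[of n] len[of n] by (simp add: cylinder_eq_map_upt)
    with P have "y \<in> nonmeagre_points (A (map b [0..<n]))" for n by metis
    moreover have "y \<in> cylinder (map y [0..<m])" for m by (simp add: in_cylinder_map_upt)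
    \<comment> \<open>\<open>limit\<close> asks for members of the sets along the branch arbitrarily
      near \<open>y\<close>; nonmeagre sets are nonempty and so provide them.\<close>
    ultimately have "\<not> meagre (A (map b [0..<n]) \<inter> cylinder (map y [0..<m]))" for n m
      unfolding nonmeagre_points_def by blast
    then have "A (map b [0..<n]) \<inter> cylinder (map y [0..<m]) \<noteq> {}" for n m
      using nowhere_dense_imp_meagre[OF nowhere_dense_empty] by metis
    then show ?thesis by (rule limit)
  qed
  moreover obtain s where "cylinder ([] @ s) \<subseteq> nonmeagre_points (A [])"
    by (rule nonmeagre_imp_cylinder[of "A []" "[]"]) (use nonmeagre in auto)
  ultimately have "cylinder s - E \<subseteq> M" by auto
  then show ?thesis using that M meagre_subset by blast
qed

section \<open>Block patterns and changes of one coordinate\<close>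

lemma nowhere_dense_avoid_finite:
  assumes "finite S" "nowhere_dense A"
  obtains w where "w \<noteq> []" "\<And>s. s \<in> S \<Longrightarrow> cylinder (s @ w) \<inter> A = {}"
proof -
  have "\<exists>w. w \<noteq> [] \<and> (\<forall>s\<in>S. cylinder (s @ w) \<inter> A = {})"
    using assms(1)
  proof (induction S rule: finite_induct)
    case empty
    show ?case by (rule exI[of _ "[undefined]"]) simp
  next
    case (insert r S)
    then obtain w where w: "w \<noteq> []" "\<And>s. s \<in> S \<Longrightarrow> cylinder (s @ w) \<inter> A = {}" by blast
    \<comment> \<open>Extending the common word for the new prefix \<open>r\<close> only shrinks the
      cylinders over the old prefixes.\<close>
    obtain v where "cylinder ((r @ w) @ v) \<inter> A = {}"
      using assms(2) unfolding nowhere_dense_def by blast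
    moreover have "cylinder ((s @ w) @ v) \<inter> A = {}" if "s \<in> S" for s
      using w(2)[OF that] cylinder_append[of "s @ w" v] by blast
    ultimately show ?case
      using w(1) by (intro exI[of _ "w @ v"]) (simp only: append_assoc append_is_Nil_conv, simp)
  qed
  then show ?thesis using that by blast
qed

text \<open>Over a finite alphabet there are finitely many words of length \<open>B k\<close>, so a
  single block of \<open>z\<close> can steer all of them away from the first nowhere dense sets. A
  sequence agreeing with \<open>z\<close> on infinitely many blocks is therefore generic, whatever
  it does elsewhere.\<close>

lemma meagre_block_pattern:
  fixes M :: "(nat \<Rightarrow> 'k::finite) set"
  assumes "meagre M"
  obtains z :: "nat \<Rightarrow> 'k" and B :: "nat \<Rightarrow> nat"
    where "strict_mono B" "B 0 = 0"
      "\<And>y. (\<And>m. \<exists>k\<ge>m. \<forall>i. B k \<le> i \<and> i < B (Suc k) \<longrightarrow> y i = z i) \<Longrightarrow> y \<notin> M"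
proof -
  obtain N :: "nat \<Rightarrow> _" where N: "\<And>n. nowhere_dense (N n)" "M \<subseteq> (\<Union>n. N n)"
    using assms unfolding meagre_def by blast
  \<comment> \<open>It is not known in advance which blocks will match. Block \<open>k\<close>
    therefore avoids all \<open>N j\<close> with \<open>j \<le> k\<close>, and any late match
    excludes a given \<open>N j\<close>.\<close>
  define N' where "N' k = (\<Union>j\<le>k. N j)" for k
  have "nowhere_dense (N' k)" for k unfolding N'_def by (intro nowhere_dense_UN_finite N) simp
  moreover have "finite {s :: 'k list. length s = n}" for n
    using finite_lists_length_eq[of "UNIV :: 'k set" n] by simp
  ultimately have "\<exists>w. w \<noteq> [] \<and> (\<forall>s. length s = n \<longrightarrow> cylinder (s @ w) \<inter> N' k = {})" for n k
    using nowhere_dense_avoid_finite[of "{s :: 'k list. length s = n}" "N' k"]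
    by (metis (mono_tags, lifting) mem_Collect_eq)
  then obtain e where e: "\<And>n k. e n k \<noteq> []"
      "\<And>n k s. length s = n \<Longrightarrow> cylinder (s @ e n k) \<inter> N' k = {}"
    by metis
  define P where "P = rec_nat [] (\<lambda>k p. p @ e (length p) k)"
  have PS: "P (Suc k) = P k @ e (length (P k)) k" and P0: "P 0 = []" for k by (simp_all add: P_def)
  define B where "B k = length (P k)" for k
  have smono: "strict_mono B"
    by (rule strict_mono_Suc_iff[THEN iffD2]) (use e(1) in \<open>simp add: B_def PS\<close>)
  have "k \<le> length (P k)" for k using strict_mono_imp_increasing[OF smono] by (simp add: B_def)
  then obtain z where z: "\<And>k. z \<in> cylinder (P k)"
    using prefix_chain_limit[of P] PS by blast
  show ?thesis
  proof (rule that[OF smono])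
    show "B 0 = 0" by (simp add: B_def P0)
    fix y assume y: "\<And>m. \<exists>k\<ge>m. \<forall>i. B k \<le> i \<and> i < B (Suc k) \<longrightarrow> y i = z i"
    show "y \<notin> M"
    proof
      assume "y \<in> M"
      then obtain j where j: "y \<in> N j" using N(2) by blast
      obtain k where k: "k \<ge> j" "\<And>i. B k \<le> i \<Longrightarrow> i < B (Suc k) \<Longrightarrow> y i = z i" using y by blast
      have "y i = (map y [0..<B k] @ e (B k) k) ! i" if i: "i < B k + length (e (B k) k)" for i
      proof (cases "i < B k")
        case False
        have "i < B (Suc k)" using i by (simp add: B_def PS)
        then have "y i = P (Suc k) ! i"
          using k(2)[of i] False z[of "Suc k"] by (simp add: B_def cylinder_def)
        then show ?thesis using False by (simp add: PS B_def nth_append)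
      qed (simp add: nth_append)
      then have "y \<in> cylinder (map y [0..<B k] @ e (B k) k)" by (simp add: cylinder_def)
      moreover have "y \<in> N' k" using j k(1) by (auto simp: N'_def)
      ultimately show False using e(2)[of "map y [0..<B k]" "B k" k] by auto
    qed
  qed
qed

text \<open>For a word that reaches past coordinate \<open>n\<close>, the modification carries its
  cylinder into that of the word with letter \<open>n\<close> rewritten.\<close>

lemma nowhere_dense_vimage_coordinate_involution:
  assumes A: "nowhere_dense A" and g: "\<And>a. g (g a) = a"
  shows "nowhere_dense {y. y(n := g (y n)) \<in> A}"
  unfolding nowhere_dense_def
proof
  fix s :: "'a list"
  \<comment> \<open>The padding guarantees that coordinate \<open>n\<close> belongs to the
    word.\<close>
  define s1 where "s1 = s @ replicate (Suc n) undefined"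
  have n: "n < length s1" by (simp add: s1_def)
  obtain u where u: "cylinder ((s1[n := g (s1 ! n)]) @ u) \<inter> A = {}"
    using A unfolding nowhere_dense_def by blast
  have "y(n := g (y n)) \<in> cylinder ((s1[n := g (s1 ! n)]) @ u)" if y: "y \<in> cylinder (s1 @ u)" for y
  proof -
    have "(y(n := g (y n))) i = ((s1[n := g (s1 ! n)]) @ u) ! i" if i: "i < length (s1 @ u)" for i
    proof (cases "i = n")
      case True
      have "y n = s1 ! n" using y n by (simp add: cylinder_def nth_append)
      then show ?thesis using True n by (simp add: nth_append)
    next
      case False
      have "y i = (s1 @ u) ! i" using y i unfolding cylinder_def by blast
      then show ?thesis using False by (simp add: nth_append)
    qed
    then show ?thesis by (simp add: cylinder_def)
  qed
  then have "cylinder (s1 @ u) \<inter> {y. y(n := g (y n)) \<in> A} = {}" using u by blast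
  then show "\<exists>t. cylinder (s @ t) \<inter> {y. y(n := g (y n)) \<in> A} = {}"
    by (intro exI[of _ "replicate (Suc n) undefined @ u"]) (simp only: s1_def append_assoc)
qed

lemma meagre_vimage_coordinate_involution:
  assumes A: "meagre A" and g: "\<And>a. g (g a) = a"
  shows "meagre {y. y(n := g (y n)) \<in> A}"
proof -
  obtain N :: "nat \<Rightarrow> _" where N: "\<And>n. nowhere_dense (N n)" "A \<subseteq> (\<Union>n. N n)"
    using assms unfolding meagre_def by blast
  have "{y. y(n := g (y n)) \<in> A} \<subseteq> (\<Union>k. {y. y(n := g (y n)) \<in> N k})"
    using N(2) by auto
  then show ?thesis
    using nowhere_dense_vimage_coordinate_involution[where g = g and n = n, OF N(1) g]
    unfolding meagre_def by (intro exI[of _ "\<lambda>k. {y. y(n := g (y n)) \<in> N k}"]) simp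
qed

text \<open>If \<open>E\<close> were non-meagre it would be comeagre in a cylinder. A generic point of the cylinder and
  its image under flipping a late first coordinate would both lie in \<open>E\<close>, so that transitivity
  relates two sequences differing in a single place.\<close>
lemma souslin_equivalence_meagre:
  fixes E :: "(nat \<Rightarrow> bool) \<Rightarrow> (nat \<Rightarrow> bool) \<Rightarrow> bool"
    and A :: "nat list \<Rightarrow> (nat \<Rightarrow> bool \<times> bool) set"
  assumes sym: "\<And>a b. E a b \<Longrightarrow> E b a" and trans: "\<And>a b c. E a b \<Longrightarrow> E b c \<Longrightarrow> E a c"
    and flip: "\<And>a n. \<not> E a (a(n := \<not> a n))"
    and Nil: "A [] = {y. E (fst \<circ> y) (snd \<circ> y)}"
    and cover: "\<And>s. A s \<subseteq> (\<Union>n. A (s @ [n]))"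
    and limit: "\<And>b y. (\<And>n m. A (map b [0..<n]) \<inter> cylinder (map y [0..<m]) \<noteq> {}) \<Longrightarrow> E (fst \<circ> y) (snd \<circ> y)"
  shows "meagre {y. E (fst \<circ> y) (snd \<circ> y)}"
proof (rule ccontr)
  let ?E = "{y. E (fst \<circ> y) (snd \<circ> y)}"
  assume "\<not> meagre ?E"
  then have "\<not> meagre (A [])" unfolding Nil .
  then obtain s where s: "meagre (cylinder s - ?E)"
    using souslin_nonmeagre_imp_comeagre_cylinder[of A ?E] cover limit by (metis (mono_tags, lifting) mem_Collect_eq)
  \<comment> \<open>The first coordinate not fixed by \<open>s\<close>: changing it does not leave
    \<open>cylinder s\<close>.\<close>
  define n where "n = length s"
  define g :: "bool \<times> bool \<Rightarrow> bool \<times> bool" where "g p = (\<not> fst p, snd p)" for p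
  have "g (g p) = p" for p by (simp add: g_def)
  from meagre_vimage_coordinate_involution[where g = g and n = n, OF s this]
  have "meagre ((cylinder s - ?E) \<union> {y. y(n := g (y n)) \<in> cylinder s - ?E})"
    by (rule meagre_Un[OF s])
  \<comment> \<open>Two meagre exceptional sets cannot cover the cylinder, so some \<open>y\<close>
    avoids both.\<close>
  then obtain y where y: "y \<in> cylinder s" "y \<notin> cylinder s - ?E" "y(n := g (y n)) \<notin> cylinder s - ?E"
    using meagre_not_supset_cylinder by blast
  have "y(n := g (y n)) \<in> cylinder s" using y(1) by (simp add: cylinder_def n_def)
  then have "E (fst \<circ> y(n := g (y n))) (snd \<circ> y(n := g (y n)))" using y(3) by blast
  moreover have "fst \<circ> y(n := g (y n)) = (fst \<circ> y)(n := \<not> (fst \<circ> y) n)"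
    "snd \<circ> y(n := g (y n)) = snd \<circ> y" by (auto simp: g_def fun_eq_iff)
  moreover have "E (fst \<circ> y) (snd \<circ> y)" using y by blast
  ultimately show False using flip sym trans by metis
qed

text \<open>The \<open>k\<close>-th block of \<open>F a\<close> is copied from the first or the second component of the pattern
  \<open>z\<close>, depending on whether the \<open>k\<close>-th binary word is a prefix of \<open>a\<close>. If \<open>a \<noteq> b\<close>, then no long prefix
  of \<open>a\<close> is a prefix of \<open>b\<close>, so that \<open>(F a, F b)\<close> agrees with \<open>z\<close> on infinitely many blocks.\<close>
theorem souslin_equivalence_perfect:
  fixes E :: "(nat \<Rightarrow> bool) \<Rightarrow> (nat \<Rightarrow> bool) \<Rightarrow> bool"
    and A :: "nat list \<Rightarrow> (nat \<Rightarrow> bool \<times> bool) set"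
  assumes sym: "\<And>a b. E a b \<Longrightarrow> E b a" and trans: "\<And>a b c. E a b \<Longrightarrow> E b c \<Longrightarrow> E a c"
    and flip: "\<And>a n. \<not> E a (a(n := \<not> a n))"
    and Nil: "A [] = {y. E (fst \<circ> y) (snd \<circ> y)}"
    and cover: "\<And>s. A s \<subseteq> (\<Union>n. A (s @ [n]))"
    and limit: "\<And>b y. (\<And>n m. A (map b [0..<n]) \<inter> cylinder (map y [0..<m]) \<noteq> {}) \<Longrightarrow> E (fst \<circ> y) (snd \<circ> y)"
  obtains F :: "(nat \<Rightarrow> bool) \<Rightarrow> (nat \<Rightarrow> bool)" where "\<And>a b. a \<noteq> b \<Longrightarrow> \<not> E (F a) (F b)"
proof -
  have "meagre {y. E (fst \<circ> y) (snd \<circ> y)}"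
    by (rule souslin_equivalence_meagre[of E A]) (fact assms)+
  then obtain z B where B: "strict_mono B" "B 0 = 0"
    and z: "\<And>y. (\<And>m. \<exists>k\<ge>m. \<forall>i. B k \<le> i \<and> i < B (Suc k) \<longrightarrow> y i = z i) \<Longrightarrow> y \<notin> {y. E (fst \<circ> y) (snd \<circ> y)}"
    by (rule meagre_block_pattern) blast
  define block where "block i = (LEAST k. i < B (Suc k))" for i
  have block: "block i = k" if "B k \<le> i" "i < B (Suc k)" for i k
    unfolding block_def
  proof (rule Least_equality)
    fix k' assume "i < B (Suc k')"
    then have "B k < B (Suc k')" using that by linarith
    then have "k < Suc k'" using B(1) strict_mono_less by blast
    then show "k \<le> k'" by simp
  qed (fact that(2))
  define F :: "(nat \<Rightarrow> bool) \<Rightarrow> (nat \<Rightarrow> bool)"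
    where "F a i = (if a \<in> cylinder (from_nat (block i)) then fst (z i) else snd (z i))" for a i
  have "\<not> E (F a) (F b)" if "a \<noteq> b" for a b
  proof -
    obtain d where d: "a d \<noteq> b d" using \<open>a \<noteq> b\<close> by blast
    define y where "y i = (F a i, F b i)" for i
    have "\<exists>k\<ge>m. \<forall>i. B k \<le> i \<and> i < B (Suc k) \<longrightarrow> y i = z i" for m
    proof -
      \<comment> \<open>Different prefixes of \<open>a\<close> have different codes, so prefixes
        reaching beyond \<open>d\<close> own blocks arbitrarily far out.\<close>
      have "inj (\<lambda>l. to_nat (map a [0..<l]))"
        by (intro injI) (metis diff_zero length_map length_upt to_nat_split inj_to_nat injD)
      then have "inj_on (\<lambda>l. to_nat (map a [0..<l])) {d<..}" by (rule inj_on_subset) simp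
      then have "infinite ((\<lambda>l. to_nat (map a [0..<l])) ` {d<..})"
        using finite_imageD infinite_Ioi by blast
      then obtain l where l: "l > d" "to_nat (map a [0..<l]) \<ge> m"
        unfolding infinite_nat_iff_unbounded_le by blast
      have "y i = z i" if "B (to_nat (map a [0..<l])) \<le> i" "i < B (Suc (to_nat (map a [0..<l])))" for i
        using block[OF that] d l(1) by (auto simp: y_def F_def in_cylinder_map_upt)
      then show ?thesis using l(2) by blast
    qed
    then have "y \<notin> {y. E (fst \<circ> y) (snd \<circ> y)}" by (rule z)
    then show ?thesis by (simp add: y_def comp_def)
  qed
  then show ?thesis by (rule that[of F])
qed

section \<open>Path congruences\<close>

lemma pathin_loop_join:
  assumes p: "pathin X p" and q: "pathin X q" and pq: "p 1 = q 0"
  shows "pathin X (loop_join p q)"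
  unfolding pathin_def loop_join_def
proof (rule continuous_map_cases_le)
  have "continuous_map (top_of_set {t. 0 \<le> t \<and> t \<le> 1 \<and> t \<le> 1/2}) (top_of_set {0..1}) ((*) (2::real))"
    by (auto intro!: continuous_intros)
  from continuous_map_compose[OF this p[unfolded pathin_def]]
  show "continuous_map (subtopology (top_of_set {0..1}) {x \<in> topspace (top_of_set {0..1}). x \<le> 1/2}) X (\<lambda>t. p (2 * t))"
    by (simp add: subtopology_subtopology comp_def Int_def conj_ac)
  have "continuous_map (top_of_set {t. 0 \<le> t \<and> t \<le> 1 \<and> 1/2 \<le> t}) (top_of_set {0..1}) (\<lambda>t::real. 2 * t - 1)"
    by (auto intro!: continuous_intros)
  from continuous_map_compose[OF this q[unfolded pathin_def]]
  show "continuous_map (subtopology (top_of_set {0..1}) {x \<in> topspace (top_of_set {0..1}). 1/2 \<le> x}) X (\<lambda>t. q (2 * t - 1))"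
    by (simp add: subtopology_subtopology comp_def Int_def conj_ac)
  show "p (2 * t) = q (2 * t - 1)" if "t = 1/2" for t
  proof -
    have "2 * t = 1" using that by linarith
    then show ?thesis using pq by (simp only:) simp
  qed
qed auto

lemma loop_join_0 [simp]: "loop_join p q 0 = p 0"
  and loop_join_1 [simp]: "loop_join p q 1 = q 1"
  by (simp_all add: loop_join_def)

section \<open>Reversal, segments and reparametrisation\<close>

definition path_rev :: "(real \<Rightarrow> 'a) \<Rightarrow> real \<Rightarrow> 'a" where
  "path_rev p = (\<lambda>t. p (1 - t))"

lemma path_rev_0 [simp]: "path_rev p 0 = p 1"
  and path_rev_1 [simp]: "path_rev p 1 = p 0"
  and path_rev_rev [simp]: "path_rev (path_rev p) = p"
  by (simp_all add: path_rev_def)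

definition path_segment :: "(real \<Rightarrow> 'a) \<Rightarrow> real \<Rightarrow> real \<Rightarrow> real \<Rightarrow> 'a" where
  "path_segment p a b = (\<lambda>t. p (a + (b - a) * t))"

lemma path_segment_0 [simp]: "path_segment p a b 0 = p a"
  and path_segment_1 [simp]: "path_segment p a b 1 = p b"
  and path_segment_0_1 [simp]: "path_segment p 0 1 = p"
  by (simp_all add: path_segment_def)

lemma pathin_reparam:
  assumes "pathin X w" "continuous_on {0..1} f" "f ` {0..1} \<subseteq> {0..1}"
  shows "pathin X (w \<circ> f)"
  using assms unfolding pathin_def
  by (intro continuous_map_compose[where X' = "top_of_set {0..1}"]) (auto simp: continuous_map_in_subtopology)

lemma pathin_rev [simp]: "pathin X p \<Longrightarrow> pathin X (path_rev p)"
  using pathin_reparam[of X p "\<lambda>t. 1 - t"] continuous_on_op_minus[of "{0..1}" "1::real"]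
  by (auto simp: path_rev_def comp_def)

lemma segment_point_in_unit_interval:
  fixes a b t :: real
  assumes "a \<in> {0..1}" "b \<in> {0..1}" "t \<in> {0..1}"
  shows "a + (b - a) * t \<in> {0..1}"
proof -
  have "a + (b - a) * t = (1 - t) * a + t * b" by algebra
  moreover have "(1 - t) * a + t * b \<le> (1 - t) * 1 + t * 1"
    using assms by (intro add_mono mult_left_mono) auto
  moreover have "0 \<le> (1 - t) * a + t * b" using assms by simp
  ultimately show ?thesis by simp
qed

lemma pathin_segment:
  assumes "pathin X p" "a \<in> {0..1}" "b \<in> {0..1}"
  shows "pathin X (path_segment p a b)"
proof -
  have "pathin X (p \<circ> (\<lambda>t. a + (b - a) * t))"
    using segment_point_in_unit_interval assms(2,3) by (intro pathin_reparam assms(1) continuous_intros) blast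
  then show ?thesis by (simp add: path_segment_def comp_def)
qed

text \<open>What homotopy and homology of paths have in common. Containing homotopy relative to the
  end points yields the groupoid laws up to \<open>R\<close>; compatibility with joins then permits
  cancellation.\<close>

locale path_congruence =
  fixes X :: "'a topology" and R :: "(real \<Rightarrow> 'a) \<Rightarrow> (real \<Rightarrow> 'a) \<Rightarrow> bool"
  assumes R_path: "R p q \<Longrightarrow> pathin X p \<and> pathin X q \<and> p 0 = q 0 \<and> p 1 = q 1"
    and R_homotopic: "homotopic_with (\<lambda>r. r 0 = x \<and> r 1 = y) (top_of_set {0..1}) X p q \<Longrightarrow> R p q"
    and R_sym: "R p q \<Longrightarrow> R q p"
    and R_trans [trans]: "R p q \<Longrightarrow> R q r \<Longrightarrow> R p r"
    and R_join: "R p p' \<Longrightarrow> R q q' \<Longrightarrow> p 1 = q 0 \<Longrightarrow> R (loop_join p q) (loop_join p' q')"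
begin

section \<open>Groupoid laws up to congruence\<close>

lemma R_cong:
  assumes "pathin X p" "\<And>t. t \<in> {0..1} \<Longrightarrow> p t = q t"
  shows "R p q"
proof (rule R_homotopic)
  show "homotopic_with (\<lambda>r. r 0 = p 0 \<and> r 1 = p 1) (top_of_set {0..1}) X p q"
    using assms by (intro homotopic_with_equal) (auto simp: pathin_def)
qed

lemma R_refl: "pathin X p \<Longrightarrow> R p p"
  by (rule R_cong) auto

text \<open>Source of all the laws below: \<open>f\<close> and \<open>g\<close> are joined by a
  straight line homotopy in the convex set \<open>{0..1}\<close>, which is then composed with
  \<open>w\<close>.\<close>

lemma R_reparam:
  assumes w: "pathin X w"
    and f: "continuous_on {0..1} f" "\<And>t. t \<in> {0..1} \<Longrightarrow> f t \<in> {0..1}"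
    and g: "continuous_on {0..1} g" "\<And>t. t \<in> {0..1} \<Longrightarrow> g t \<in> {0..1}"
    and ends: "f 0 = g 0" "f 1 = g 1"
    and p: "\<And>t. t \<in> {0..1} \<Longrightarrow> p t = w (f t)" and q: "\<And>t. t \<in> {0..1} \<Longrightarrow> q t = w (g t)"
  shows "R p q"
proof -
  have "closed_segment (f t) (g t) \<subseteq> {0..1}" if "t \<in> {0..1}" for t
    using f(2)[OF that] g(2)[OF that] by (intro closed_segment_subset) auto
  then have "homotopic_paths {0..1} f g"
    using f(1) g(1) ends by (intro homotopic_paths_linear) (auto simp: path_def pathstart_def pathfinish_def)
  then have "homotopic_with_canon (\<lambda>r. r 0 = f 0 \<and> r 1 = f 1) {0..1} {0..1} f g"
    by (simp add: homotopic_paths_def pathstart_def pathfinish_def)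
  then have "homotopic_with (\<lambda>r. r 0 = w (f 0) \<and> r 1 = w (f 1)) (top_of_set {0..1}) X (w \<circ> f) (w \<circ> g)"
    by (rule homotopic_with_compose_continuous_map_left) (use w in \<open>auto simp: pathin_def\<close>)
  then have "R (w \<circ> f) (w \<circ> g)" by (rule R_homotopic)
  moreover from this have "pathin X (w \<circ> f)" "pathin X (w \<circ> g)" using R_path by blast+
  ultimately show ?thesis
    using R_cong[of "w \<circ> f" p] R_cong[of "w \<circ> g" q] p q by (metis R_sym R_trans comp_apply)
qed

lemma R_assoc:
  assumes "pathin X p" "pathin X q" "pathin X r" "p 1 = q 0" "q 1 = r 0"
  shows "R (loop_join (loop_join p q) r) (loop_join p (loop_join q r))"
proof (rule R_reparam)
  show "pathin X (loop_join p (loop_join q r))" using assms by (intro pathin_loop_join) auto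
  \<comment> \<open>The change of parameter has breakpoints 1/4 and 1/2 and decreasing slopes 2, 1,
    1/2. It is concave, hence the minimum of its three linear pieces, and continuity needs no
    pasting.\<close>
  show "continuous_on {0..1} (\<lambda>t::real. min (2 * t) (min (t + 1/4) (t/2 + 1/2)))"
    by (intro continuous_intros) auto
  show "continuous_on {0..1} (\<lambda>t::real. t)" by (intro continuous_intros)
  fix t :: real assume t: "t \<in> {0..1}"
  consider "t \<le> 1/4" | "1/4 < t" "t \<le> 1/2" | "1/2 < t" by linarith
  then show "loop_join (loop_join p q) r t = loop_join p (loop_join q r) (min (2 * t) (min (t + 1/4) (t/2 + 1/2)))"
  proof cases
    case 1
    then have "min (2 * t) (min (t + 1/4) (t/2 + 1/2)) = 2 * t" by auto
    then show ?thesis using 1 by (simp add: loop_join_def)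
  next
    case 2
    then have m: "min (2 * t) (min (t + 1/4) (t/2 + 1/2)) = t + 1/4" by auto
    have "2 * (2 * (t + 1/4) - 1) = 2 * (2 * t) - 1" by simp
    then show ?thesis using 2 unfolding m by (simp add: loop_join_def)
  next
    case 3
    then have m: "min (2 * t) (min (t + 1/4) (t/2 + 1/2)) = t/2 + 1/2" by auto
    have "2 * (2 * (t/2 + 1/2) - 1) - 1 = 2 * t - 1" by simp
    then show ?thesis using 3 unfolding m by (simp add: loop_join_def)
  qed
qed (auto simp: min_def)

lemma R_left_unit:
  assumes "pathin X p" "x = p 0"
  shows "R (loop_join (\<lambda>_. x) p) p"
  by (rule R_reparam[OF assms(1), where f = "\<lambda>t. max 0 (2 * t - 1)" and g = "\<lambda>t. t"])
    (auto simp: loop_join_def max_absorb1 max_absorb2 assms(2) intro!: continuous_intros)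

lemma R_right_unit:
  assumes "pathin X p" "x = p 1"
  shows "R (loop_join p (\<lambda>_. x)) p"
  by (rule R_reparam[OF assms(1), where f = "\<lambda>t. min 1 (2 * t)" and g = "\<lambda>t. t"])
    (auto simp: loop_join_def min_absorb1 min_absorb2 assms(2) intro!: continuous_intros)

text \<open>Going along \<open>p\<close> and back is \<open>p\<close> composed with a tent map that,
  like the constant map, begins and ends at 0.\<close>

lemma R_right_inverse:
  assumes "pathin X p" "x = p 0"
  shows "R (loop_join p (path_rev p)) (\<lambda>_. x)"
  by (rule R_reparam[OF assms(1), where f = "\<lambda>t. min (2 * t) (2 - 2 * t)" and g = "\<lambda>t. 0"])
    (auto simp: loop_join_def path_rev_def min_absorb1 min_absorb2 assms(2) intro!: continuous_intros)

lemma R_left_inverse: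
  assumes "pathin X p" "x = p 1"
  shows "R (loop_join (path_rev p) p) (\<lambda>_. x)"
  using R_right_inverse[of "path_rev p" x] assms by simp

lemma R_segment_join:
  assumes "pathin X p" "a \<in> {0..1}" "b \<in> {0..1}" "c \<in> {0..1}"
  shows "R (loop_join (path_segment p a b) (path_segment p b c)) (path_segment p a c)"
proof (rule R_reparam[OF assms(1)])
  \<comment> \<open>Clipping makes the second leg wait at 0 during the first half and the first leg
    stay complete during the second half.\<close>
  let ?f = "\<lambda>t. a + (b - a) * min 1 (2 * t) + (c - b) * max 0 (2 * t - 1)"
  show "continuous_on {0..1} ?f" "continuous_on {0..1} (\<lambda>t. a + (c - a) * t)"
    by (intro continuous_intros)+
  fix t :: real assume t: "t \<in> {0..1}"
  have le: "?f t = a + (b - a) * (2 * t)" if "t \<le> 1/2" using that by simp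
  have ge: "?f t = b + (c - b) * (2 * t - 1)" if "\<not> t \<le> 1/2" using that by simp
  show "?f t \<in> {0..1}"
    using segment_point_in_unit_interval[of a b "2 * t"] segment_point_in_unit_interval[of b c "2 * t - 1"]
      assms t le ge by (cases "t \<le> 1/2") auto
  show "a + (c - a) * t \<in> {0..1}" using segment_point_in_unit_interval assms t by blast
  show "loop_join (path_segment p a b) (path_segment p b c) t = p (?f t)"
    using le ge by (cases "t \<le> 1/2") (simp_all add: loop_join_def path_segment_def)
qed (auto simp: path_segment_def)

lemma R_insert_left:
  assumes "pathin X p" "pathin X u" "p 1 = u 0"
  shows "R u (loop_join (path_rev p) (loop_join p u))"
proof -
  have "R (loop_join (loop_join (path_rev p) p) u) (loop_join (\<lambda>_. u 0) u)"
    using assms by (intro R_join R_left_inverse R_refl) auto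
  also have "R \<dots> u" using assms by (intro R_left_unit) auto
  finally have "R u (loop_join (loop_join (path_rev p) p) u)" by (rule R_sym)
  also have "R \<dots> (loop_join (path_rev p) (loop_join p u))"
    using assms by (intro R_assoc) auto
  finally show ?thesis .
qed

lemma R_insert_right:
  assumes "pathin X p" "pathin X u" "p 1 = u 0"
  shows "R p (loop_join (loop_join p u) (path_rev u))"
proof -
  have "R (loop_join p (loop_join u (path_rev u))) (loop_join p (\<lambda>_. p 1))"
    using assms by (intro R_join R_right_inverse R_refl) auto
  also have "R \<dots> p" using assms by (intro R_right_unit) auto
  finally have "R p (loop_join p (loop_join u (path_rev u)))" by (rule R_sym)
  also have "R \<dots> (loop_join (loop_join p u) (path_rev u))"
    using assms by (intro R_sym[OF R_assoc]) auto
  finally show ?thesis .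
qed

lemma R_cancel_left:
  assumes "R (loop_join p u) (loop_join p v)" "pathin X p" "pathin X u" "pathin X v" "p 1 = u 0" "p 1 = v 0"
  shows "R u v"
proof -
  have "R u (loop_join (path_rev p) (loop_join p u))" using assms by (intro R_insert_left)
  also have "R \<dots> (loop_join (path_rev p) (loop_join p v))"
    using assms by (intro R_join[OF R_refl assms(1)]) auto
  also have "R \<dots> v" using assms by (intro R_sym[OF R_insert_left])
  finally show ?thesis .
qed

lemma R_cancel_right:
  assumes "R (loop_join p u) (loop_join q u)" "pathin X p" "pathin X q" "pathin X u" "p 1 = u 0" "q 1 = u 0"
  shows "R p q"
proof -
  have "R p (loop_join (loop_join p u) (path_rev u))" using assms by (intro R_insert_right)
  also have "R \<dots> (loop_join (loop_join q u) (path_rev u))"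
    using assms by (intro R_join[OF assms(1) R_refl]) auto
  also have "R \<dots> q" using assms by (intro R_sym[OF R_insert_right])
  finally show ?thesis .
qed

end

section \<open>Locally trivial path congruences\<close>

lemma pathin_ball_image:
  assumes p: "pathin X p" and D: "openin X D" and a: "a \<in> {0..1}" "p a \<in> D"
  obtains e where "e > 0" "p ` (ball a e \<inter> {0..1}) \<subseteq> D"
proof -
  define T where "T = {t \<in> topspace (top_of_set {0..1}). p t \<in> D}"
  have "openin (top_of_set {0..1}) T"
    using p D unfolding pathin_def T_def by (rule openin_continuous_map_preimage)
  then have "\<forall>s\<in>T. \<exists>e>0. ball s e \<inter> {0..1} \<subseteq> T" unfolding openin_contains_ball by (rule conjunct2)
  moreover have "a \<in> T" using a by (simp add: T_def)
  ultimately obtain e where e: "e > 0" "ball a e \<inter> {0..1} \<subseteq> T" by blast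
  show ?thesis
  proof (rule that)
    show "p ` (ball a e \<inter> {0..1}) \<subseteq> D" using e(2) by (auto simp: T_def)
  qed (fact e(1))
qed

context path_congruence
begin

text \<open>A relative form of simple connectedness: the compared paths stay in \<open>V\<close>,
  while their congruence takes place in \<open>X\<close>, as in semilocal simple
  connectedness.\<close>

definition R_simple :: "'a set \<Rightarrow> bool" where
  "R_simple V \<longleftrightarrow> openin X V \<and> path_connectedin X V \<and>
     (\<forall>p q. pathin X p \<and> pathin X q \<and> p ` {0..1} \<subseteq> V \<and> q ` {0..1} \<subseteq> V \<and> p 0 = q 0 \<and> p 1 = q 1 \<longrightarrow> R p q)"

definition loop_classes :: "'a \<Rightarrow> (real \<Rightarrow> 'a) set set" where
  "loop_classes x = (\<lambda>p. {q \<in> loops_at X x. R p q}) ` loops_at X x"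

lemma loop_class_eq:
  assumes "R p q"
  shows "{r \<in> loops_at X x. R p r} = {r \<in> loops_at X x. R q r}"
proof -
  have "R p r \<longleftrightarrow> R q r" for r
    using R_trans[OF assms] R_trans[OF R_sym[OF assms]] by metis
  then show ?thesis by simp
qed

lemma R_simpleD:
  assumes "R_simple V" "pathin X p" "pathin X q" "p ` {0..1} \<subseteq> V" "q ` {0..1} \<subseteq> V" "p 0 = q 0" "p 1 = q 1"
  shows "R p q"
  using assms unfolding R_simple_def by blast

lemma R_simple_path:
  assumes "R_simple V" "y \<in> V" "z \<in> V"
  shows "\<exists>e. pathin X e \<and> e ` {0..1} \<subseteq> V \<and> e 0 = y \<and> e 1 = z"
  using assms unfolding R_simple_def path_connectedin by (metis image_subset_iff_funcset)

lemma loop_join_image: "p ` {0..1} \<subseteq> V \<Longrightarrow> q ` {0..1} \<subseteq> V \<Longrightarrow> loop_join p q ` {0..1} \<subseteq> V"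
  by (auto simp: loop_join_def)

lemma path_segment_image:
  assumes "a \<in> {0..1}" "b \<in> {0..1}"
  shows "path_segment p a b ` {0..1} \<subseteq> p ` closed_segment a b"
proof -
  have "a + (b - a) * t \<in> closed_segment a b" if "t \<in> {0..1}" for t
    using that by (auto simp: in_segment algebra_simps intro!: exI[of _ t])
  then show ?thesis by (auto simp: path_segment_def)
qed

text \<open>Members of a countable base need not be \<open>R_simple\<close>. Instead, one
  \<open>R_simple\<close> set is chosen between each pair of base sets that admits one, and there
  are countably many pairs.\<close>

lemma countable_R_simple_base:
  assumes sc: "second_countable X"
    and simple: "\<And>U y. openin X U \<Longrightarrow> y \<in> U \<Longrightarrow> \<exists>V. R_simple V \<and> y \<in> V \<and> V \<subseteq> U"
  obtains \<B> where "countable \<B>" "\<And>V. V \<in> \<B> \<Longrightarrow> R_simple V"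
    "\<And>U y. openin X U \<Longrightarrow> y \<in> U \<Longrightarrow> \<exists>V\<in>\<B>. y \<in> V \<and> V \<subseteq> U"
proof -
  obtain \<O> where O: "countable \<O>" "\<And>V. V \<in> \<O> \<Longrightarrow> openin X V"
    "\<And>U y. openin X U \<Longrightarrow> y \<in> U \<Longrightarrow> \<exists>V\<in>\<O>. y \<in> V \<and> V \<subseteq> U"
    using sc unfolding second_countable_def by metis
  define ok where "ok P F \<longleftrightarrow> R_simple F \<and> fst P \<subseteq> F \<and> F \<subseteq> snd P" for P F
  define \<B> where "\<B> = (\<lambda>P. SOME F. ok P F) ` {P \<in> \<O> \<times> \<O>. \<exists>F. ok P F}"
  show ?thesis
  proof (rule that)
    have "countable (\<O> \<times> \<O>)" using O(1) by simp
    then have "countable {P \<in> \<O> \<times> \<O>. \<exists>F. ok P F}" by (rule countable_subset[rotated]) auto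
    then show "countable \<B>" unfolding \<B>_def by simp
    have ok: "ok P (SOME F. ok P F)" if "\<exists>F. ok P F" for P using someI_ex[OF that] .
    show "R_simple V" if V: "V \<in> \<B>" for V
    proof -
      obtain P where "\<exists>F. ok P F" "V = (SOME F. ok P F)" using V unfolding \<B>_def by blast
      then have "ok P V" using ok[of P] by (simp only:)
      then show ?thesis unfolding ok_def by (rule conjunct1)
    qed
    fix U y assume "openin X U" "y \<in> U"
    then obtain O2 where O2: "O2 \<in> \<O>" "y \<in> O2" "O2 \<subseteq> U" using O(3) by blast
    then obtain F where F: "R_simple F" "y \<in> F" "F \<subseteq> O2" using simple O(2) by blast
    then obtain O1 where O1: "O1 \<in> \<O>" "y \<in> O1" "O1 \<subseteq> F" using O(3) by (metis R_simple_def)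
    have ex: "\<exists>F. ok (O1, O2) F" using F O1 by (auto simp: ok_def)
    then have "(SOME F. ok (O1, O2) F) \<in> \<B>" unfolding \<B>_def using O1 O2 by blast
    moreover have "O1 \<subseteq> (SOME F. ok (O1, O2) F)" "(SOME F. ok (O1, O2) F) \<subseteq> O2"
      using ok[OF ex] unfolding ok_def[of "(O1, O2)" "SOME F. ok (O1, O2) F"] by simp_all
    ultimately show "\<exists>V\<in>\<B>. y \<in> V \<and> V \<subseteq> U" using O1(2) O2(3) by blast
  qed
qed

text \<open>A path is followed through successive basic sets, passing from \<open>B\<close> to the next one through a
  basic subset \<open>C\<close> of their intersection. The chosen connecting paths \<open>W L\<close> depend only on the list
  \<open>L\<close> of these pairs, and there are countably many lists.\<close>
theorem countable_loop_classes:
  assumes sc: "second_countable X"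
    and simple: "\<And>U y. openin X U \<Longrightarrow> y \<in> U \<Longrightarrow> \<exists>V. R_simple V \<and> y \<in> V \<and> V \<subseteq> U"
    and x: "x \<in> topspace X"
  shows "countable (loop_classes x)"
proof -
  obtain \<B> where \<B>: "countable \<B>" "\<And>V. V \<in> \<B> \<Longrightarrow> R_simple V"
    "\<And>U y. openin X U \<Longrightarrow> y \<in> U \<Longrightarrow> \<exists>V\<in>\<B>. y \<in> V \<and> V \<subseteq> U"
    using countable_R_simple_base[OF sc simple] by metis
  define link where "link y P e \<longleftrightarrow>
      pathin X e \<and> e ` {0..1} \<subseteq> fst P \<and> e 0 = y \<and> e 1 = (SOME c. c \<in> snd P)" for y :: 'a and P :: "'a set \<times> 'a set" and e
  define W where "W = rec_list (\<lambda>_. x) (\<lambda>P _ w. loop_join w (SOME e. link (w 1) P e))"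
  have W_Nil: "W [] = (\<lambda>_. x)" and W_Cons: "W (P # L) = loop_join (W L) (SOME e. link (W L 1) P e)" for P L
    by (simp_all add: W_def)
  \<comment> \<open>Invariant: up to time \<open>t\<close>, \<open>p\<close> is congruent to the
    standard path \<open>W L\<close> followed by a path inside the current set \<open>B\<close>. The
    most recent pair is at the head of \<open>L\<close>.\<close>
  define good where "good p t L B \<longleftrightarrow> L \<in> lists (\<B> \<times> \<B>) \<and> B \<in> \<B> \<and> pathin X (W L) \<and>
    (\<exists>c. pathin X c \<and> c ` {0..1} \<subseteq> B \<and> c 0 = W L 1 \<and> c 1 = p t \<and> R (path_segment p 0 t) (loop_join (W L) c))" for p t L B
  have step: "\<exists>L B. good p t L B"
    if p: "pathin X p" and s: "s \<in> {0..1}" and t: "t \<in> {0..1}" and D: "D \<in> \<B>" "p ` closed_segment s t \<subseteq> D"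
      and g: "good p s L B" for p s t D L B
  proof -
    obtain c where L: "L \<in> lists (\<B> \<times> \<B>)" "B \<in> \<B>" "pathin X (W L)"
      and c: "pathin X c" "c ` {0..1} \<subseteq> B" "c 0 = W L 1" "c 1 = p s" "R (path_segment p 0 s) (loop_join (W L) c)"
      using g unfolding good_def by blast
    have "p s \<in> D" using D(2) by auto
    moreover have "p s \<in> B" using c(2,4) by (metis atLeastAtMost_iff image_subset_iff order_refl zero_le_one)
    moreover have "openin X (B \<inter> D)" using \<B>(2) L(2) D(1) unfolding R_simple_def by blast
    ultimately obtain C where C: "C \<in> \<B>" "p s \<in> C" "C \<subseteq> B" "C \<subseteq> D" using \<B>(3) by (metis IntI le_inf_iff)
    define z where "z = (SOME c. c \<in> C)"
    have z: "z \<in> C" unfolding z_def using C(2) by (rule someI)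
    have "W L 1 \<in> B" using c(2,3) by force
    then obtain e where "link (W L 1) (B, C) e"
      using R_simple_path[OF \<B>(2)[OF L(2)], of "W L 1" z] subsetD[OF C(3) z]
      unfolding link_def z_def fst_conv snd_conv by metis
    then have "link (W L 1) (B, C) (SOME e. link (W L 1) (B, C) e)" by (rule someI[of "link (W L 1) (B, C)"])
    then obtain e where e: "pathin X e" "e ` {0..1} \<subseteq> B" "e 0 = W L 1" "e 1 = z"
      and We: "W ((B, C) # L) = loop_join (W L) e"
      unfolding link_def z_def W_Cons by auto
    obtain k where k: "pathin X k" "k ` {0..1} \<subseteq> C" "k 0 = z" "k 1 = p s"
      using R_simple_path[OF \<B>(2)[OF C(1)] z C(2)] by blast
    have seg: "pathin X (path_segment p a b)" if "a \<in> {0..1}" "b \<in> {0..1}" for a b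
      using pathin_segment p that by blast
    have 0: "(0::real) \<in> {0..1}" by simp
    let ?u = "path_segment p s t"
    \<comment> \<open>Inside \<open>B\<close> the unknown path \<open>c\<close> is replaced by the
      chosen link \<open>e\<close> to \<open>z\<close>, followed by \<open>k\<close> in
      \<open>C\<close>. Since \<open>C\<close> also lies in \<open>D\<close>, \<open>k\<close> can
      be absorbed into the new final path.\<close>
    have ek: "R c (loop_join e k)"
    proof (rule R_simpleD[OF \<B>(2)[OF L(2)]])
      show "pathin X (loop_join e k)" using e k by (intro pathin_loop_join) simp_all
      show "loop_join e k ` {0..1} \<subseteq> B" by (rule loop_join_image[OF e(2) subset_trans[OF k(2) C(3)]])
    qed (use c e k in simp_all)
    have "R (path_segment p 0 t) (loop_join (path_segment p 0 s) ?u)"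
      using R_segment_join[OF p 0 s t] by (rule R_sym)
    also have "R \<dots> (loop_join (loop_join (W L) c) ?u)"
      by (intro R_join c R_refl seg s t) simp
    also have "R \<dots> (loop_join (loop_join (W L) (loop_join e k)) ?u)"
      using c by (intro R_join R_refl ek seg s t L) auto
    also have "R \<dots> (loop_join (loop_join (loop_join (W L) e) k) ?u)"
      using e k L by (intro R_join[OF R_sym[OF R_assoc] R_refl] seg s t) auto
    also have "R \<dots> (loop_join (loop_join (W L) e) (loop_join k ?u))"
      using e k L by (intro R_assoc pathin_loop_join seg s t) auto
    finally have "R (path_segment p 0 t) (loop_join (W ((B, C) # L)) (loop_join k ?u))"
      by (simp only: We)
    moreover have "loop_join k ?u ` {0..1} \<subseteq> D"
      using k(2) C(4) D(2) path_segment_image[OF s t, of p] by (intro loop_join_image) auto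
    moreover have "pathin X (loop_join k ?u)" using k by (intro pathin_loop_join seg s t) auto
    moreover have "pathin X (W ((B, C) # L))" unfolding We using L e by (intro pathin_loop_join) auto
    moreover have "(B, C) # L \<in> lists (\<B> \<times> \<B>)" using L C by simp
    ultimately have "good p t ((B, C) # L) D"
      unfolding good_def using D(1) k e We by (intro conjI exI[of _ "loop_join k ?u"]) auto
    then show ?thesis by blast
  qed
  have ex: "\<exists>L B. good p 1 L B" if p: "p \<in> loops_at X x" for p
  proof -
    have pin: "pathin X p" and p0: "p 0 = x" using p by (auto simp: loops_at_def)
    have "\<exists>P. good p 1 (fst P) (snd P)"
    \<comment> \<open>Near each time the invariant passes between any two times in either direction,
      so connectedness of the interval takes the place of a subdivision.\<close>
    proof (rule connected_induction_simple[of "{0..1::real}" 0 1 "\<lambda>t. \<exists>P. good p t (fst P) (snd P)"])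
      obtain B where B: "B \<in> \<B>" "x \<in> B" using \<B>(3)[OF openin_topspace x] by blast
      have "R (loop_join (\<lambda>_. x) (\<lambda>_. x)) (\<lambda>_. x)" using x by (intro R_left_unit) auto
      then have "R (path_segment p 0 0) (loop_join (W []) (\<lambda>_. x))"
        using R_sym by (simp add: path_segment_def p0 W_Nil)
      then have "good p 0 [] B"
        unfolding good_def using B x p0 by (intro conjI exI[of _ "\<lambda>_. x"]) (auto simp: W_Nil)
      then show "\<exists>P. good p 0 (fst P) (snd P)" by auto
      fix a :: real assume a: "a \<in> {0..1}"
      then have "p a \<in> topspace X" using path_image_subset_topspace[OF pin] by blast
      then obtain D where D: "D \<in> \<B>" "p a \<in> D" using \<B>(3)[OF openin_topspace] by blast
      then obtain e where e: "e > 0" "p ` (ball a e \<inter> {0..1}) \<subseteq> D"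
        using pathin_ball_image[OF pin _ a] \<B>(2)[OF D(1)] unfolding R_simple_def by blast
      have "\<exists>P. good p t (fst P) (snd P)"
        if "s \<in> ball a e \<inter> {0..1}" "t \<in> ball a e \<inter> {0..1}" "\<exists>P. good p s (fst P) (snd P)" for s t
      proof -
        have "convex (ball a e \<inter> {0..1})" by (intro convex_Int) auto
        then have "closed_segment s t \<subseteq> ball a e \<inter> {0..1}" using that closed_segment_subset by blast
        then have "p ` closed_segment s t \<subseteq> D" by (rule subset_trans[OF image_mono e(2)])
        then show ?thesis using step[OF pin _ _ D(1), of s t] that by (metis IntD2 fst_conv snd_conv)
      qed
      moreover have "openin (top_of_set {0..1}) (ball a e \<inter> {0..1})"
        unfolding Int_commute[of "ball a e"] by (rule openin_open_Int) simp
      moreover have "a \<in> ball a e \<inter> {0..1}" using a e(1) by simp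
      ultimately show "\<exists>T. openin (top_of_set {0..1}) T \<and> a \<in> T \<and>
          (\<forall>s\<in>T. \<forall>t\<in>T. (\<exists>P. good p s (fst P) (snd P)) \<longrightarrow> (\<exists>P. good p t (fst P) (snd P)))"
        by metis
    qed auto
    then show ?thesis by blast
  qed
  \<comment> \<open>Both loops share \<open>W L\<close>, and their final paths lie in the same set
    \<open>B\<close> with equal end points.\<close>
  have same: "R p q" if "good p 1 L B" "good q 1 L B" "p \<in> loops_at X x" "q \<in> loops_at X x" for p q L B
  proof -
    obtain c where c: "pathin X c" "c ` {0..1} \<subseteq> B" "c 0 = W L 1" "c 1 = p 1" "R (path_segment p 0 1) (loop_join (W L) c)"
      and L: "B \<in> \<B>" "pathin X (W L)"
      using \<open>good p 1 L B\<close> unfolding good_def by blast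
    obtain c' where c': "pathin X c'" "c' ` {0..1} \<subseteq> B" "c' 0 = W L 1" "c' 1 = q 1" "R (path_segment q 0 1) (loop_join (W L) c')"
      using \<open>good q 1 L B\<close> unfolding good_def by blast
    have "p 1 = q 1" using that by (simp add: loops_at_def)
    then have "R c c'" using c c' by (intro R_simpleD[OF \<B>(2)[OF L(1)]]) auto
    then have "R (loop_join (W L) c) (loop_join (W L) c')" using c L by (intro R_join R_refl) auto
    then have "R p (loop_join (W L) c')" using c(5) by (auto intro: R_trans)
    then show ?thesis using c'(5) by (auto intro: R_trans R_sym)
  qed
  define rep where "rep P = (SOME p. p \<in> loops_at X x \<and> good p 1 (fst P) (snd P))" for P
  have "loop_classes x \<subseteq> (\<lambda>P. {q \<in> loops_at X x. R (rep P) q}) ` (lists (\<B> \<times> \<B>) \<times> \<B>)"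
  proof
    fix A assume "A \<in> loop_classes x"
    then obtain p where p: "p \<in> loops_at X x" "A = {q \<in> loops_at X x. R p q}" unfolding loop_classes_def by blast
    obtain L B where LB: "good p 1 L B" using ex[OF p(1)] by blast
    have "rep (L, B) \<in> loops_at X x \<and> good (rep (L, B)) 1 L B"
      unfolding rep_def using someI[of "\<lambda>p. p \<in> loops_at X x \<and> good p 1 L B" p] p LB by simp
    then have "R p (rep (L, B))" using same[OF LB] p by blast
    then have "A = {q \<in> loops_at X x. R (rep (L, B)) q}" using loop_class_eq p(2) by simp
    moreover have "(L, B) \<in> lists (\<B> \<times> \<B>) \<times> \<B>" using LB unfolding good_def by blast
    ultimately show "A \<in> (\<lambda>P. {q \<in> loops_at X x. R (rep P) q}) ` (lists (\<B> \<times> \<B>) \<times> \<B>)" by blast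
  qed
  moreover have "countable ((\<lambda>P. {q \<in> loops_at X x. R (rep P) q}) ` (lists (\<B> \<times> \<B>) \<times> \<B>))"
    using \<B>(1) by (intro countable_image countable_SIGMA countable_lists) auto
  ultimately show ?thesis by (rule countable_subset)
qed

end

section \<open>Infinite concatenations of loops\<close>

text \<open>\<open>w n\<close> occupies the interval from \<open>1 - (1/2)^n\<close> to
  \<open>1 - (1/2)^(n+1)\<close>; after the first \<open>m\<close> loops the path rests at
  \<open>x\<close>.\<close>

fun finite_concat :: "'a \<Rightarrow> (nat \<Rightarrow> real \<Rightarrow> 'a) \<Rightarrow> nat \<Rightarrow> real \<Rightarrow> 'a" where
  "finite_concat x w 0 = (\<lambda>_. x)"
| "finite_concat x w (Suc m) = loop_join (w 0) (finite_concat x (\<lambda>n. w (Suc n)) m)"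

text \<open>For loops at \<open>x\<close> every admissible \<open>m\<close> gives the same value; at
  time 1 there is no such \<open>m\<close>, and the value is set to \<open>x\<close>.\<close>

definition infinite_concat :: "'a \<Rightarrow> (nat \<Rightarrow> real \<Rightarrow> 'a) \<Rightarrow> real \<Rightarrow> 'a" where
  "infinite_concat x w t = (if t < 1 then finite_concat x w (SOME m. t \<le> 1 - (1/2)^m) t else x)"

lemma half_power_less:
  fixes t :: real assumes "t < 1"
  shows "\<exists>m. t \<le> 1 - (1/2)^m"
proof -
  obtain m where "(1/2)^m < 1 - t" using real_arch_pow_inv[of "1 - t" "1/2"] assms by auto
  then have "t \<le> 1 - (1/2)^m" by linarith
  then show ?thesis ..
qed

lemma finite_concat_0: "(\<And>n. w n 0 = x) \<Longrightarrow> finite_concat x w m 0 = x"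
  by (cases m) auto

lemma finite_concat_stable:
  assumes "\<And>n. w n 0 = x" "0 \<le> t" "t \<le> 1 - (1/2)^m" "m \<le> m'"
  shows "finite_concat x w m' t = finite_concat x w m t"
  using assms
proof (induction m arbitrary: w t m')
  case 0
  then have "t = 0" by simp
  then show ?case using 0 finite_concat_0[of w x] by simp
next
  case (Suc m)
  then obtain k where k: "m' = Suc k" "m \<le> k" by (metis Suc_le_D Suc_le_mono)
  show ?case
  proof (cases "t \<le> 1/2")
    case False
    have "2 * t - 1 \<le> 1 - (1/2)^m" using Suc.prems(3) by simp
    then have "finite_concat x (\<lambda>n. w (Suc n)) k (2 * t - 1) = finite_concat x (\<lambda>n. w (Suc n)) m (2 * t - 1)"
      using Suc.prems False k(2) by (intro Suc.IH) auto
    then show ?thesis using False by (simp add: k(1) loop_join_def)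
  qed (simp add: k(1) loop_join_def)
qed

lemma finite_concat_cong: "(\<And>n. n < m \<Longrightarrow> w n = w' n) \<Longrightarrow> finite_concat x w m = finite_concat x w' m"
proof (induction m arbitrary: w w')
  case (Suc m)
  have "finite_concat x (\<lambda>n. w (Suc n)) m = finite_concat x (\<lambda>n. w' (Suc n)) m"
    by (rule Suc.IH) (simp add: Suc.prems)
  then show ?case using Suc.prems[of 0] by simp
qed simp

lemma infinite_concat_eq:
  assumes "\<And>n. w n 0 = x" "0 \<le> t" "t \<le> 1 - (1/2)^m"
  shows "infinite_concat x w t = finite_concat x w m t"
proof -
  have "(1/2::real)^m > 0" by simp
  then have t: "t < 1" using assms(3) by linarith
  define k where "k = (SOME m. t \<le> 1 - (1/2)^m)"
  have k: "t \<le> 1 - (1/2)^k" unfolding k_def using half_power_less[OF t] by (rule someI_ex)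
  have "finite_concat x w k t = finite_concat x w m t"
  proof (cases "k \<le> m")
    case True
    then show ?thesis using assms(1,2) k by (intro finite_concat_stable[symmetric]) auto
  next
    case False
    then have "m \<le> k" by simp
    then show ?thesis using assms by (intro finite_concat_stable) auto
  qed
  then show ?thesis using t by (simp add: infinite_concat_def k_def)
qed

lemma infinite_concat_0: "(\<And>n. w n 0 = x) \<Longrightarrow> infinite_concat x w 0 = x"
  using infinite_concat_eq[of w x 0 0] by simp

lemma infinite_concat_1: "infinite_concat x w 1 = x"
  by (simp add: infinite_concat_def)

text \<open>The tail is again an infinite concatenation, so loops can be peeled off from the front
  one by one.\<close>

lemma infinite_concat_unfold:
  assumes "\<And>n. w n 0 = x" "t \<in> {0..1}"
  shows "infinite_concat x w t = loop_join (w 0) (infinite_concat x (\<lambda>n. w (Suc n))) t"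
proof (cases "t < 1")
  case True
  then obtain m where m: "2 * t - 1 \<le> 1 - (1/2)^m" using half_power_less[of "2 * t - 1"] by auto
  then have "t \<le> 1 - (1/2)^Suc m" by simp
  then have "infinite_concat x w t = finite_concat x w (Suc m) t"
    using assms by (intro infinite_concat_eq) auto
  moreover have "infinite_concat x (\<lambda>n. w (Suc n)) (2 * t - 1) = finite_concat x (\<lambda>n. w (Suc n)) m (2 * t - 1)" if "\<not> t \<le> 1/2"
    using assms m that by (intro infinite_concat_eq) auto
  ultimately show ?thesis by (simp add: loop_join_def)
next
  case False
  then have "t = 1" using assms(2) by simp
  then show ?thesis by (simp add: infinite_concat_1)
qed

section \<open>Continuity of infinite concatenations\<close>

context Metric_space
begin

lemma finite_concat_close:
  assumes "\<And>n t. t \<in> {0..1} \<Longrightarrow> w n t \<in> mcball x r" "x \<in> mcball x r" "t \<in> {0..1}"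
  shows "finite_concat x w m t \<in> mcball x r"
  using assms
proof (induction m arbitrary: w t)
  case (Suc m)
  show ?case
  proof (cases "t \<le> 1/2")
    case True
    then show ?thesis using Suc.prems(1)[of "2 * t" 0] Suc.prems(3) by (simp add: loop_join_def)
  next
    case False
    have "finite_concat x (\<lambda>n. w (Suc n)) m (2 * t - 1) \<in> mcball x r"
      using Suc.prems False by (intro Suc.IH) auto
    then show ?thesis using False by (simp add: loop_join_def)
  qed
qed (simp only: finite_concat.simps)

text \<open>After time \<open>1 - (1/2)^j\<close> only loops of index at least \<open>j\<close> are
  traversed.\<close>

lemma finite_concat_tail_close:
  assumes "\<And>n. w n 1 = x" "\<And>n t. j \<le> n \<Longrightarrow> t \<in> {0..1} \<Longrightarrow> w n t \<in> mcball x r" "x \<in> mcball x r"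
    "t \<in> {0..1}" "1 - (1/2)^j \<le> t"
  shows "finite_concat x w m t \<in> mcball x r"
  using assms
proof (induction j arbitrary: w t m)
  case 0
  then show ?case by (intro finite_concat_close) auto
next
  case (Suc j)
  show ?case
  proof (cases m)
    case 0
    then show ?thesis using Suc.prems(3) by (simp only: finite_concat.simps)
  next
    case (Suc k)
    show ?thesis
    proof (cases "t \<le> 1/2")
      case True
      \<comment> \<open>Only the junction \<open>t = 1/2\<close> remains, where the possibly large
        first loop is back at \<open>x\<close>.\<close>
      have "(1/2::real)^j \<le> 1" by (simp add: power_le_one)
      then have "2 * t = 1" using True Suc.prems(5) by simp
      then have "finite_concat x w m t = x" using True Suc Suc.prems(1) by (simp add: loop_join_def)
      then show ?thesis using Suc.prems(3) by (simp only:)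
    next
      case False
      have "finite_concat x (\<lambda>n. w (Suc n)) k (2 * t - 1) \<in> mcball x r"
        using Suc.prems False by (intro Suc.IH) auto
      then show ?thesis using False Suc by (simp add: loop_join_def)
    qed
  qed
qed

lemma pathin_finite_concat:
  assumes "\<And>n. pathin mtopology (w n)" "\<And>n. w n 0 = x" "\<And>n. w n 1 = x"
  shows "pathin mtopology (finite_concat x w m)"
  using assms
proof (induction m arbitrary: w)
  case 0
  then have "x \<in> M" using path_start_in_topspace[of mtopology "w 0"] by simp
  then show ?case by simp
next
  case (Suc m)
  then show ?case using finite_concat_0[of "\<lambda>n. w (Suc n)" x] by (auto intro!: pathin_loop_join)
qed

text \<open>A uniform limit: up to time \<open>1 - (1/2)^m\<close> it equals the \<open>m\<close>-th
  finite concatenation, and afterwards both stay within \<open>e/3\<close> of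
  \<open>x\<close>.\<close>

lemma pathin_infinite_concat:
  assumes w: "\<And>n. pathin mtopology (w n)" "\<And>n. w n 0 = x" "\<And>n. w n 1 = x"
    and small: "\<And>e. e > 0 \<Longrightarrow> \<exists>j. \<forall>n\<ge>j. w n ` {0..1} \<subseteq> mcball x e"
  shows "pathin mtopology (infinite_concat x w)"
  unfolding pathin_def
proof (rule continuous_map_uniform_limit[where F = sequentially and f = "finite_concat x w"])
  show "\<forall>\<^sub>F m in sequentially. continuous_map (top_of_set {0..1}) mtopology (finite_concat x w m)"
    using pathin_finite_concat[OF w] by (simp add: pathin_def)
  have x: "x \<in> M" using path_start_in_topspace[OF w(1), of 0] w(2) by simp
  fix e :: real assume e: "e > 0"
  obtain j where j: "\<And>n. j \<le> n \<Longrightarrow> w n ` {0..1} \<subseteq> mcball x (e/3)" using small[of "e/3"] e by auto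
  have "infinite_concat x w t \<in> M \<and> d (finite_concat x w m t) (infinite_concat x w t) < e"
    if m: "m \<ge> j" and t: "t \<in> {0..1}" for m t
  proof -
    have fM: "finite_concat x w k t \<in> M" for k
      using path_image_subset_topspace[OF pathin_finite_concat[of w x k]] w t by auto
    have xr: "x \<in> mcball x (e/3)" using x e by simp
    show ?thesis
    proof (cases "t \<le> 1 - (1/2)^m")
      case True
      then have "infinite_concat x w t = finite_concat x w m t" using t w(2) by (intro infinite_concat_eq) auto
      then show ?thesis using fM e by simp
    next
      case False
      have "(1/2::real)^m \<le> (1/2)^j" using m by (intro power_decreasing) auto
      then have tj: "1 - (1/2)^j \<le> t" using False by linarith
      have f: "finite_concat x w k t \<in> mcball x (e/3)" for k
        by (rule finite_concat_tail_close[of w x j]) (use w(3) j xr t tj in blast)+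
      have g: "infinite_concat x w t \<in> mcball x (e/3)"
      proof (cases "t < 1")
        case True
        then obtain k where "t \<le> 1 - (1/2)^k" using half_power_less by blast
        then have "infinite_concat x w t = finite_concat x w k t" using t w(2) by (intro infinite_concat_eq) auto
        then show ?thesis using f by simp
      next
        case False
        then have "t = 1" using t by simp
        then show ?thesis using xr infinite_concat_1 by metis
      qed
      have "d (finite_concat x w m t) (infinite_concat x w t) \<le> d (finite_concat x w m t) x + d x (infinite_concat x w t)"
        using f g x by (intro triangle) auto
      also have "\<dots> \<le> e/3 + e/3" using f[of m] g by (intro add_mono) (simp_all add: commute)
      also have "\<dots> < e" using e by simp
      finally show ?thesis using g by simp
    qed
  qed
  then show "\<forall>\<^sub>F m in sequentially. \<forall>t\<in>topspace (top_of_set {0..1}).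
      infinite_concat x w t \<in> M \<and> d (finite_concat x w m t) (infinite_concat x w t) < e"
    using eventually_sequentiallyI[of j] by simp
qed simp

end

text \<open>Each time before 1 sees only finitely many loops, so the values are eventually constant.
  This supplies the pointwise limits at which closedness of the witness condition is
  applied.\<close>

lemma infinite_concat_limit:
  fixes w :: "nat \<Rightarrow> nat \<Rightarrow> real \<Rightarrow> 'a"
  assumes "\<And>k n. w k n 0 = x" "\<And>n. v n 0 = x" "\<And>k n. n < k \<Longrightarrow> w k n = v n" "t \<in> {0..1}"
  shows "\<forall>\<^sub>F k in sequentially. infinite_concat x (w k) t = infinite_concat x v t"
proof (cases "t < 1")
  case True
  then obtain m where m: "t \<le> 1 - (1/2)^m" using half_power_less by blast
  have "infinite_concat x (w k) t = infinite_concat x v t" if "k \<ge> m" for k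
  proof -
    have "finite_concat x (w k) m = finite_concat x v m" using assms(3) that by (intro finite_concat_cong) auto
    then show ?thesis using infinite_concat_eq[of "w k" x t m] infinite_concat_eq[of v x t m] assms m by simp
  qed
  then show ?thesis by (rule eventually_sequentiallyI)
next
  case False
  then have "t = 1" using assms(4) by simp
  then show ?thesis by (simp add: infinite_concat_1)
qed

text \<open>The loops before place \<open>n\<close> agree and are cancelled from the left, one in
  each induction step; the tails after it agree and are cancelled from the right.\<close>

lemma (in path_congruence) infinite_concat_R_imp:
  assumes "R (infinite_concat x w) (infinite_concat x w')" "\<And>i. i \<noteq> n \<Longrightarrow> w i = w' i"
    and w: "\<And>i. pathin X (w i)" "\<And>i. w i 0 = x" "\<And>i. w i 1 = x"
    and w': "\<And>i. pathin X (w' i)" "\<And>i. w' i 0 = x" "\<And>i. w' i 1 = x"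
    and cont: "\<And>k. pathin X (infinite_concat x (\<lambda>i. w (i + k)))" "\<And>k. pathin X (infinite_concat x (\<lambda>i. w' (i + k)))"
  shows "R (w n) (w' n)"
  using assms
proof (induction n arbitrary: w w')
  have unfold_R: "R (infinite_concat x v) (loop_join (v 0) (infinite_concat x (\<lambda>i. v (Suc i))))"
    if "pathin X (infinite_concat x v)" "\<And>i. v i 0 = x" for v
    using that by (intro R_cong infinite_concat_unfold) auto
  have join: "R (loop_join (v 0) (infinite_concat x (\<lambda>i. v (Suc i)))) (loop_join (v' 0) (infinite_concat x (\<lambda>i. v' (Suc i))))"
    if vv': "R (infinite_concat x v) (infinite_concat x v')" and ends: "\<And>i. v i 0 = x" "\<And>i. v' i 0 = x" for v v'
  proof -
    have "R (loop_join (v 0) (infinite_concat x (\<lambda>i. v (Suc i)))) (infinite_concat x v)"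
      using R_path[OF vv'] ends(1) by (intro R_sym[OF unfold_R]) auto
    also note vv'
    also have "R (infinite_concat x v') (loop_join (v' 0) (infinite_concat x (\<lambda>i. v' (Suc i))))"
      using R_path[OF vv'] ends(2) by (intro unfold_R) auto
    finally show ?thesis .
  qed
  {
    case 0
    have "(\<lambda>i. w (Suc i)) = (\<lambda>i. w' (Suc i))" using 0(2) by auto
    moreover have "infinite_concat x (\<lambda>i. w' (Suc i)) 0 = x" using 0 by (intro infinite_concat_0) auto
    moreover have "pathin X (infinite_concat x (\<lambda>i. w' (Suc i)))" using 0(10)[of 1] by simp
    ultimately show ?case using join[of w w'] 0 by (intro R_cancel_right[of "w 0" "infinite_concat x (\<lambda>i. w' (Suc i))" "w' 0"]) auto
  next
    case (Suc n)
    let ?u = "infinite_concat x (\<lambda>i. w (Suc i))" and ?u' = "infinite_concat x (\<lambda>i. w' (Suc i))"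
    have 0: "w 0 = w' 0" by (rule Suc.prems(2)) simp
    have ends: "?u 0 = x" "?u' 0 = x"
      by (rule infinite_concat_0, rule Suc.prems)+
    have u: "R ?u ?u'"
    proof (rule R_cancel_left)
      show "R (loop_join (w 0) ?u) (loop_join (w 0) ?u')"
        using join[OF Suc.prems(1,4,7)] by (simp only: 0)
      show "pathin X ?u" using Suc.prems(9)[of 1] by simp
      show "pathin X ?u'" using Suc.prems(10)[of 1] by simp
    qed (simp_all only: Suc.prems ends)
    show ?case
    proof (rule Suc.IH[OF u])
      show "w (Suc i) = w' (Suc i)" if "i \<noteq> n" for i using that by (intro Suc.prems(2)) simp
      show "pathin X (infinite_concat x (\<lambda>i. w (Suc (i + k))))" for k using Suc.prems(9)[of "Suc k"] by simp
      show "pathin X (infinite_concat x (\<lambda>i. w' (Suc (i + k))))" for k using Suc.prems(10)[of "Suc k"] by simp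
    qed (rule Suc.prems)+
  }
qed

section \<open>Polish spaces\<close>

context Metric_space
begin

lemma separable_imp_second_countable:
  assumes "separable_space mtopology"
  shows "second_countable mtopology"
proof -
  obtain D where D: "countable D" "D \<subseteq> M" "mtopology closure_of D = M"
    using assms unfolding separable_space_def topspace_mtopology by metis
  define \<B> where "\<B> = (\<lambda>(p, n::nat). mball p (inverse (Suc n))) ` (D \<times> UNIV)"
  show ?thesis
    unfolding second_countable_def
  proof (intro exI[of _ \<B>] conjI ballI allI impI)
    show "countable \<B>" unfolding \<B>_def using D(1) by simp
    show "openin mtopology V" if "V \<in> \<B>" for V using that by (auto simp: \<B>_def)
    fix U x assume "openin mtopology U \<and> x \<in> U"
    then obtain r where r: "r > 0" "mball x r \<subseteq> U" and x: "x \<in> M"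
      unfolding openin_mtopology by blast
    obtain n where n: "inverse (Suc n) < r/2" using reals_Archimedean[of "r/2"] r(1) by auto
    have "x \<in> mtopology closure_of D" using D(3) x by simp
    then obtain p where p: "p \<in> D" "p \<in> mball x (inverse (Suc n))"
      unfolding metric_closure_of by (smt (verit) mem_Collect_eq inverse_positive_iff_positive of_nat_0_less_iff zero_less_Suc)
    have "mball p (inverse (Suc n)) \<subseteq> mball x r"
    proof
      fix y assume y: "y \<in> mball p (inverse (Suc n))"
      have "d x y \<le> d x p + d p y" using p y by (intro triangle) auto
      also have "\<dots> < r" using p(2) y n by simp
      finally show "y \<in> mball x r" using y x by simp
    qed
    moreover have "x \<in> mball p (inverse (Suc n))" using p(2) by (simp add: commute)
    moreover have "mball p (inverse (Suc n)) \<in> \<B>" unfolding \<B>_def using p(1) by force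
    ultimately show "\<exists>V\<in>\<B>. x \<in> V \<and> V \<subseteq> U" using r(2) by blast
  qed
qed

text \<open>A cover by countably many small sets replaces separability of the space of continuous maps.\<close>
lemma countable_cover_continuous_maps:
  assumes K: "compact_space K" "second_countable K" and sep: "separable_space mtopology" and e: "e > 0"
  obtains C :: "nat \<Rightarrow> ('k \<Rightarrow> 'a) set" where
    "\<And>g. continuous_map K mtopology g \<Longrightarrow> \<exists>i. g \<in> C i"
    "\<And>i g h y. g \<in> C i \<Longrightarrow> h \<in> C i \<Longrightarrow> y \<in> topspace K \<Longrightarrow> d (g y) (h y) < e"
proof -
  obtain D where D: "countable D" "D \<subseteq> M" "mtopology closure_of D = M"
    using sep unfolding separable_space_def topspace_mtopology by metis
  obtain \<O> where O: "countable \<O>" "\<And>V. V \<in> \<O> \<Longrightarrow> openin K V"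
    "\<And>U y. openin K U \<Longrightarrow> y \<in> U \<Longrightarrow> \<exists>V\<in>\<O>. y \<in> V \<and> V \<subseteq> U"
    using K(2) unfolding second_countable_def by metis
  \<comment> \<open>A list stores a finite cover of \<open>K\<close> by basic sets, each with a
    centre in \<open>D\<close> whose ball contains its image. Maps sharing a list are within
    \<open>e\<close> of each other, and the lists are countable in number.\<close>
  define C where "C L = {g. topspace K \<subseteq> \<Union>(fst ` set L) \<and> (\<forall>P\<in>set L. g ` fst P \<subseteq> mball (snd P) (e/2))}"
    for L :: "('k set \<times> 'a) list"
  define \<L> where "\<L> = lists (\<O> \<times> D)"
  have \<L>: "countable \<L>" "\<L> \<noteq> {}" using O(1) D(1) by (auto simp: \<L>_def)
  have ex: "\<exists>L\<in>\<L>. g \<in> C L" if g: "continuous_map K mtopology g" for g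
  proof -
    define \<U> where "\<U> = {U \<in> \<O>. \<exists>p\<in>D. g ` U \<subseteq> mball p (e/2)}"
    have "topspace K \<subseteq> \<Union>\<U>"
    proof
      fix y assume y: "y \<in> topspace K"
      then have gy: "g y \<in> mtopology closure_of D" using g D(3) by (auto simp: continuous_map_def)
      then have "\<forall>r>0. \<exists>p\<in>D. p \<in> mball (g y) r" unfolding metric_closure_of by blast
      moreover have "e/2 > 0" using e by simp
      ultimately obtain p where p: "p \<in> D" "p \<in> mball (g y) (e/2)" by blast
      define W where "W = {y \<in> topspace K. g y \<in> mball p (e/2)}"
      have "openin K W" unfolding W_def using g by (rule openin_continuous_map_preimage) simp
      moreover have "y \<in> W" using p(2) y by (simp add: W_def commute)
      ultimately obtain U where U: "U \<in> \<O>" "y \<in> U" "U \<subseteq> W" using O(3)[of W y] by blast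
      have "g ` U \<subseteq> mball p (e/2)" using U(3) unfolding W_def by blast
      then show "y \<in> \<Union>\<U>" using p(1) U unfolding \<U>_def by blast
    qed
    moreover have "\<forall>U\<in>\<U>. openin K U" using O(2) by (simp add: \<U>_def)
    ultimately obtain \<F> where F: "finite \<F>" "\<F> \<subseteq> \<U>" "topspace K \<subseteq> \<Union>\<F>"
      using K(1) unfolding compact_space_alt by meson
    have "\<forall>U\<in>\<F>. \<exists>p. p \<in> D \<and> g ` U \<subseteq> mball p (e/2)" using F(2) unfolding \<U>_def by blast
    then obtain c where c: "\<And>U. U \<in> \<F> \<Longrightarrow> c U \<in> D" "\<And>U. U \<in> \<F> \<Longrightarrow> g ` U \<subseteq> mball (c U) (e/2)" by metis
    obtain Us where Us: "set Us = \<F>" using F(1) finite_list by blast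
    have "map (\<lambda>U. (U, c U)) Us \<in> \<L>"
      unfolding \<L>_def using Us c(1) F(2) by (auto simp: \<U>_def in_lists_conv_set)
    moreover have "g \<in> C (map (\<lambda>U. (U, c U)) Us)"
      unfolding C_def using Us c(2) F(3) by (simp add: image_image)
    ultimately show ?thesis by blast
  qed
  have close: "d (g y) (h y) < e" if gh: "g \<in> C L" "h \<in> C L" and y: "y \<in> topspace K" for g h y L
  proof -
    obtain P where P: "P \<in> set L" "y \<in> fst P" using gh(1) y unfolding C_def by blast
    have gy: "g y \<in> mball (snd P) (e/2)" and hy: "h y \<in> mball (snd P) (e/2)"
      using gh P unfolding C_def by blast+
    have "d (g y) (h y) \<le> d (g y) (snd P) + d (snd P) (h y)" using gy hy by (intro triangle) auto
    also have "\<dots> < e" using gy hy by (simp add: commute)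
    finally show ?thesis .
  qed
  show ?thesis
  proof (rule that[of "\<lambda>i. C (from_nat_into \<L> i)"])
    show "\<exists>i. g \<in> C (from_nat_into \<L> i)" if "continuous_map K mtopology g" for g
      using ex[OF that] from_nat_into_surj[OF \<L>(1)] by metis
  qed (rule close)
qed

end

section \<open>Cardinality bounds for loop classes\<close>

lemma nat_fun_bool_eqpoll_reals: "(UNIV :: (nat \<Rightarrow> bool) set) \<approx> (UNIV :: real set)"
proof -
  have "bij (Collect :: (nat \<Rightarrow> bool) \<Rightarrow> nat set)"
    by (rule bijI'[where f = Collect]) (auto intro: exI[of _ "\<lambda>x. x \<in> _"])
  then have "(UNIV :: (nat \<Rightarrow> bool) set) \<approx> (UNIV :: nat set set)" unfolding eqpoll_def by blast
  then show ?thesis using nat_sets_eqpoll_reals by (rule eqpoll_trans)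
qed

lemma countable_sets_lepoll_reals: "(UNIV :: 'b::countable set set) \<lesssim> (UNIV :: real set)"
proof -
  have "inj (image (to_nat :: 'b \<Rightarrow> nat))" by (intro injI) (simp add: inj_image_eq_iff)
  then have "(UNIV :: 'b set set) \<lesssim> (UNIV :: nat set set)" unfolding lepoll_def by blast
  then show ?thesis using nat_sets_eqpoll_reals lepoll_trans2 by blast
qed

lemma paths_agree_on_rationals_imp_eq:
  assumes X: "Hausdorff_space X" and p: "pathin X p" and q: "pathin X q"
    and rat: "\<And>r :: rat. of_rat r \<in> {0..1::real} \<Longrightarrow> p (of_rat r) = q (of_rat r)"
    and t: "t \<in> {0..1}"
  shows "p t = q t"
proof (rule ccontr)
  assume ne: "p t \<noteq> q t"
  have "p t \<in> topspace X" "q t \<in> topspace X"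
    using path_image_subset_topspace[OF p] path_image_subset_topspace[OF q] t by auto
  then obtain U V where UV: "openin X U" "openin X V" "p t \<in> U" "q t \<in> V" "disjnt U V"
    using X ne unfolding Hausdorff_space_def by metis
  obtain e where e: "e > 0" "p ` (ball t e \<inter> {0..1}) \<subseteq> U" by (rule pathin_ball_image[OF p UV(1) t UV(3)]) (rule that)
  obtain e' where e': "e' > 0" "q ` (ball t e' \<inter> {0..1}) \<subseteq> V" by (rule pathin_ball_image[OF q UV(2) t UV(4)]) (rule that)
  have "max 0 (t - min e e') < min 1 (t + min e e')" using e(1) e'(1) t by auto
  then obtain r :: rat where r: "max 0 (t - min e e') < of_rat r" "of_rat r < min 1 (t + min e e')"
    using of_rat_dense by blast
  then have "of_rat r \<in> ball t e \<inter> {0..1}" "of_rat r \<in> ball t e' \<inter> {0..1}"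
    by (auto simp: dist_real_def)
  then have "p (of_rat r) \<in> U" "q (of_rat r) \<in> V" "of_rat r \<in> {0..1::real}" using e(2) e'(2) by blast+
  then show False using rat[of r] UV(5) by (simp add: disjnt_iff)
qed

context path_congruence
begin

text \<open>A path is determined on the unit interval by its values at rational times, and each
  value by the basic open sets around it. Thus a loop is coded, up to congruence, by a subset of a
  countable set.\<close>

lemma loop_classes_lepoll_reals:
  assumes sc: "second_countable X" and X: "Hausdorff_space X"
  shows "loop_classes x \<lesssim> (UNIV :: real set)"
proof -
  obtain \<O> where O: "countable \<O>" "\<And>V. V \<in> \<O> \<Longrightarrow> openin X V"
    "\<And>U y. openin X U \<Longrightarrow> y \<in> U \<Longrightarrow> \<exists>V\<in>\<O>. y \<in> V \<and> V \<subseteq> U"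
    using sc unfolding second_countable_def by metis
  define code where "code p = {(r :: rat, n :: nat). \<exists>V\<in>\<O>. p (of_rat r) \<in> V \<and> to_nat_on \<O> V = n}" for p :: "real \<Rightarrow> 'a"
  define rep where "rep A = (SOME p. p \<in> loops_at X x \<and> A = {q \<in> loops_at X x. R p q})" for A
  have rep: "rep A \<in> loops_at X x" "A = {q \<in> loops_at X x. R (rep A) q}" if "A \<in> loop_classes x" for A
  proof -
    have "\<exists>p. p \<in> loops_at X x \<and> A = {q \<in> loops_at X x. R p q}" using that unfolding loop_classes_def by blast
    from someI_ex[OF this] show "rep A \<in> loops_at X x" "A = {q \<in> loops_at X x. R (rep A) q}"
      unfolding rep_def by blast+
  qed
  have code: "p t = q t" if pq: "p \<in> loops_at X x" "q \<in> loops_at X x" and eq: "code p = code q" and t: "t \<in> {0..1}" for p q t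
  proof (rule paths_agree_on_rationals_imp_eq[OF X])
    show pin: "pathin X p" "pathin X q" using pq by (simp_all add: loops_at_def)
    show "t \<in> {0..1}" by (rule t)
    fix r :: rat assume r: "of_rat r \<in> {0..1::real}"
    have pr: "p (of_rat r) \<in> topspace X" "q (of_rat r) \<in> topspace X"
      using path_image_subset_topspace pin r by blast+
    show "p (of_rat r) = q (of_rat r)"
    proof (rule ccontr)
      assume "p (of_rat r) \<noteq> q (of_rat r)"
      then obtain U V where "openin X U" "openin X V" "p (of_rat r) \<in> U" "q (of_rat r) \<in> V" "disjnt U V"
        using X pr unfolding Hausdorff_space_def by metis
      then obtain W where W: "W \<in> \<O>" "p (of_rat r) \<in> W" "q (of_rat r) \<notin> W"
        using O(3) by (metis disjnt_iff subsetD)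
      have in_code: "(r, n) \<in> code p \<longleftrightarrow> (\<exists>V\<in>\<O>. p (of_rat r) \<in> V \<and> to_nat_on \<O> V = n)" for p n
        by (simp add: code_def)
      have "(r, to_nat_on \<O> W) \<in> code p" using W unfolding in_code by blast
      then have "(r, to_nat_on \<O> W) \<in> code q" by (simp only: eq)
      then obtain W' where "W' \<in> \<O>" "q (of_rat r) \<in> W'" "to_nat_on \<O> W' = to_nat_on \<O> W"
        unfolding in_code by blast
      then show False using W to_nat_on_inj[OF O(1)] by metis
    qed
  qed
  have "inj_on (\<lambda>A. code (rep A)) (loop_classes x)"
  proof (rule inj_onI)
    fix A B assume A: "A \<in> loop_classes x" and B: "B \<in> loop_classes x" and eq: "code (rep A) = code (rep B)"
    have "R (rep A) (rep B)"
      using rep(1)[OF A] code[OF rep(1)[OF A] rep(1)[OF B] eq] by (intro R_cong) (auto simp: loops_at_def)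
    from loop_class_eq[OF this] show "A = B" using rep(2)[OF A] rep(2)[OF B] by metis
  qed
  then have "loop_classes x \<lesssim> (UNIV :: (rat \<times> nat) set set)" unfolding lepoll_def by blast
  then show ?thesis using countable_sets_lepoll_reals by (rule lepoll_trans)
qed

text \<open>Conjugation by \<open>c\<close> reflects congruence, by cancellation on both sides, and
  hence induces an injection of classes.\<close>

lemma loop_classes_basepoint:
  assumes c: "pathin X c" "c 0 = x" "c 1 = y"
  shows "loop_classes y \<lesssim> loop_classes x"
proof -
  define conj where "conj p = loop_join c (loop_join p (path_rev c))" for p
  have conj: "conj p \<in> loops_at X x" if "p \<in> loops_at X y" for p
    using that c by (auto simp: loops_at_def conj_def intro!: pathin_loop_join)
  have cancel: "R p q" if "R (conj p) (conj q)" "p \<in> loops_at X y" "q \<in> loops_at X y" for p q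
  proof -
    have p: "pathin X p" "p 0 = y" "p 1 = y" and q: "pathin X q" "q 0 = y" "q 1 = y"
      using that by (auto simp: loops_at_def)
    have "R (loop_join p (path_rev c)) (loop_join q (path_rev c))"
      by (rule R_cancel_left[OF that(1)[unfolded conj_def]]) (simp_all add: p q c pathin_loop_join)
    then show ?thesis by (rule R_cancel_right) (simp_all add: p q c)
  qed
  define f where "f A = {q \<in> loops_at X x. R (conj (SOME p. p \<in> A)) q}" for A
  have some: "(SOME p. p \<in> A) \<in> A" if "A \<in> loop_classes y" for A
  proof -
    have "\<exists>p. p \<in> A" using that R_refl by (auto simp: loop_classes_def loops_at_def)
    then show ?thesis by (rule someI_ex)
  qed
  have sub: "A \<subseteq> loops_at X y" if "A \<in> loop_classes y" for A using that unfolding loop_classes_def by blast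
  have "inj_on f (loop_classes y)"
  proof (rule inj_onI)
    fix A B assume A: "A \<in> loop_classes y" and B: "B \<in> loop_classes y" and eq: "f A = f B"
    define p q where "p = (SOME p. p \<in> A)" and "q = (SOME p. p \<in> B)"
    have pq: "p \<in> A" "q \<in> B" "p \<in> loops_at X y" "q \<in> loops_at X y"
      using some A B sub unfolding p_def q_def by blast+
    have "conj q \<in> f B" unfolding f_def q_def[symmetric] using conj[OF pq(4)] R_refl by (simp add: loops_at_def)
    then have "conj q \<in> f A" by (simp only: eq)
    then have "R (conj p) (conj q)" unfolding f_def p_def[symmetric] by simp
    then have R: "R p q" using cancel pq by blast
    obtain a b where a: "A = {r \<in> loops_at X y. R a r}" and b: "B = {r \<in> loops_at X y. R b r}"
      using A B unfolding loop_classes_def by blast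
    have "R a p" "R b q" using pq a b by auto
    then have "R a b" using R R_sym R_trans by metis
    then show "A = B" using loop_class_eq a b by metis
  qed
  moreover have "f ` loop_classes y \<subseteq> loop_classes x"
  proof (rule image_subsetI)
    fix A assume "A \<in> loop_classes y"
    then have "conj (SOME p. p \<in> A) \<in> loops_at X x" using conj some sub by blast
    then show "f A \<in> loop_classes x" unfolding f_def loop_classes_def by (rule imageI)
  qed
  ultimately show ?thesis unfolding lepoll_def by blast
qed

text \<open>If \<open>x\<close> has no \<open>R_simple\<close> neighbourhood inside
  \<open>U0\<close>, every path connected open neighbourhood of \<open>x\<close> in
  \<open>U0\<close> carries incongruent paths \<open>p\<close> and \<open>q\<close> with common
  ends. Following \<open>p\<close> and then \<open>q\<close> backwards, and conjugating by a path
  from \<open>x\<close> inside the neighbourhood, gives a small loop that is not trivial.\<close>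

lemma R_simple_or_small_loops:
  assumes lpc: "locally_path_connected_space X"
  obtains "\<And>U y. openin X U \<Longrightarrow> y \<in> U \<Longrightarrow> \<exists>V. R_simple V \<and> y \<in> V \<and> V \<subseteq> U"
  | x where "x \<in> topspace X"
      "\<And>U. openin X U \<Longrightarrow> x \<in> U \<Longrightarrow> \<exists>l. l \<in> loops_at X x \<and> l ` {0..1} \<subseteq> U \<and> \<not> R l (\<lambda>_. x)"
proof (cases "\<forall>U y. openin X U \<and> y \<in> U \<longrightarrow> (\<exists>V. R_simple V \<and> y \<in> V \<and> V \<subseteq> U)")
  case True
  then show ?thesis using that(1) by simp
next
  case False
  then obtain U0 x where U0: "openin X U0" "x \<in> U0" "\<And>V. R_simple V \<Longrightarrow> x \<in> V \<Longrightarrow> \<not> V \<subseteq> U0" by auto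
  have x: "x \<in> topspace X" using U0(1,2) openin_subset by blast
  have "\<exists>l. l \<in> loops_at X x \<and> l ` {0..1} \<subseteq> U \<and> \<not> R l (\<lambda>_. x)" if U: "openin X U" "x \<in> U" for U
  proof -
    have "openin X (U \<inter> U0)" "x \<in> U \<inter> U0" using U U0 by auto
    then obtain V where V: "openin X V" "path_connectedin X V" "x \<in> V" "V \<subseteq> U \<inter> U0"
      using lpc unfolding locally_path_connected_space by metis
    have "\<not> R_simple V" using U0(3)[of V] V by auto
    then obtain p q where p: "pathin X p" "p ` {0..1} \<subseteq> V" and q: "pathin X q" "q ` {0..1} \<subseteq> V"
      and ends: "p 0 = q 0" "p 1 = q 1" and nR: "\<not> R p q"
      using V(1,2) unfolding R_simple_def by blast
    have "p 0 \<in> V" using p(2) by force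
    then obtain c where c: "pathin X c" "c ` {0..1} \<subseteq> V" "c 0 = x" "c 1 = p 0"
      using V(2,3) unfolding path_connectedin by (metis image_subset_iff_funcset)
    define m where "m = loop_join p (path_rev q)"
    define l where "l = loop_join c (loop_join m (path_rev c))"
    have rev: "path_rev f ` {0..1} \<subseteq> V" if "f ` {0..1} \<subseteq> V" for f
      using that by (auto simp: path_rev_def)
    have m: "pathin X m" "m 0 = p 0" "m 1 = p 0" "m ` {0..1} \<subseteq> V"
      unfolding m_def using p q ends by (simp_all add: pathin_loop_join loop_join_image rev)
    have mc: "pathin X (loop_join m (path_rev c))" using m c by (intro pathin_loop_join) auto
    have l: "l \<in> loops_at X x" unfolding l_def using c m mc by (auto simp: loops_at_def intro!: pathin_loop_join)
    have "l ` {0..1} \<subseteq> V" unfolding l_def by (intro loop_join_image rev c m)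
    moreover have "\<not> R l (\<lambda>_. x)"
    proof
      assume "R l (\<lambda>_. x)"
      also have "R (\<lambda>_. x) (loop_join c (path_rev c))" using c by (intro R_sym[OF R_right_inverse]) auto
      finally have "R (loop_join m (path_rev c)) (path_rev c)"
        unfolding l_def by (rule R_cancel_left) (simp_all add: c m mc)
      also have "R (path_rev c) (loop_join (\<lambda>_. p 0) (path_rev c))"
        using c by (intro R_sym[OF R_left_unit]) auto
      finally have "R m (\<lambda>_. p 0)"
        by (rule R_cancel_right) (simp_all add: c m path_start_in_topspace[OF p(1)])
      also have "R (\<lambda>_. p 0) (loop_join q (path_rev q))" using q ends by (intro R_sym[OF R_right_inverse]) auto
      finally have "R p q" unfolding m_def by (rule R_cancel_right) (simp_all add: p q ends)
      then show False using nR by simp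
    qed
    ultimately show ?thesis using l V(4) by blast
  qed
  then show ?thesis using that(2) x by blast
qed

end

section \<open>Analytic path congruences\<close>

text \<open>\<open>S c g p q\<close> says that \<open>g\<close>, a sequence of continuous maps on the compact space \<open>K\<close>, witnesses
  that \<open>p\<close> and \<open>q\<close> are congruent; the type \<open>c\<close> of the witness ranges over a countable set.
  Closedness of \<open>S c\<close> makes the congruence an analytic relation.\<close>
locale analytic_path_congruence = path_congruence X R
  for X :: "'a topology" and R +
  fixes K :: "'k topology" and S :: "nat \<Rightarrow> (nat \<Rightarrow> 'k \<Rightarrow> 'a) \<Rightarrow> (real \<Rightarrow> 'a) \<Rightarrow> (real \<Rightarrow> 'a) \<Rightarrow> bool"
  assumes K_compact: "compact_space K" and K_second_countable: "second_countable K"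
    and R_iff_witness: "p \<in> loops_at X x \<Longrightarrow> q \<in> loops_at X x \<Longrightarrow>
      R p q \<longleftrightarrow> (\<exists>c g. (\<forall>i. continuous_map K X (g i)) \<and> S c g p q)"
    and S_closed: "(\<And>n. S c (gs n) (ps n) (qs n)) \<Longrightarrow>
      (\<And>i y. y \<in> topspace K \<Longrightarrow> limitin X (\<lambda>n. gs n i y) (g i y) sequentially) \<Longrightarrow>
      (\<And>t. t \<in> {0..1} \<Longrightarrow> limitin X (\<lambda>n. ps n t) (p t) sequentially) \<Longrightarrow>
      (\<And>t. t \<in> {0..1} \<Longrightarrow> limitin X (\<lambda>n. qs n t) (q t) sequentially) \<Longrightarrow> S c g p q"
begin

text \<open>In the Souslin scheme \<open>A\<close>, the first index is the type of the witness; the later ones approximate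
  its maps more and more closely, so that witnesses along a branch converge uniformly.\<close>
lemma reals_lepoll_loop_classes:
  assumes "Polish_space X" and x: "x \<in> topspace X"
    and small: "\<And>U. openin X U \<Longrightarrow> x \<in> U \<Longrightarrow> \<exists>l. l \<in> loops_at X x \<and> l ` {0..1} \<subseteq> U \<and> \<not> R l (\<lambda>_. x)"
  shows "(UNIV :: real set) \<lesssim> loop_classes x"
proof -
  obtain M d where "Metric_space M d" "Metric_space.mcomplete M d" and X: "X = Metric_space.mtopology M d"
    and sep: "separable_space X"
    using assms(1) unfolding Polish_space_def completely_metrizable_space_def by metis
  interpret Metric_space M d by fact
  have mcomplete by fact
  have "\<exists>l. l \<in> loops_at X x \<and> l ` {0..1} \<subseteq> mball x (inverse (Suc n)) \<and> \<not> R l (\<lambda>_. x)" for n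
    using small[of "mball x (inverse (Suc n))"] x by (simp add: X)
  then obtain l where l: "\<And>n. l n \<in> loops_at X x" "\<And>n. l n ` {0..1} \<subseteq> mball x (inverse (Suc n))"
      "\<And>n. \<not> R (l n) (\<lambda>_. x)"
    by metis
  define w where "w a n = (if a n then l n else (\<lambda>_. x))" for a :: "nat \<Rightarrow> bool" and n
  have w: "pathin X (w a n)" "w a n 0 = x" "w a n 1 = x" for a n
    using l(1)[of n] x by (auto simp: w_def loops_at_def)
  have w_small: "w a n ` {0..1} \<subseteq> mball x (inverse (Suc n))" for a n
    using l(2)[of n] x by (auto simp: w_def X)
  have cont: "pathin X (infinite_concat x (\<lambda>i. w a (i + k)))" for a k
    unfolding X
  proof (rule pathin_infinite_concat)
    fix e :: real assume "e > 0"
    then obtain j where j: "inverse (Suc j) < e" using reals_Archimedean by blast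
    have "w a (n + k) ` {0..1} \<subseteq> mcball x e" if "n \<ge> j" for n
    proof -
      have "inverse (real (Suc (n + k))) \<le> inverse (real (Suc j))" using that by (intro le_imp_inverse_le) auto
      then have "inverse (real (Suc (n + k))) < e" using j by (rule order_le_less_trans)
      then have "mball x (inverse (Suc (n + k))) \<subseteq> mcball x e" by (auto simp del: of_nat_Suc)
      then show ?thesis by (rule subset_trans[OF w_small])
    qed
    then show "\<exists>j. \<forall>n\<ge>j. w a (n + k) ` {0..1} \<subseteq> mcball x e" by blast
  qed (use w in \<open>simp_all add: X\<close>)
  define f where "f a = infinite_concat x (w a)" for a
  have f: "f a \<in> loops_at X x" for a
    using cont[of a 0] infinite_concat_0[of "w a" x] w by (simp add: f_def loops_at_def infinite_concat_1)
  define E where "E a b = R (f a) (f b)" for a b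
  have "\<exists>C :: nat \<Rightarrow> ('k \<Rightarrow> 'a) set. (\<forall>g. continuous_map K X g \<longrightarrow> (\<exists>i. g \<in> C i)) \<and>
      (\<forall>i g h y. g \<in> C i \<longrightarrow> h \<in> C i \<longrightarrow> y \<in> topspace K \<longrightarrow> d (g y) (h y) < inverse (Suc k))" for k
  proof -
    have "inverse (real (Suc k)) > 0" by simp
    from countable_cover_continuous_maps[OF K_compact K_second_countable sep[unfolded X] this]
    show ?thesis unfolding X by metis
  qed
  then obtain C :: "nat \<Rightarrow> nat \<Rightarrow> ('k \<Rightarrow> 'a) set" where C: "\<And>k g. continuous_map K X g \<Longrightarrow> \<exists>i. g \<in> C k i"
    "\<And>k i g h y. g \<in> C k i \<Longrightarrow> h \<in> C k i \<Longrightarrow> y \<in> topspace K \<Longrightarrow> d (g y) (h y) < inverse (Suc k)"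
    by metis
  \<comment> \<open>The number \<open>n\<close> stands for a pair: which map of the witness is
    located, and to which accuracy. Every map thus receives every accuracy along a branch.\<close>
  define entry where "entry g n i \<longleftrightarrow> g (fst (prod_decode n)) \<in> C (snd (prod_decode n)) i" for g n i
  define wit where "wit c s y g \<longleftrightarrow> (\<forall>i. continuous_map K X (g i)) \<and> S c g (f (fst \<circ> y)) (f (snd \<circ> y)) \<and>
      (\<forall>k<length s. entry g k (s ! k))" for c and s :: "nat list" and y :: "nat \<Rightarrow> bool \<times> bool" and g
  define A where "A s = (case s of [] \<Rightarrow> {y. E (fst \<circ> y) (snd \<circ> y)} | c # s' \<Rightarrow> {y. \<exists>g. wit c s' y g})" for s
  obtain F :: "(nat \<Rightarrow> bool) \<Rightarrow> nat \<Rightarrow> bool" where F: "\<And>a b. a \<noteq> b \<Longrightarrow> \<not> E (F a) (F b)"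
  proof (rule souslin_equivalence_perfect[of E A])
    show "E a b \<Longrightarrow> E b a" for a b unfolding E_def by (rule R_sym)
    show "E a b \<Longrightarrow> E b c \<Longrightarrow> E a c" for a b c unfolding E_def by (rule R_trans)
    show "\<not> E a (a(n := \<not> a n))" for a n
    proof
      \<comment> \<open>The two concatenations differ only at place \<open>n\<close>, where one has
        \<open>l n\<close> and the other the constant loop.\<close>
      assume "E a (a(n := \<not> a n))"
      then have "R (w a n) (w (a(n := \<not> a n)) n)"
        unfolding E_def f_def
      proof (rule infinite_concat_R_imp)
        show "w a i = w (a(n := \<not> a n)) i" if "i \<noteq> n" for i using that by (simp add: w_def)
      qed (rule w cont)+
      then show False using l(3)[of n] R_sym by (auto simp: w_def split: if_splits)
    qed
    show "A [] = {y. E (fst \<circ> y) (snd \<circ> y)}" by (simp add: A_def)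
    show "A s \<subseteq> (\<Union>n. A (s @ [n]))" for s
    proof
      fix y assume y: "y \<in> A s"
      show "y \<in> (\<Union>n. A (s @ [n]))"
      proof (cases s)
        case Nil
        then have "R (f (fst \<circ> y)) (f (snd \<circ> y))" using y by (simp add: A_def E_def)
        then obtain c g where "\<forall>i. continuous_map K X (g i)" "S c g (f (fst \<circ> y)) (f (snd \<circ> y))"
          using R_iff_witness[OF f f] by blast
        then have "wit c [] y g" by (simp add: wit_def)
        then have "y \<in> A (s @ [c])" unfolding A_def using Nil by auto
        then show ?thesis by (rule UN_I[OF UNIV_I])
      next
        case (Cons c s')
        then obtain g where g: "wit c s' y g" using y by (auto simp: A_def)
        then obtain i where i: "entry g (length s') i" using C(1) unfolding wit_def entry_def by blast
        have "wit c (s' @ [i]) y g"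
          using g i unfolding wit_def by (auto simp: nth_append less_Suc_eq)
        then have "y \<in> A (s @ [i])" unfolding A_def using Cons by auto
        then show ?thesis by (rule UN_I[OF UNIV_I])
      qed
    qed
    show "E (fst \<circ> y) (snd \<circ> y)"
      if nonempty: "\<And>n m. A (map b [0..<n]) \<inter> cylinder (map y [0..<m]) \<noteq> {}" for b y
    proof -
      define c where "c = b 0"
      have "map b [0..<Suc n] = c # map (b \<circ> Suc) [0..<n]" for n
        by (simp add: c_def upt_conv_Cons map_Suc_upt[symmetric] del: upt_Suc)
      then have "\<exists>z g. z \<in> cylinder (map y [0..<n]) \<and> wit c (map (b \<circ> Suc) [0..<n]) z g" for n
        using nonempty[of "Suc n" n] by (auto simp: A_def)
      then obtain z g where z: "\<And>n. z n \<in> cylinder (map y [0..<n])"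
        and g: "\<And>n. wit c (map (b \<circ> Suc) [0..<n]) (z n) (g n)" by metis
      \<comment> \<open>From some stage on, the \<open>j\<close>-th maps all lie in one set of
        accuracy \<open>k\<close>, so they are uniformly Cauchy. The shift by \<open>Suc\<close> is
        due to the witness type in place 0 of the branch.\<close>
      have gC: "g n j \<in> C k (b (Suc (prod_encode (j, k))))" if "prod_encode (j, k) < n" for j k n
        using g[of n] that by (auto simp: wit_def entry_def)
      have "\<exists>h. continuous_map K mtopology h \<and>
          (\<forall>e>0. \<forall>\<^sub>F n in sequentially. \<forall>v\<in>topspace K. d (g n j v) (h v) < e)" for j
      proof -
        have ev: "\<forall>\<^sub>F n in sequentially. continuous_map K mtopology (g n j)"
          using g by (simp add: wit_def X)
        have cau: "\<exists>N. \<forall>m n v. N \<le> m \<longrightarrow> N \<le> n \<longrightarrow> v \<in> topspace K \<longrightarrow> d (g m j v) (g n j v) < e"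
          if "e > 0" for e :: real
        proof -
          obtain k where k: "inverse (Suc k) < e" using reals_Archimedean[OF \<open>e > 0\<close>] by blast
          let ?N = "Suc (prod_encode (j, k))"
          have "d (g m j v) (g n j v) < e" if "?N \<le> m" "?N \<le> n" "v \<in> topspace K" for m n v
            using C(2)[OF gC gC that(3), of j k m n] that k by simp
          then show ?thesis by blast
        qed
        show ?thesis
          by (rule continuous_map_uniformly_Cauchy_limit[OF \<open>mcomplete\<close> ev], erule cau, rule exI, rule conjI, assumption, simp)
      qed
      from choice[OF allI[OF this]] obtain h where "\<forall>j. continuous_map K mtopology (h j) \<and>
          (\<forall>e>0. \<forall>\<^sub>F n in sequentially. \<forall>v\<in>topspace K. d (g n j v) (h j v) < e)" ..
      then have h: "\<And>j. continuous_map K mtopology (h j)"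
        "\<And>j e. 0 < e \<Longrightarrow> \<forall>\<^sub>F n in sequentially. \<forall>v\<in>topspace K. d (g n j v) (h j v) < e"
        by simp_all
      have gM: "g n j v \<in> M" if "v \<in> topspace K" for n j v
        using g[of n] that by (auto simp: wit_def X continuous_map_def)
      have hM: "h j v \<in> M" if "v \<in> topspace K" for j v
        using h(1)[of j] that by (auto simp: continuous_map_def)
      have lim_g: "limitin X (\<lambda>n. g n j v) (h j v) sequentially" if "v \<in> topspace K" for j v
        unfolding X limitin_metric
      proof (intro conjI allI impI)
        show "h j v \<in> M" using hM that .
        fix e :: real assume "e > 0"
        from h(2)[OF this] show "\<forall>\<^sub>F n in sequentially. g n j v \<in> M \<and> d (g n j v) (h j v) < e"
          by (rule eventually_mono) (use gM that in blast)
      qed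
      have lim_f: "limitin X (\<lambda>n. f (u n) t) (f v t) sequentially"
        if "\<And>n i. i < n \<Longrightarrow> u n i = v i" "t \<in> {0..1}" for u v t
      proof -
        have "\<forall>\<^sub>F n in sequentially. f (u n) t = f v t"
          unfolding f_def using that w(2) by (intro infinite_concat_limit) (auto simp: w_def)
        moreover have "f v t \<in> topspace X"
          using f[of v] path_image_subset_topspace[of X "f v"] that(2) by (auto simp: loops_at_def)
        ultimately show ?thesis by (auto intro: limitin_eventually)
      qed
      have zy: "z n i = y i" if "i < n" for n i using z[of n] that by (simp add: in_cylinder_map_upt)
      \<comment> \<open>The approximating pairs \<open>z n\<close> have their own witnesses; these
        converge to \<open>h\<close> while the concatenations converge pointwise, so
        \<open>h\<close> is a witness for \<open>y\<close>.\<close>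
      have "S c h (f (fst \<circ> y)) (f (snd \<circ> y))"
      proof (rule S_closed)
        show "S c (g n) (f (fst \<circ> z n)) (f (snd \<circ> z n))" for n using g[of n] by (simp add: wit_def)
        show "limitin X (\<lambda>n. g n j v) (h j v) sequentially" if "v \<in> topspace K" for j v using that by (rule lim_g)
        fix t :: real assume t: "t \<in> {0..1}"
        show "limitin X (\<lambda>n. f (fst \<circ> z n) t) (f (fst \<circ> y) t) sequentially"
          using t by (intro lim_f) (simp_all add: zy)
        show "limitin X (\<lambda>n. f (snd \<circ> z n) t) (f (snd \<circ> y) t) sequentially"
          using t by (intro lim_f) (simp_all add: zy)
      qed
      then show ?thesis unfolding E_def using R_iff_witness[OF f f] h(1) X by blast
    qed
  next
    fix G :: "(nat \<Rightarrow> bool) \<Rightarrow> nat \<Rightarrow> bool"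
    assume "\<And>a b. a \<noteq> b \<Longrightarrow> \<not> E (G a) (G b)"
    then show thesis by (rule that[of G])
  qed
  have "inj (\<lambda>a. {q \<in> loops_at X x. R (f (F a)) q})"
  proof (rule injI, rule ccontr)
    fix a b assume eq: "{q \<in> loops_at X x. R (f (F a)) q} = {q \<in> loops_at X x. R (f (F b)) q}" and "a \<noteq> b"
    have "R (f (F b)) (f (F b))" using f[of "F b"] by (intro R_refl) (simp add: loops_at_def)
    then have "f (F b) \<in> {q \<in> loops_at X x. R (f (F a)) q}" unfolding eq using f by simp
    then have "E (F a) (F b)" by (simp add: E_def)
    then show False using F \<open>a \<noteq> b\<close> by blast
  qed
  moreover have "range (\<lambda>a. {q \<in> loops_at X x. R (f (F a)) q}) \<subseteq> loop_classes x"
    unfolding loop_classes_def using f by blast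
  ultimately have "(UNIV :: (nat \<Rightarrow> bool) set) \<lesssim> loop_classes x"
    unfolding lepoll_def by (intro exI[of _ "\<lambda>a. {q \<in> loops_at X x. R (f (F a)) q}"] conjI) auto
  then show ?thesis using nat_fun_bool_eqpoll_reals lepoll_trans1 eqpoll_sym by blast
qed

text \<open>The point with arbitrarily small nontrivial loops may differ from \<open>x\<close>; the
  lower bound obtained there is transported to \<open>x\<close> along a path.\<close>

theorem loop_classes_dichotomy:
  assumes con: "connected_space X" and lpc: "locally_path_connected_space X" and pol: "Polish_space X"
    and x: "x \<in> topspace X"
  shows "countable (loop_classes x) \<or> loop_classes x \<approx> (UNIV :: real set)"
proof -
  obtain M d where "Metric_space M d" and X: "X = Metric_space.mtopology M d" and "separable_space X"
    using pol unfolding Polish_space_def completely_metrizable_space_def by metis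
  then have sc: "second_countable X" and haus: "Hausdorff_space X"
    using Metric_space.separable_imp_second_countable Metric_space.Hausdorff_space_mtopology by blast+
  show ?thesis
  proof (rule R_simple_or_small_loops[OF lpc])
    assume "\<And>U y. openin X U \<Longrightarrow> y \<in> U \<Longrightarrow> \<exists>V. R_simple V \<and> y \<in> V \<and> V \<subseteq> U"
    from countable_loop_classes[OF sc this x] show ?thesis ..
  next
    fix y assume y: "y \<in> topspace X"
      and "\<And>U. openin X U \<Longrightarrow> y \<in> U \<Longrightarrow> \<exists>l. l \<in> loops_at X y \<and> l ` {0..1} \<subseteq> U \<and> \<not> R l (\<lambda>_. y)"
    from reals_lepoll_loop_classes[OF pol this] have "(UNIV :: real set) \<lesssim> loop_classes y" .
    moreover obtain c where "pathin X c" "c 0 = x" "c 1 = y"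
      using con lpc x y path_connected_eq_connected_space unfolding path_connected_space_def by blast
    then have "loop_classes y \<lesssim> loop_classes x" by (rule loop_classes_basepoint)
    ultimately have "(UNIV :: real set) \<lesssim> loop_classes x" by (rule lepoll_trans)
    then show ?thesis using lepoll_antisym[OF loop_classes_lepoll_reals[OF sc haus]] by blast
  qed
qed

end

section \<open>Homotopy\<close>

lemma limitin_eq_unique:
  assumes "Hausdorff_space X" "\<And>n. u n = v n" "limitin X u a sequentially" "limitin X v b sequentially"
  shows "a = b"
proof -
  have "u = v" using assms(2) by (rule ext)
  then show ?thesis using limitin_Hausdorff_unique[OF assms(3) _ _ assms(1)] assms(4) by simp
qed

lemma second_countable_euclidean: "second_countable (euclidean :: 'b::second_countable_topology topology)"
proof -
  obtain \<B> :: "'b set set" where B: "countable \<B>" "\<And>V. V \<in> \<B> \<Longrightarrow> open V" "\<And>S. open S \<Longrightarrow> \<exists>U\<subseteq>\<B>. S = \<Union>U"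
    using univ_second_countable by metis
  have "\<exists>V\<in>\<B>. x \<in> V \<and> V \<subseteq> U" if "open U" "x \<in> U" for U x
    using B(3)[OF that(1)] that(2) by blast
  then show ?thesis unfolding second_countable_def using B(1,2) by (intro exI[of _ \<B>]) auto
qed

definition path_homotopic :: "'a topology \<Rightarrow> (real \<Rightarrow> 'a) \<Rightarrow> (real \<Rightarrow> 'a) \<Rightarrow> bool" where
  "path_homotopic X p q \<longleftrightarrow> homotopic_with (\<lambda>r. r 0 = p 0 \<and> r 1 = p 1) (top_of_set {0..1}) X p q"

lemma homotopic_with_endpoints:
  assumes "homotopic_with (\<lambda>r. r 0 = x \<and> r 1 = y) (top_of_set {0..1}) X p q"
  shows "pathin X p" "pathin X q" "p 0 = x" "p 1 = y" "q 0 = x" "q 1 = y"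
  using homotopic_with_imp_continuous_maps[OF assms] homotopic_with_imp_property[OF assms]
  by (auto simp: pathin_def)

lemma path_homotopicI:
  assumes "homotopic_with (\<lambda>r. r 0 = x \<and> r 1 = y) (top_of_set {0..1}) X p q"
  shows "path_homotopic X p q"
  using assms homotopic_with_endpoints[OF assms] by (simp add: path_homotopic_def)

text \<open>The form used for witnesses: equations on the four sides of the square, with the first
  coordinate as homotopy time.\<close>

lemma path_homotopic_iff:
  "path_homotopic X p q \<longleftrightarrow> (\<exists>h. continuous_map (top_of_set ({0..1} \<times> {0..1})) X h \<and>
     (\<forall>t\<in>{0..1}. h (0, t) = p t \<and> h (1, t) = q t \<and> h (t, 0) = p 0 \<and> h (t, 1) = p 1))"
  unfolding path_homotopic_def by (subst homotopic_with) (auto 0 4)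

lemma homotopic_with_loop_join:
  assumes p: "path_homotopic X p p'" and q: "path_homotopic X q q'" and pq: "p 1 = q 0"
  shows "path_homotopic X (loop_join p q) (loop_join p' q')"
proof -
  let ?I = "{0..1::real}"
  obtain h where h: "continuous_map (top_of_set (?I \<times> ?I)) X h"
    "\<And>t. t \<in> ?I \<Longrightarrow> h (0, t) = p t \<and> h (1, t) = p' t \<and> h (t, 0) = p 0 \<and> h (t, 1) = p 1"
    using p unfolding path_homotopic_iff by blast
  obtain k where k: "continuous_map (top_of_set (?I \<times> ?I)) X k"
    "\<And>t. t \<in> ?I \<Longrightarrow> k (0, t) = q t \<and> k (1, t) = q' t \<and> k (t, 0) = q 0 \<and> k (t, 1) = q 1"
    using q unfolding path_homotopic_iff by blast
  define r where "r v = (if snd v \<le> 1/2 then h (fst v, 2 * snd v) else k (fst v, 2 * snd v - 1))" for v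
  have "continuous_map (top_of_set (?I \<times> ?I)) X r"
    unfolding r_def
  proof (rule continuous_map_cases_le)
    have "continuous_map (top_of_set {v \<in> ?I \<times> ?I. snd v \<le> 1/2}) (top_of_set (?I \<times> ?I)) (\<lambda>v. (fst v, 2 * snd v))"
      by (auto intro!: continuous_intros)
    from continuous_map_compose[OF this h(1)]
    show "continuous_map (subtopology (top_of_set (?I \<times> ?I)) {v \<in> topspace (top_of_set (?I \<times> ?I)). snd v \<le> 1/2}) X
        (\<lambda>v. h (fst v, 2 * snd v))"
      by (simp add: subtopology_subtopology comp_def Int_def conj_ac)
    have "continuous_map (top_of_set {v \<in> ?I \<times> ?I. 1/2 \<le> snd v}) (top_of_set (?I \<times> ?I)) (\<lambda>v. (fst v, 2 * snd v - 1))"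
      by (auto intro!: continuous_intros)
    from continuous_map_compose[OF this k(1)]
    show "continuous_map (subtopology (top_of_set (?I \<times> ?I)) {v \<in> topspace (top_of_set (?I \<times> ?I)). 1/2 \<le> snd v}) X
        (\<lambda>v. k (fst v, 2 * snd v - 1))"
      by (simp add: subtopology_subtopology comp_def Int_def conj_ac)
    show "h (fst v, 2 * snd v) = k (fst v, 2 * snd v - 1)"
      if "v \<in> topspace (top_of_set (?I \<times> ?I))" "snd v = 1/2" for v
    proof -
      have "2 * snd v = 1" "fst v \<in> ?I" using that by auto
      then show ?thesis using h(2)[of "fst v"] k(2)[of "fst v"] pq by (simp only:) simp
    qed
  qed (auto intro!: continuous_intros)
  moreover have "r (0, t) = loop_join p q t \<and> r (1, t) = loop_join p' q' t \<and>
      r (t, 0) = loop_join p q 0 \<and> r (t, 1) = loop_join p q 1" if t: "t \<in> ?I" for t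
    using h(2)[of "2 * t"] k(2)[of "2 * t - 1"] h(2)[OF t] k(2)[OF t] t
    by (auto simp: r_def loop_join_def)
  ultimately show ?thesis unfolding path_homotopic_iff by blast
qed

lemma path_homotopic_congruence: "path_congruence X (path_homotopic X)"
proof
  fix p q r p' q' :: "real \<Rightarrow> 'a" and x y
  show "pathin X p \<and> pathin X q \<and> p 0 = q 0 \<and> p 1 = q 1" if "path_homotopic X p q"
    using homotopic_with_endpoints[OF that[unfolded path_homotopic_def]] by simp
  show "path_homotopic X p q" if "homotopic_with (\<lambda>r. r 0 = x \<and> r 1 = y) (top_of_set {0..1}) X p q"
    using that by (rule path_homotopicI)
  show "path_homotopic X q p" if "path_homotopic X p q"
    by (rule path_homotopicI[OF homotopic_with_symD[OF that[unfolded path_homotopic_def]]])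
  show "path_homotopic X p r" if "path_homotopic X p q" "path_homotopic X q r"
  proof -
    have "q 0 = p 0" "q 1 = p 1" by (rule homotopic_with_endpoints[OF that(1)[unfolded path_homotopic_def]])+
    then have "homotopic_with (\<lambda>r. r 0 = p 0 \<and> r 1 = p 1) (top_of_set {0..1}) X q r"
      using that(2) unfolding path_homotopic_def by (simp only:)
    then show ?thesis using homotopic_with_trans[OF that(1)[unfolded path_homotopic_def]]
      unfolding path_homotopic_def by blast
  qed
qed (rule homotopic_with_loop_join)

text \<open>A single map on the square is a complete witness, so only \<open>g 0\<close> is read.
  The side conditions are equations and pass to limits because limits in a Hausdorff space are
  unique.\<close>

lemma analytic_path_homotopic:
  assumes X: "Hausdorff_space X"
  shows "analytic_path_congruence X (path_homotopic X) (top_of_set ({0..1} \<times> {0..1}))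
    (\<lambda>_ g p q. \<forall>t\<in>{0..1}. g 0 (0, t) = p t \<and> g 0 (1, t) = q t \<and> g 0 (t, 0) = p 0 \<and> g 0 (t, 1) = p 1)"
  (is "analytic_path_congruence X _ ?K ?S")
proof -
  interpret path_congruence X "path_homotopic X" by (rule path_homotopic_congruence)
  show ?thesis
  proof
    have "compact ({0..1::real} \<times> {0..1::real})" by (intro compact_Times compact_Icc)
    then show "compact_space ?K" by (intro compact_space_subtopology) simp
    show "second_countable ?K" by (intro second_countable_subtopology second_countable_euclidean)
    fix p q :: "real \<Rightarrow> 'a" and x
    show "path_homotopic X p q \<longleftrightarrow> (\<exists>(c::nat) g. (\<forall>i::nat. continuous_map ?K X (g i)) \<and> ?S c g p q)"
      unfolding path_homotopic_iff
    proof
      assume "\<exists>h. continuous_map ?K X h \<and> (\<forall>t\<in>{0..1}. h (0, t) = p t \<and> h (1, t) = q t \<and> h (t, 0) = p 0 \<and> h (t, 1) = p 1)"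
      then obtain h where "continuous_map ?K X h" "\<forall>t\<in>{0..1}. h (0, t) = p t \<and> h (1, t) = q t \<and> h (t, 0) = p 0 \<and> h (t, 1) = p 1"
        by blast
      then show "\<exists>(c::nat) g. (\<forall>i::nat. continuous_map ?K X (g i)) \<and> ?S c g p q"
        by (intro exI[of _ 0] exI[of _ "\<lambda>_. h"]) simp
    qed blast
  next
    fix c :: nat and gs :: "nat \<Rightarrow> nat \<Rightarrow> real \<times> real \<Rightarrow> 'a" and ps qs g p q
    assume S: "\<And>n. ?S c (gs n) (ps n) (qs n)"
      and g: "\<And>i y. y \<in> topspace ?K \<Longrightarrow> limitin X (\<lambda>n. gs n i y) (g i y) sequentially"
      and p: "\<And>t. t \<in> {0..1} \<Longrightarrow> limitin X (\<lambda>n. ps n t) (p t) sequentially"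
      and q: "\<And>t. t \<in> {0..1} \<Longrightarrow> limitin X (\<lambda>n. qs n t) (q t) sequentially"
    show "?S c g p q"
    proof (intro ballI conjI)
      fix t :: real assume t: "t \<in> {0..1}"
      show "g 0 (0, t) = p t"
        by (rule limitin_eq_unique[OF X _ g p]) (use S t in auto)
      show "g 0 (1, t) = q t"
        by (rule limitin_eq_unique[OF X _ g q]) (use S t in auto)
      show "g 0 (t, 0) = p 0"
        by (rule limitin_eq_unique[OF X _ g p]) (use S t in auto)
      show "g 0 (t, 1) = p 1"
        by (rule limitin_eq_unique[OF X _ g p]) (use S t in auto)
    qed
  qed
qed

lemma fundamental_group_carrier:
  "carrier (fundamental_group X x) = path_congruence.loop_classes X (path_homotopic X) x"
proof -
  have "homotopic_loops_at X x p q \<longleftrightarrow> path_homotopic X p q" if "p \<in> loops_at X x" for p q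
    using that by (simp add: homotopic_loops_at_def path_homotopic_def loops_at_def)
  then have "loop_class X x p = {q \<in> loops_at X x. path_homotopic X p q}" if "p \<in> loops_at X x" for p
    using that by (simp add: loop_class_def)
  then show ?thesis
    unfolding path_congruence.loop_classes_def[OF path_homotopic_congruence] fundamental_group_def by simp
qed

section \<open>Homology\<close>

lemma powertop_real_eq_euclidean: "subtopology (powertop_real UNIV) S = top_of_set S"
  by (simp add: euclidean_product_topology)

lemma standard_simplex_1: "u \<in> standard_simplex 1 \<longleftrightarrow> u 0 \<ge> 0 \<and> u 1 \<ge> 0 \<and> u 0 + u 1 = 1 \<and> (\<forall>i>1. u i = 0)"
proof -
  have "(0 \<le> u i \<and> u i \<le> 1)" if "u 0 \<ge> 0" "u 1 \<ge> 0" "u 0 + u 1 = 1" "\<forall>i>1. u i = 0" for i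
    using that by (cases "i = 0"; cases "i = 1") auto
  then show ?thesis unfolding standard_simplex_def by auto
qed

lemmas standard_simplex_Suc_0 = standard_simplex_1[unfolded One_nat_def]

lemma standard_simplex_2:
  "u \<in> standard_simplex 2 \<longleftrightarrow> u 0 \<ge> 0 \<and> u 1 \<ge> 0 \<and> u 2 \<ge> 0 \<and> u 0 + u 1 + u 2 = 1 \<and> (\<forall>i>2. u i = 0)"
proof -
  have "(0 \<le> u i \<and> u i \<le> 1)" if "u 0 \<ge> 0" "u 1 \<ge> 0" "u 2 \<ge> 0" "u 0 + u 1 + u 2 = 1" "\<forall>i>2. u i = 0" for i
  proof -
    consider "i = 0" | "i = 1" | "i = 2" | "i > 2" by linarith
    then show ?thesis using that by cases auto
  qed
  then show ?thesis unfolding standard_simplex_def by (auto simp: numeral_2_eq_2)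
qed

lemma simplical_face_in_standard_simplex_2:
  assumes "k \<le> 2" "u \<in> standard_simplex 1"
  shows "simplical_face k u \<in> standard_simplex 2"
proof -
  have "k = 0 \<or> k = 1 \<or> k = 2" using assms(1) by auto
  then show ?thesis using assms(2) unfolding standard_simplex_1 standard_simplex_2
    by (auto simp: simplical_face_def)
qed

lemma compact_standard_simplex: "compact (standard_simplex p)"
proof -
  have "compactin (powertop_real UNIV) (standard_simplex p)"
  proof (rule closed_compactin)
    show "compactin (powertop_real UNIV) (UNIV \<rightarrow>\<^sub>E {0..1})" by (simp add: compactin_PiE)
    show "standard_simplex p \<subseteq> UNIV \<rightarrow>\<^sub>E {0..1}" by (auto simp: standard_simplex_def)
    have "closed {x :: nat \<Rightarrow> real. (\<forall>i. 0 \<le> x i \<and> x i \<le> 1) \<and> (\<forall>i>p. x i = 0) \<and> (\<Sum>i\<le>p. x i) = 1}"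
      by (intro closed_Collect_conj closed_Collect_all closed_Collect_imp closed_Collect_le closed_Collect_eq
          continuous_intros continuous_on_product_coordinates) auto
    then show "closedin (powertop_real UNIV) (standard_simplex p)"
      by (simp add: euclidean_product_topology standard_simplex_def)
  qed
  then show ?thesis by (simp add: euclidean_product_topology)
qed

text \<open>Time is the barycentric coordinate of the second vertex, so face 0 is the end of the
  path and face 1 its start. The restriction provides the extensionality required of singular
  simplices.\<close>

definition path_simplex :: "(real \<Rightarrow> 'a) \<Rightarrow> (nat \<Rightarrow> real) \<Rightarrow> 'a" where
  "path_simplex p = restrict (\<lambda>u. p (u 1)) (standard_simplex 1)"

abbreviation path_chain :: "(real \<Rightarrow> 'a) \<Rightarrow> 'a chain" where
  "path_chain p \<equiv> frag_of (path_simplex p)"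

definition simplex_path :: "((nat \<Rightarrow> real) \<Rightarrow> 'a) \<Rightarrow> real \<Rightarrow> 'a" where
  "simplex_path f = (\<lambda>t. f (\<lambda>i. if i = 0 then 1 - t else if i = 1 then t else 0))"

lemma singular_simplex_path_simplex:
  assumes "pathin X p"
  shows "singular_simplex 1 X (path_simplex p)"
proof -
  have "continuous_on (standard_simplex 1) (\<lambda>u. u 1)"
    by (rule continuous_on_subset[OF continuous_on_product_coordinates]) simp
  then have "continuous_map (top_of_set (standard_simplex 1)) (top_of_set {0..1}) (\<lambda>u. u 1)"
    by (auto simp: standard_simplex_Suc_0)
  from continuous_map_compose[OF this assms[unfolded pathin_def]]
  have "continuous_map (top_of_set (standard_simplex 1)) X (\<lambda>u. p (u 1))" by (simp add: comp_def)
  then have "continuous_map (top_of_set (standard_simplex 1)) X (path_simplex p)"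
    by (rule continuous_map_eq) (simp add: path_simplex_def)
  then show ?thesis unfolding singular_simplex_def powertop_real_eq_euclidean by (simp add: path_simplex_def)
qed

lemma pathin_simplex_path:
  assumes "singular_simplex 1 X f"
  shows "pathin X (simplex_path f)"
proof -
  have "continuous_on {0..1} (\<lambda>t::real. (\<lambda>i::nat. if i = 0 then 1 - t else if i = 1 then t else 0))"
  proof (rule continuous_on_coordinatewise_then_product)
    fix i :: nat
    show "continuous_on {0..1} (\<lambda>t::real. if i = 0 then 1 - t else if i = 1 then t else 0)"
      by (cases "i = 0"; cases "i = 1") (auto intro!: continuous_intros)
  qed
  then have "continuous_map (top_of_set {0..1}) (top_of_set (standard_simplex 1))
      (\<lambda>t::real. (\<lambda>i::nat. if i = 0 then 1 - t else if i = 1 then t else 0))"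
    by (auto simp: standard_simplex_Suc_0)
  from continuous_map_compose[OF this, of X f]
  show ?thesis using assms unfolding singular_simplex_def powertop_real_eq_euclidean pathin_def simplex_path_def
    by (simp add: comp_def)
qed

lemma path_simplex_simplex_path:
  assumes "singular_simplex 1 X f"
  shows "path_simplex (simplex_path f) = f"
proof (rule extensionalityI[of _ "standard_simplex 1"])
  show "f \<in> extensional (standard_simplex 1)" using assms by (simp add: singular_simplex_def)
  fix u :: "nat \<Rightarrow> real" assume u: "u \<in> standard_simplex 1"
  have "(\<lambda>i. if i = 0 then 1 - u 1 else if i = 1 then u 1 else 0) = u"
  proof
    fix i show "(if i = 0 then 1 - u 1 else if i = 1 then u 1 else 0) = u i"
      using u unfolding standard_simplex_1 by (cases "i = 0"; cases "i = 1") auto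
  qed
  then show "path_simplex (simplex_path f) u = f u" using u by (simp add: path_simplex_def simplex_path_def)
qed (simp add: path_simplex_def)

section \<open>Boundaries and path chains\<close>

definition boundaries :: "'a topology \<Rightarrow> 'a chain set" where
  "boundaries X = {chain_boundary 2 d | d. singular_chain 2 X d}"

lemma chain_boundary_diff: "chain_boundary p (c - d) = chain_boundary p c - chain_boundary p d"
  by (simp add: chain_boundary_def frag_extend_diff)

lemma singular_chain_diff: "singular_chain p X c \<Longrightarrow> singular_chain p X d \<Longrightarrow> singular_chain p X (c - d)"
  unfolding singular_chain_def by (rule subset_trans[OF keys_diff Un_least])

lemma boundaries_zero: "0 \<in> boundaries X"
  unfolding boundaries_def by (auto intro!: exI[of _ 0] simp: chain_boundary_def singular_chain_def)

lemma boundaries_diff: "a \<in> boundaries X \<Longrightarrow> b \<in> boundaries X \<Longrightarrow> a - b \<in> boundaries X"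
  unfolding boundaries_def mem_Collect_eq
  by (elim exE conjE) (metis chain_boundary_diff singular_chain_diff)

lemma boundaries_minus: "a \<in> boundaries X \<Longrightarrow> - a \<in> boundaries X"
  using boundaries_diff[OF boundaries_zero] by fastforce

lemma boundaries_add: "a \<in> boundaries X \<Longrightarrow> b \<in> boundaries X \<Longrightarrow> a + b \<in> boundaries X"
  using boundaries_diff[OF _ boundaries_minus] by fastforce

text \<open>\<open>H\<close> on the affine triangle \<open>A\<close>, \<open>B\<close>,
  \<open>C\<close> is a singular 2-simplex with faces \<open>q\<close>, \<open>r\<close>,
  \<open>p\<close> in this order, whence the signs. Degenerate triangles are allowed and give the
  relations for constant paths and for joins.\<close>

lemma triangle_boundary:
  fixes A B C :: "real \<times> real"
  assumes H: "continuous_map (top_of_set ({0..1} \<times> {0..1})) X H"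
    and ABC: "A \<in> {0..1} \<times> {0..1}" "B \<in> {0..1} \<times> {0..1}" "C \<in> {0..1} \<times> {0..1}"
    and p: "\<And>t. t \<in> {0..1} \<Longrightarrow> p t = H (A + t *\<^sub>R (B - A))"
    and q: "\<And>t. t \<in> {0..1} \<Longrightarrow> q t = H (B + t *\<^sub>R (C - B))"
    and r: "\<And>t. t \<in> {0..1} \<Longrightarrow> r t = H (A + t *\<^sub>R (C - A))"
  shows "path_chain p + path_chain q - path_chain r \<in> boundaries X"
proof -
  define a where "a u = u 0 *\<^sub>R A + u 1 *\<^sub>R B + u 2 *\<^sub>R C" for u :: "nat \<Rightarrow> real"
  have a_in: "a u \<in> {0..1} \<times> {0..1}" if u: "u \<in> standard_simplex 2" for u
  proof -
    have conv: "convex ({0..1::real} \<times> {0..1::real})" by (intro convex_Times convex_real_interval)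
    have u': "u 0 \<ge> 0" "u 1 \<ge> 0" "u 2 \<ge> 0" "u 0 + u 1 + u 2 = 1" using u by (auto simp: standard_simplex_2)
    have "u 0 *\<^sub>R A + (u 1 *\<^sub>R B + u 2 *\<^sub>R C) = a u" by (simp add: a_def)
    moreover have "0 \<le> u 0 * x + u 1 * y + u 2 * z \<and> u 0 * x + u 1 * y + u 2 * z \<le> 1"
      if "x \<in> {0..1}" "y \<in> {0..1}" "z \<in> {0..1}" for x y z :: real
    proof -
      have "u 0 * x + u 1 * y + u 2 * z \<le> u 0 * 1 + u 1 * 1 + u 2 * 1"
        using that u' by (intro add_mono mult_left_mono) auto
      then show ?thesis using that u' by simp
    qed
    ultimately show ?thesis using ABC by (cases A, cases B, cases C) (auto simp: a_def)
  qed
  have "continuous_on (standard_simplex 2) a"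
    unfolding a_def
    by (intro continuous_intros continuous_on_subset[OF continuous_on_product_coordinates subset_UNIV])
  then have "continuous_map (top_of_set (standard_simplex 2)) (top_of_set ({0..1} \<times> {0..1})) a"
    using a_in by (auto simp: image_subset_iff)
  from continuous_map_compose[OF this H]
  have c: "continuous_map (top_of_set (standard_simplex 2)) X (restrict (H \<circ> a) (standard_simplex 2))"
    by (rule continuous_map_eq) simp
  define s where "s = restrict (H \<circ> a) (standard_simplex 2)"
  have "singular_simplex 2 X s"
    using c unfolding singular_simplex_def powertop_real_eq_euclidean s_def by simp
  then have sc: "singular_chain 2 X (frag_of s)" by (simp add: singular_chain_def)
  have u0: "u 0 = 1 - u 1" "u 1 \<in> {0..1}" if "u \<in> standard_simplex 1" for u
    using that by (auto simp: standard_simplex_Suc_0)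
  have seg: "u 0 *\<^sub>R P + u 1 *\<^sub>R Q = P + u 1 *\<^sub>R (Q - P)" if u: "u \<in> standard_simplex 1" for u and P Q :: "real \<times> real"
    unfolding u0(1)[OF u] by (simp add: algebra_simps)
  have face: "singular_face 2 k s = path_simplex v"
    if "k \<le> 2" "\<And>u. u \<in> standard_simplex 1 \<Longrightarrow> H (a (simplical_face k u)) = v (u 1)" for k v
    unfolding singular_face_def path_simplex_def s_def
    by (rule trans[OF _ restrict_ext[of "standard_simplex 1"]])
      (auto simp: that simplical_face_in_standard_simplex_2[unfolded One_nat_def] intro!: restrict_ext)
  have f0: "singular_face 2 0 s = path_simplex q"
  proof (rule face)
    fix u :: "nat \<Rightarrow> real" assume u: "u \<in> standard_simplex 1"
    have "a (simplical_face 0 u) = u 0 *\<^sub>R B + u 1 *\<^sub>R C" by (simp add: a_def simplical_face_def)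
    then show "H (a (simplical_face 0 u)) = q (u 1)" by (simp only: seg[OF u] q[OF u0(2)[OF u]])
  qed simp
  have f1: "singular_face 2 1 s = path_simplex r"
  proof (rule face)
    fix u :: "nat \<Rightarrow> real" assume u: "u \<in> standard_simplex 1"
    have "a (simplical_face 1 u) = u 0 *\<^sub>R A + u 1 *\<^sub>R C" by (simp add: a_def simplical_face_def)
    then show "H (a (simplical_face 1 u)) = r (u 1)" by (simp only: seg[OF u] r[OF u0(2)[OF u]])
  qed simp
  have f2: "singular_face 2 2 s = path_simplex p"
  proof (rule face)
    fix u :: "nat \<Rightarrow> real" assume u: "u \<in> standard_simplex 1"
    have "a (simplical_face 2 u) = u 0 *\<^sub>R A + u 1 *\<^sub>R B" by (simp add: a_def simplical_face_def)
    then show "H (a (simplical_face 2 u)) = p (u 1)" by (simp only: seg[OF u] p[OF u0(2)[OF u]])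
  qed simp
  have "chain_boundary 2 (frag_of s) = path_chain p + path_chain q - path_chain r"
    using f0 f1 f2 by (simp add: chain_boundary_def numeral_2_eq_2)
  then show ?thesis unfolding boundaries_def using sc by (metis (mono_tags, lifting) mem_Collect_eq)
qed

lemma const_path_chain_boundary:
  assumes "x \<in> topspace X"
  shows "path_chain (\<lambda>_. x) \<in> boundaries X"
  \<comment> \<open>With three equal faces, two signs are positive and one negative, so one copy is
    left.\<close>
  using triangle_boundary[of X "\<lambda>_. x" 0 0 0 "\<lambda>_. x" "\<lambda>_. x" "\<lambda>_. x"] assms by (simp add: zero_prod_def)

lemma path_chain_join:
  assumes "pathin X p" "pathin X q" "p 1 = q 0"
  shows "path_chain p + path_chain q - path_chain (loop_join p q) \<in> boundaries X"
proof (rule triangle_boundary)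
  have "continuous_map (top_of_set ({0..1} \<times> {0..1})) (top_of_set {0..1}) (snd :: real \<times> real \<Rightarrow> real)"
    by (auto intro!: continuous_intros)
  from continuous_map_compose[OF this pathin_loop_join[OF assms, unfolded pathin_def]]
  show "continuous_map (top_of_set ({0..1} \<times> {0..1})) X (\<lambda>v :: real \<times> real. loop_join p q (snd v))" by (simp add: comp_def)
  \<comment> \<open>All three vertices lie on one side of the square; the middle one marks the
    junction at time 1/2.\<close>
  show "(0::real, 0::real) \<in> {0..1} \<times> {0..1}" "(0::real, 1/2::real) \<in> {0..1} \<times> {0..1}" "(0::real, 1::real) \<in> {0..1} \<times> {0..1}"
    by auto
  fix t :: real assume t: "t \<in> {0..1}"
  show "p t = loop_join p q (snd ((0, 0) + t *\<^sub>R ((0, 1/2) - (0, 0))))" using t by (simp add: loop_join_def)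
  show "q t = loop_join p q (snd ((0, 1/2) + t *\<^sub>R ((0, 1) - (0, 1/2))))"
    using t assms(3) by (cases "t = 0") (auto simp: loop_join_def algebra_simps)
  show "loop_join p q t = loop_join p q (snd ((0, 0) + t *\<^sub>R ((0, 1) - (0, 0))))" by simp
qed

definition path_homologous :: "'a topology \<Rightarrow> (real \<Rightarrow> 'a) \<Rightarrow> (real \<Rightarrow> 'a) \<Rightarrow> bool" where
  "path_homologous X p q \<longleftrightarrow> pathin X p \<and> pathin X q \<and> p 0 = q 0 \<and> p 1 = q 1 \<and>
     path_chain p - path_chain q \<in> boundaries X"

text \<open>The diagonal \<open>r\<close> cuts the square of the homotopy into two triangles; on
  subtraction it cancels, and the constant sides are boundaries themselves.\<close>

lemma path_homotopic_imp_homologous: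
  assumes "path_homotopic X p q"
  shows "path_homologous X p q"
proof -
  have ends: "pathin X p" "pathin X q" "p 0 = q 0" "p 1 = q 1"
    using homotopic_with_endpoints[OF assms[unfolded path_homotopic_def]] by auto
  obtain h where h: "continuous_map (top_of_set ({0..1} \<times> {0..1})) X h"
    "\<And>t. t \<in> {0..1} \<Longrightarrow> h (0, t) = p t \<and> h (1, t) = q t \<and> h (t, 0) = p 0 \<and> h (t, 1) = p 1"
    using assms unfolding path_homotopic_iff by blast
  define r where "r t = h (t, t)" for t
  have 1: "path_chain p + path_chain (\<lambda>_. p 1) - path_chain r \<in> boundaries X"
    by (rule triangle_boundary[OF h(1), of "(0, 0)" "(0, 1)" "(1, 1)" p "\<lambda>_. p 1" r]) (use h(2) in \<open>auto simp: r_def\<close>)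
  have 2: "path_chain (\<lambda>_. p 0) + path_chain q - path_chain r \<in> boundaries X"
    by (rule triangle_boundary[OF h(1), of "(0, 0)" "(1, 0)" "(1, 1)" "\<lambda>_. p 0" q r]) (use h(2) in \<open>auto simp: r_def\<close>)
  have 3: "path_chain (\<lambda>_. p 0) - path_chain (\<lambda>_. p 1) \<in> boundaries X"
    using path_start_in_topspace[OF ends(1)] path_finish_in_topspace[OF ends(1)]
    by (intro boundaries_diff const_path_chain_boundary)
  have "path_chain p - path_chain q =
      ((path_chain p + path_chain (\<lambda>_. p 1) - path_chain r) - (path_chain (\<lambda>_. p 0) + path_chain q - path_chain r))
      + (path_chain (\<lambda>_. p 0) - path_chain (\<lambda>_. p 1))"
    by simp
  also have "\<dots> \<in> boundaries X" by (intro boundaries_add boundaries_diff 1 2 3)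
  finally show ?thesis using ends by (simp add: path_homologous_def)
qed

lemma path_homologous_congruence: "path_congruence X (path_homologous X)"
proof
  fix p q r p' q' :: "real \<Rightarrow> 'a" and x y
  show "pathin X p \<and> pathin X q \<and> p 0 = q 0 \<and> p 1 = q 1" if "path_homologous X p q"
    using that by (simp add: path_homologous_def)
  show "path_homologous X p q" if "homotopic_with (\<lambda>r. r 0 = x \<and> r 1 = y) (top_of_set {0..1}) X p q"
    using that by (intro path_homotopic_imp_homologous path_homotopicI)
  show "path_homologous X q p" if "path_homologous X p q"
    using that boundaries_minus[of "path_chain p - path_chain q" X] by (simp add: path_homologous_def)
  show "path_homologous X p r" if "path_homologous X p q" "path_homologous X q r"
    using that boundaries_add[of "path_chain p - path_chain q" X "path_chain q - path_chain r"]
    by (simp add: path_homologous_def)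
  assume p: "path_homologous X p p'" and q: "path_homologous X q q'" and pq: "p 1 = q 0"
  have ends: "pathin X p" "pathin X p'" "p 0 = p' 0" "p 1 = p' 1" "pathin X q" "pathin X q'" "q 0 = q' 0" "q 1 = q' 1"
    using p q by (simp_all add: path_homologous_def)
  have "path_chain (loop_join p q) - path_chain (loop_join p' q') =
     ((path_chain p - path_chain p') + (path_chain q - path_chain q')
       - (path_chain p + path_chain q - path_chain (loop_join p q)))
       + (path_chain p' + path_chain q' - path_chain (loop_join p' q'))"
    by simp
  also have "\<dots> \<in> boundaries X"
  proof (rule boundaries_add[OF boundaries_diff[OF boundaries_add]])
    show "path_chain p + path_chain q - path_chain (loop_join p q) \<in> boundaries X"
      using ends pq by (intro path_chain_join)
    show "path_chain p' + path_chain q' - path_chain (loop_join p' q') \<in> boundaries X"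
      using ends pq by (intro path_chain_join) simp_all
  qed (use p q in \<open>simp_all add: path_homologous_def\<close>)
  finally show "path_homologous X (loop_join p q) (loop_join p' q')"
    using ends pq by (simp add: path_homologous_def pathin_loop_join)
qed

section \<open>Finite combinatorial data of a boundary\<close>

lemma sum_frag_cmul_left: "(\<Sum>j\<in>A. frag_cmul (b j) y) = frag_cmul (\<Sum>j\<in>A. b j) y"
  by (induction A rule: infinite_finite_induct) (simp_all add: frag_cmul_distrib)

text \<open>Cancellation in a formal sum is expressed by a labelling of its terms: terms with the
  same label are equal, and the coefficients of each label add up to 0. Terms with different labels
  may still coincide, so the condition contains no inequalities and is preserved under
  limits.\<close>

lemma sum_frag_of_eq_0_iff:
  assumes "finite J"
  shows "(\<Sum>j\<in>J. frag_cmul (b j) (frag_of (f j))) = 0 \<longleftrightarrow>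
    (\<exists>L :: 'b \<Rightarrow> 'b. (\<forall>j\<in>J. L j \<in> J) \<and> (\<forall>i\<in>J. \<forall>j\<in>J. L i = L j \<longrightarrow> f i = f j) \<and> (\<forall>m\<in>J. (\<Sum>j\<in>{j\<in>J. L j = m}. b j) = 0))"
proof
  have coeff: "Poly_Mapping.lookup (\<Sum>j\<in>J. frag_cmul (b j) (frag_of (f j))) y = (\<Sum>j\<in>{j\<in>J. f j = y}. b j)" for y
  proof -
    have "Poly_Mapping.lookup (\<Sum>j\<in>J. frag_cmul (b j) (frag_of (f j))) y = (\<Sum>j\<in>J. if f j = y then b j else 0)"
      unfolding lookup_sum by (rule sum.cong[OF refl]) auto
    also have "\<dots> = (\<Sum>j\<in>{j\<in>J. f j = y}. b j)" using assms by (simp add: sum.inter_filter)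
    finally show ?thesis .
  qed
  assume 0: "(\<Sum>j\<in>J. frag_cmul (b j) (frag_of (f j))) = 0"
  \<comment> \<open>Each term is labelled by a chosen index carrying the same generator.\<close>
  define L where "L j = (SOME i. i \<in> J \<and> f i = f j)" for j
  have L: "L j \<in> J \<and> f (L j) = f j" if "j \<in> J" for j
  proof -
    have "\<exists>i. i \<in> J \<and> f i = f j" using that by blast
    from someI_ex[OF this] show ?thesis unfolding L_def .
  qed
  have eq: "L i = L j \<longleftrightarrow> f i = f j" if "i \<in> J" "j \<in> J" for i j
  proof
    show "f i = f j" if "L i = L j" using L[OF \<open>i \<in> J\<close>] L[OF \<open>j \<in> J\<close>] that by simp
    show "L i = L j" if "f i = f j" using that by (simp only: L_def)
  qed
  have "(\<Sum>j\<in>{j\<in>J. L j = m}. b j) = 0" if m: "m \<in> J" for m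
  proof (cases "\<exists>i\<in>J. L i = m")
    case True
    then obtain i where i: "i \<in> J" "L i = m" by blast
    have "{j\<in>J. L j = m} = {j\<in>J. f j = f i}" using eq i by auto
    then show ?thesis using coeff[of "f i"] 0 by simp
  next
    case False
    then have e: "{j\<in>J. L j = m} = {}" by blast
    show ?thesis unfolding e by simp
  qed
  then show "\<exists>L :: 'b \<Rightarrow> 'b. (\<forall>j\<in>J. L j \<in> J) \<and> (\<forall>i\<in>J. \<forall>j\<in>J. L i = L j \<longrightarrow> f i = f j) \<and> (\<forall>m\<in>J. (\<Sum>j\<in>{j\<in>J. L j = m}. b j) = 0)"
    using L eq by (intro exI[of _ L]) auto
next
  assume "\<exists>L :: 'b \<Rightarrow> 'b. (\<forall>j\<in>J. L j \<in> J) \<and> (\<forall>i\<in>J. \<forall>j\<in>J. L i = L j \<longrightarrow> f i = f j) \<and> (\<forall>m\<in>J. (\<Sum>j\<in>{j\<in>J. L j = m}. b j) = 0)"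
  then obtain L :: "'b \<Rightarrow> 'b" where L: "\<And>j. j \<in> J \<Longrightarrow> L j \<in> J" "\<And>i j. i \<in> J \<Longrightarrow> j \<in> J \<Longrightarrow> L i = L j \<Longrightarrow> f i = f j"
    "\<And>m. m \<in> J \<Longrightarrow> (\<Sum>j\<in>{j\<in>J. L j = m}. b j) = 0" by blast
  have "(\<Sum>j\<in>J. frag_cmul (b j) (frag_of (f j))) = (\<Sum>m\<in>J. \<Sum>j\<in>{j\<in>J. L j = m}. frag_cmul (b j) (frag_of (f j)))"
    using assms L(1) by (intro sum.group[symmetric]) auto
  also have "\<dots> = (\<Sum>m\<in>J. 0)"
  proof (rule sum.cong[OF refl])
    fix m assume m: "m \<in> J"
    show "(\<Sum>j\<in>{j\<in>J. L j = m}. frag_cmul (b j) (frag_of (f j))) = 0"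
    proof (cases "\<exists>i\<in>J. L i = m")
      case True
      then obtain i where i: "i \<in> J" "L i = m" by blast
      have "(\<Sum>j\<in>{j\<in>J. L j = m}. frag_cmul (b j) (frag_of (f j))) = (\<Sum>j\<in>{j\<in>J. L j = m}. frag_cmul (b j) (frag_of (f i)))"
      proof (rule sum.cong[OF refl])
        fix j assume "j \<in> {j\<in>J. L j = m}"
        then have "f j = f i" using i by (intro L(2)) auto
        then show "frag_cmul (b j) (frag_of (f j)) = frag_cmul (b j) (frag_of (f i))" by simp
      qed
      also have "\<dots> = frag_cmul (\<Sum>j\<in>{j\<in>J. L j = m}. b j) (frag_of (f i))"
        by (rule sum_frag_cmul_left)
      also have "\<dots> = 0" using L(3)[OF m] by simp
      finally show ?thesis .
    next
      case False
      then have e: "{j\<in>J. L j = m} = {}" by blast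
      show ?thesis unfolding e by simp
    qed
  qed
  finally show "(\<Sum>j\<in>J. frag_cmul (b j) (frag_of (f j))) = 0" by simp
qed

text \<open>The \<open>3 N + 2\<close> singular edges occurring in \<open>\<partial> d - (p - q)\<close>, for a chain \<open>d\<close> of \<open>N\<close>
  triangles \<open>g 0, \<dots>, g (N - 1)\<close>, and their coefficients.\<close>
definition edge_coeff :: "nat \<Rightarrow> int list \<Rightarrow> nat \<Rightarrow> int" where
  "edge_coeff N as j = (if j < 3 * N then as ! (j div 3) * (-1) ^ (j mod 3) else if j = 3 * N then -1 else 1)"

definition edge_value :: "nat \<Rightarrow> (nat \<Rightarrow> (nat \<Rightarrow> real) \<Rightarrow> 'a) \<Rightarrow> (real \<Rightarrow> 'a) \<Rightarrow> (real \<Rightarrow> 'a) \<Rightarrow> nat \<Rightarrow> (nat \<Rightarrow> real) \<Rightarrow> 'a" where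
  "edge_value N g p q j u = (if j < 3 * N then g (j div 3) (simplical_face (j mod 3) u)
     else if j = 3 * N then p (u 1) else q (u 1))"

text \<open>Brings the equation for a bounding chain into the shape to which the labelling criterion
  applies: edge \<open>3 * i + k\<close> is face \<open>k\<close> of triangle \<open>i\<close>, and
  the last two edges are \<open>p\<close> and \<open>q\<close>.\<close>

lemma boundary_as_edge_sum:
  "chain_boundary 2 (\<Sum>i<N. frag_cmul (as ! i) (frag_of (restrict (g i) (standard_simplex 2)))) - (path_chain p - path_chain q)
    = (\<Sum>j<3 * N + 2. frag_cmul (edge_coeff N as j) (frag_of (restrict (edge_value N g p q j) (standard_simplex 1))))"
proof -
  define F where "F j = frag_cmul (as ! (j div 3) * (-1) ^ (j mod 3))
      (frag_of (restrict (\<lambda>u. g (j div 3) (simplical_face (j mod 3) u)) (standard_simplex 1)))" for j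
  have face: "singular_face 2 k (restrict (g i) (standard_simplex 2)) = restrict (\<lambda>u. g i (simplical_face k u)) (standard_simplex 1)"
    if "k \<le> 2" for k i
    unfolding singular_face_def
    by (auto simp: that simplical_face_in_standard_simplex_2[unfolded One_nat_def] intro!: restrict_ext)
  have "chain_boundary 2 (\<Sum>i<N. frag_cmul (as ! i) (frag_of (restrict (g i) (standard_simplex 2))))
      = (\<Sum>i<N. frag_cmul (as ! i) (\<Sum>k\<le>2. frag_cmul ((-1) ^ k) (frag_of (restrict (\<lambda>u. g i (simplical_face k u)) (standard_simplex 1)))))"
    by (simp add: chain_boundary_def frag_extend_sum frag_extend_cmul face)
  also have "\<dots> = (\<Sum>i<N. F (3 * i) + F (3 * i + 1) + F (3 * i + 2))"
  proof (rule sum.cong[OF refl])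
    fix i :: nat
    have num: "(3 * i) div 3 = i" "(3 * i + 1) div 3 = i" "(3 * i + 2) div 3 = i"
      "(3 * i) mod 3 = 0" "(3 * i + 1) mod 3 = 1" "(3 * i + 2) mod 3 = 2" by presburger+
    define e where "e k = frag_of (restrict (\<lambda>u. g i (simplical_face k u)) (standard_simplex 1))" for k
    have F: "F (3 * i) = frag_cmul (as ! i) (e 0)" "F (3 * i + 1) = frag_cmul (as ! i * (-1)) (e 1)"
      "F (3 * i + 2) = frag_cmul (as ! i) (e 2)"
      unfolding F_def e_def num by simp_all
    have "(\<Sum>k\<le>2. frag_cmul ((-1) ^ k) (e k)) = e 0 + frag_cmul (-1) (e 1) + e 2"
      by (simp add: numeral_2_eq_2)
    then show "frag_cmul (as ! i) (\<Sum>k\<le>2. frag_cmul ((-1) ^ k)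
          (frag_of (restrict (\<lambda>u. g i (simplical_face k u)) (standard_simplex 1))))
        = F (3 * i) + F (3 * i + 1) + F (3 * i + 2)"
      unfolding F e_def[symmetric] by (simp only: frag_cmul_distrib2 frag_cmul_cmul)
  qed
  also have "\<dots> = (\<Sum>j<3 * N. F j)"
    by (induction N) (simp_all add: eval_nat_numeral)
  also have "\<dots> = (\<Sum>j<3 * N. frag_cmul (edge_coeff N as j) (frag_of (restrict (edge_value N g p q j) (standard_simplex 1))))"
  proof (rule sum.cong[OF refl])
    fix j assume "j \<in> {..<3 * N}"
    then have "edge_value N g p q j = (\<lambda>u. g (j div 3) (simplical_face (j mod 3) u))"
      "edge_coeff N as j = as ! (j div 3) * (-1) ^ (j mod 3)"
      by (auto simp: edge_value_def edge_coeff_def)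
    then show "F j = frag_cmul (edge_coeff N as j) (frag_of (restrict (edge_value N g p q j) (standard_simplex 1)))"
      unfolding F_def by (simp only:)
  qed
  finally have main: "chain_boundary 2 (\<Sum>i<N. frag_cmul (as ! i) (frag_of (restrict (g i) (standard_simplex 2)))) = \<dots>" .
  have "3 * N + 2 = Suc (Suc (3 * N))" by simp
  moreover have "edge_value N g p q (3 * N) = (\<lambda>u. p (u 1))" "edge_value N g p q (Suc (3 * N)) = (\<lambda>u. q (u 1))"
    "edge_coeff N as (3 * N) = -1" "edge_coeff N as (Suc (3 * N)) = 1"
    by (auto simp: edge_value_def edge_coeff_def)
  ultimately show ?thesis
    unfolding main by (simp only: sum.lessThan_Suc path_simplex_def frag_cmul_one frag_cmul_minus_one) simp
qed

text \<open>The code \<open>c\<close> holds everything discrete: the number of triangles, their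
  coefficients and the labels of the edges. The maps enter only through equations between edges with
  the same label.\<close>

definition homology_witness :: "nat \<Rightarrow> (nat \<Rightarrow> (nat \<Rightarrow> real) \<Rightarrow> 'a) \<Rightarrow> (real \<Rightarrow> 'a) \<Rightarrow> (real \<Rightarrow> 'a) \<Rightarrow> bool" where
  "homology_witness c g p q \<longleftrightarrow> (case from_nat c of (N, as, Ls) \<Rightarrow>
     (\<forall>j<3 * N + 2. Ls ! j < 3 * N + 2) \<and>
     (\<forall>i<3 * N + 2. \<forall>j<3 * N + 2. Ls ! i = Ls ! j \<longrightarrow>
        (\<forall>u\<in>standard_simplex 1. edge_value N g p q i u = edge_value N g p q j u)) \<and>
     (\<forall>m<3 * N + 2. (\<Sum>j\<in>{j\<in>{..<3 * N + 2}. Ls ! j = m}. edge_coeff N as j) = 0))"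

lemma chain_as_indexed_sum:
  fixes d :: "'b \<Rightarrow>\<^sub>0 int"
  obtains N :: nat and as :: "int list" and xs where
    "\<And>i. i < N \<Longrightarrow> xs i \<in> Poly_Mapping.keys d" "d = (\<Sum>i<N. frag_cmul (as ! i) (frag_of (xs i)))"
proof -
  obtain ys where ys: "set ys = Poly_Mapping.keys d" "distinct ys" using finite_distinct_list[OF finite_keys[of d]] by blast
  have "d = (\<Sum>y\<in>Poly_Mapping.keys d. frag_cmul (Poly_Mapping.lookup d y) (frag_of y))"
    using frag_expansion[of d] unfolding frag_extend_def .
  also have "\<dots> = (\<Sum>i<length ys. frag_cmul (Poly_Mapping.lookup d (ys ! i)) (frag_of (ys ! i)))"
    using bij_betw_nth[OF ys(2) refl ys(1)[symmetric]] by (intro sum.reindex_bij_betw[symmetric])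
  also have "\<dots> = (\<Sum>i<length ys. frag_cmul (map (Poly_Mapping.lookup d) ys ! i) (frag_of (ys ! i)))"
    by (rule sum.cong) auto
  finally show ?thesis by (rule that[rotated]) (use ys(1) nth_mem in blast)
qed

lemma path_homologous_iff_witness:
  assumes p: "p \<in> loops_at X x" and q: "q \<in> loops_at X x"
  shows "path_homologous X p q \<longleftrightarrow>
    (\<exists>c g. (\<forall>i. continuous_map (top_of_set (standard_simplex 2)) X (g i)) \<and> homology_witness c g p q)"
proof
  assume "path_homologous X p q"
  then obtain d where d: "singular_chain 2 X d" "chain_boundary 2 d = path_chain p - path_chain q"
    unfolding path_homologous_def boundaries_def by auto
  obtain N as xs where xs: "\<And>i. i < N \<Longrightarrow> xs i \<in> Poly_Mapping.keys d" "d = (\<Sum>i<N. frag_cmul (as ! i) (frag_of (xs i)))"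
    by (rule chain_as_indexed_sum[of d], rule that, simp, assumption)
  have sing: "singular_simplex 2 X (xs i)" if "i < N" for i
    using xs(1)[OF that] d(1) unfolding singular_chain_def by blast
  \<comment> \<open>A witness is an infinite sequence of maps on the full simplex; beyond the
    \<open>N\<close> triangles it is filled up with constant maps.\<close>
  define g where "g i = (if i < N then xs i else (\<lambda>_. x))" for i
  have x: "x \<in> topspace X" using p path_start_in_topspace by (force simp: loops_at_def)
  have g: "continuous_map (top_of_set (standard_simplex 2)) X (g i)" for i
    using sing[of i] x unfolding g_def singular_simplex_def powertop_real_eq_euclidean by simp
  have "restrict (g i) (standard_simplex 2) = xs i" if "i < N" for i
    using sing[OF that] that by (simp add: g_def singular_simplex_def extensional_restrict)
  then have "d = (\<Sum>i<N. frag_cmul (as ! i) (frag_of (restrict (g i) (standard_simplex 2))))"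
    using xs(2) by simp
  then have "(\<Sum>j<3 * N + 2. frag_cmul (edge_coeff N as j) (frag_of (restrict (edge_value N g p q j) (standard_simplex 1)))) = 0"
    using boundary_as_edge_sum[of as g N p q] d(2) by simp
  then obtain L :: "nat \<Rightarrow> nat" where L: "\<forall>j\<in>{..<3 * N + 2}. L j \<in> {..<3 * N + 2}"
    "\<forall>i\<in>{..<3 * N + 2}. \<forall>j\<in>{..<3 * N + 2}. L i = L j \<longrightarrow>
       restrict (edge_value N g p q i) (standard_simplex 1) = restrict (edge_value N g p q j) (standard_simplex 1)"
    "\<forall>m\<in>{..<3 * N + 2}. (\<Sum>j\<in>{j\<in>{..<3 * N + 2}. L j = m}. edge_coeff N as j) = 0"
    unfolding sum_frag_of_eq_0_iff[OF finite_lessThan] by blast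
  define Ls where "Ls = map L [0..<3 * N + 2]"
  have Ls: "Ls ! j = L j" if "j < 3 * N + 2" for j
    using that nth_map_upt[of j "3 * N + 2" 0 L] by (simp add: Ls_def)
  have "homology_witness (to_nat (N, as, Ls)) g p q"
    unfolding homology_witness_def from_nat_to_nat prod.case
  proof (intro conjI allI impI ballI)
    show "Ls ! j < 3 * N + 2" if "j < 3 * N + 2" for j using L(1) Ls[OF that] that by auto
    fix i j u assume ij: "i < 3 * N + 2" "j < 3 * N + 2" "Ls ! i = Ls ! j" and u: "u \<in> standard_simplex 1"
    have "L i = L j" using ij(3) Ls[OF ij(1)] Ls[OF ij(2)] by simp
    then have "restrict (edge_value N g p q i) (standard_simplex 1) = restrict (edge_value N g p q j) (standard_simplex 1)"
      using L(2) ij(1,2) by blast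
    then show "edge_value N g p q i u = edge_value N g p q j u" using u by (metis restrict_apply')
  next
    fix m assume "m < 3 * N + 2"
    moreover have "{j\<in>{..<3 * N + 2}. Ls ! j = m} = {j\<in>{..<3 * N + 2}. L j = m}" using Ls by auto
    ultimately show "(\<Sum>j\<in>{j\<in>{..<3 * N + 2}. Ls ! j = m}. edge_coeff N as j) = 0" using L(3) by simp
  qed
  then show "\<exists>c g. (\<forall>i. continuous_map (top_of_set (standard_simplex 2)) X (g i)) \<and> homology_witness c g p q"
    using g by blast
next
  assume "\<exists>c g. (\<forall>i. continuous_map (top_of_set (standard_simplex 2)) X (g i)) \<and> homology_witness c g p q"
  then obtain c g where g: "\<And>i. continuous_map (top_of_set (standard_simplex 2)) X (g i)" and w: "homology_witness c g p q"
    by blast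
  obtain N as Ls where c: "from_nat c = (N :: nat, as :: int list, Ls :: nat list)" by (cases "from_nat c :: nat \<times> int list \<times> nat list") auto
  note W = w[unfolded homology_witness_def c prod.case]
  have "(\<Sum>j\<in>{..<3 * N + 2}. frag_cmul (edge_coeff N as j) (frag_of (restrict (edge_value N g p q j) (standard_simplex 1)))) = 0"
    unfolding sum_frag_of_eq_0_iff[OF finite_lessThan]
  proof (intro exI[of _ "\<lambda>j. Ls ! j"] conjI ballI impI)
    fix i j assume "i \<in> {..<3 * N + 2}" "j \<in> {..<3 * N + 2}" "Ls ! i = Ls ! j"
    then have "\<forall>u\<in>standard_simplex 1. edge_value N g p q i u = edge_value N g p q j u" using W by blast
    then show "restrict (edge_value N g p q i) (standard_simplex 1) = restrict (edge_value N g p q j) (standard_simplex 1)"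
      by (intro restrict_ext) simp
  qed (use W in simp_all)
  then have eq: "chain_boundary 2 (\<Sum>i<N. frag_cmul (as ! i) (frag_of (restrict (g i) (standard_simplex 2)))) = path_chain p - path_chain q"
    using boundary_as_edge_sum[of as g N p q] by simp
  have "singular_simplex 2 X (restrict (g i) (standard_simplex 2))" for i
  proof -
    have "continuous_map (top_of_set (standard_simplex 2)) X (restrict (g i) (standard_simplex 2))"
      using g[of i] by (rule continuous_map_eq) simp
    then show ?thesis unfolding singular_simplex_def powertop_real_eq_euclidean by simp
  qed
  then have kb: "Poly_Mapping.keys (frag_cmul (as ! i) (frag_of (restrict (g i) (standard_simplex 2)))) \<subseteq> Collect (singular_simplex 2 X)" for i
    by (intro subset_trans[OF keys_cmul]) simp
  have "singular_chain 2 X (\<Sum>i<N. frag_cmul (as ! i) (frag_of (restrict (g i) (standard_simplex 2))))"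
    unfolding singular_chain_def by (intro subset_trans[OF keys_sum] UN_least kb)
  then have "path_chain p - path_chain q \<in> boundaries X" unfolding boundaries_def using eq by (metis (mono_tags, lifting) mem_Collect_eq)
  then show "path_homologous X p q" using p q by (simp add: path_homologous_def loops_at_def)
qed

lemma analytic_path_homologous:
  assumes X: "Hausdorff_space X"
  shows "analytic_path_congruence X (path_homologous X) (top_of_set (standard_simplex 2)) homology_witness"
proof -
  interpret path_congruence X "path_homologous X" by (rule path_homologous_congruence)
  show ?thesis
  proof
    show "compact_space (top_of_set (standard_simplex 2))"
      using compact_standard_simplex[of 2] by (intro compact_space_subtopology) simp
    show "second_countable (top_of_set (standard_simplex 2))"
      by (intro second_countable_subtopology second_countable_euclidean)
  next
    fix p q :: "real \<Rightarrow> 'a" and x assume "p \<in> loops_at X x" "q \<in> loops_at X x"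
    then show "path_homologous X p q \<longleftrightarrow>
        (\<exists>c g. (\<forall>i. continuous_map (top_of_set (standard_simplex 2)) X (g i)) \<and> homology_witness c g p q)"
      by (rule path_homologous_iff_witness)
  next
    fix c :: nat and gs :: "nat \<Rightarrow> nat \<Rightarrow> (nat \<Rightarrow> real) \<Rightarrow> 'a" and ps qs g p q
    assume S: "\<And>n. homology_witness c (gs n) (ps n) (qs n)"
      and g: "\<And>i y. y \<in> topspace (top_of_set (standard_simplex 2)) \<Longrightarrow> limitin X (\<lambda>n. gs n i y) (g i y) sequentially"
      and p: "\<And>t. t \<in> {0..1} \<Longrightarrow> limitin X (\<lambda>n. ps n t) (p t) sequentially"
      and q: "\<And>t. t \<in> {0..1} \<Longrightarrow> limitin X (\<lambda>n. qs n t) (q t) sequentially"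
    obtain N as Ls where c: "from_nat c = (N :: nat, as :: int list, Ls :: nat list)" by (cases "from_nat c :: nat \<times> int list \<times> nat list") auto
    note W = S[unfolded homology_witness_def c prod.case]
    have lim: "limitin X (\<lambda>n. edge_value N (gs n) (ps n) (qs n) j u) (edge_value N g p q j u) sequentially"
      if "u \<in> standard_simplex 1" for j u
    proof -
      have "simplical_face (j mod 3) u \<in> standard_simplex 2"
        using that by (intro simplical_face_in_standard_simplex_2) simp_all
      moreover have "u 1 \<in> {0..1}" using that by (auto simp: standard_simplex_Suc_0)
      ultimately show ?thesis unfolding edge_value_def using g p q by auto
    qed
    show "homology_witness c g p q"
      unfolding homology_witness_def c prod.case
    proof (intro conjI allI impI ballI)
      fix i j u assume ij: "i < 3 * N + 2" "j < 3 * N + 2" "Ls ! i = Ls ! j" and u: "u \<in> standard_simplex 1"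
      show "edge_value N g p q i u = edge_value N g p q j u"
        \<comment> \<open>The labels stay fixed along the sequence, so the same two edges agree at
          every stage and hence in the limit.\<close>
        by (rule limitin_eq_unique[OF X _ lim[OF u] lim[OF u]]) (use W ij u in blast)
    qed (use W in simp_all)
  qed
qed

section \<open>The first homology group in terms of loops\<close>

lemma eqpoll_images_same_kernel:
  assumes "\<And>p q. p \<in> L \<Longrightarrow> q \<in> L \<Longrightarrow> f p = f q \<longleftrightarrow> g p = g q"
  shows "f ` L \<approx> g ` L"
proof -
  define h where "h y = g (SOME p. p \<in> L \<and> f p = y)" for y
  have h: "h (f p) = g p" if p: "p \<in> L" for p
  proof -
    have "\<exists>q. q \<in> L \<and> f q = f p" using p by blast
    from someI_ex[OF this] show ?thesis unfolding h_def using assms p by blast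
  qed
  have "inj_on h (f ` L)" by (rule inj_onI) (use h assms in auto)
  moreover have "h ` f ` L = g ` L" using h by (auto simp: image_image)
  ultimately show ?thesis unfolding eqpoll_def bij_betw_def by blast
qed

text \<open>Standard simplices are nonempty, so the empty space carries only the zero chain. Hence
  working modulo chains in the empty subspace is equality.\<close>

lemma not_singular_simplex_trivial: "\<not> singular_simplex p trivial_topology f"
proof
  assume "singular_simplex p trivial_topology f"
  then have "f ` standard_simplex p \<subseteq> {}"
    unfolding singular_simplex_def continuous_map_def by auto
  moreover have "(\<lambda>j. if j = 0 then 1 else 0) \<in> standard_simplex p" by (auto simp: standard_simplex_def)
  ultimately show False by blast
qed

lemma singular_chain_trivial_iff: "singular_chain p trivial_topology c \<longleftrightarrow> c = 0"
  unfolding singular_chain_def using not_singular_simplex_trivial by (auto simp flip: keys_eq_empty)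

lemma singular_relcycle_iff: "singular_relcycle 1 X {} c \<longleftrightarrow> singular_chain 1 X c \<and> chain_boundary 1 c = 0"
  by (simp add: singular_relcycle_def mod_subset_def singular_chain_trivial_iff)

lemma singular_relboundary_iff: "singular_relboundary 1 X {} c \<longleftrightarrow> c \<in> boundaries X"
  by (auto simp: singular_relboundary_def mod_subset_def singular_chain_trivial_iff boundaries_def numeral_2_eq_2)

lemma homology_group_carrier:
  "carrier (homology_group 1 X) = (\<lambda>c. {b + c | b. b \<in> boundaries X}) ` {c. singular_chain 1 X c \<and> chain_boundary 1 c = 0}"
proof -
  let ?Z = "{c. singular_chain 1 X c \<and> chain_boundary 1 c = 0}"
  have "subgroup ?Z (chain_group 1 X)"
  proof (rule group.subgroupI)
    show "group (chain_group 1 X)" by (simp add: chain_group_def)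
    show "?Z \<subseteq> carrier (chain_group 1 X)" by (auto simp: chain_group_def singular_chain_def)
    have "0 \<in> ?Z" by (simp add: singular_chain_def chain_boundary_def)
    then show "?Z \<noteq> {}" by blast
    show "inv\<^bsub>chain_group 1 X\<^esub> a \<in> ?Z" if "a \<in> ?Z" for a
    proof -
      have "inv\<^bsub>chain_group 1 X\<^esub> a = 0 - a" using that by (simp add: chain_group_def singular_chain_def)
      moreover have "0 - a \<in> ?Z"
        using that singular_chain_diff[of 1 X 0 a] chain_boundary_diff[of 1 0 a]
        by (simp add: singular_chain_def chain_boundary_def)
      ultimately show ?thesis by simp
    qed
    show "a \<otimes>\<^bsub>chain_group 1 X\<^esub> b \<in> ?Z" if "a \<in> ?Z" "b \<in> ?Z" for a b
      using that keys_add[of a b]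
      by (auto simp: chain_group_def singular_chain_def chain_boundary_def frag_extend_add)
  qed
  then have carr: "carrier (relcycle_group 1 X {}) = ?Z"
    unfolding relcycle_group_def singular_relcycle_iff by (rule subgroup.carrier_subgroup_generated_subgroup)
  have mult: "a \<otimes>\<^bsub>relcycle_group 1 X {}\<^esub> b = a + b" for a b
    by (simp add: relcycle_group_def subgroup_generated_def chain_group_def)
  show ?thesis
    unfolding homology_group_def FactGroup_def RCOSETS_def r_coset_def carr mult singular_relboundary_iff
    by auto
qed

lemma chain_boundary_1_frag_of:
  "chain_boundary 1 (frag_of f) = frag_of (singular_face 1 0 f) - frag_of (singular_face 1 1 f)"
  by (simp add: chain_boundary_def)

lemma path_chain_cycle:
  assumes "p \<in> loops_at X x"
  shows "singular_chain 1 X (path_chain p)" "chain_boundary 1 (path_chain p) = 0"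
proof -
  have p: "pathin X p" "p 0 = p 1" using assms by (auto simp: loops_at_def)
  show "singular_chain 1 X (path_chain p)"
    using singular_simplex_path_simplex[OF p(1)] by (simp add: singular_chain_def)
  have "singular_face 1 0 (path_simplex p) = singular_face 1 1 (path_simplex p)"
    unfolding singular_face_def
  proof (rule restrict_ext)
    fix u :: "nat \<Rightarrow> real" assume "u \<in> standard_simplex (1 - Suc 0)"
    then have u: "u 0 = 1" "\<forall>i>0. u i = 0" by (auto simp: standard_simplex_def)
    have "simplical_face 0 u \<in> standard_simplex 1" "simplical_face 1 u \<in> standard_simplex 1"
      using u by (auto simp: standard_simplex_Suc_0 simplical_face_def)
    then show "(path_simplex p \<circ> simplical_face 0) u = (path_simplex p \<circ> simplical_face 1) u"
      using u p(2) by (simp add: path_simplex_def simplical_face_def)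
  qed
  then show "chain_boundary 1 (path_chain p) = 0" unfolding chain_boundary_1_frag_of by simp
qed

lemma (in path_congruence) R_loop_rev:
  assumes "p \<in> loops_at X x"
  shows "R (loop_join p (path_rev p)) (\<lambda>_. x)"
  using assms by (intro R_right_inverse) (auto simp: loops_at_def)

text \<open>Up to boundaries, a difference of loops is again a loop. This is the step for
  differences when a formal combination of loops is reduced to one loop.\<close>

lemma path_chain_loop_diff:
  assumes p: "p \<in> loops_at X x" and q: "q \<in> loops_at X x"
  shows "path_chain p - path_chain q - path_chain (loop_join p (path_rev q)) \<in> boundaries X"
proof -
  interpret path_congruence X "path_homologous X" by (rule path_homologous_congruence)
  have pin: "pathin X p" "p 0 = x" "p 1 = x" "pathin X q" "q 0 = x" "q 1 = x"
    using p q by (auto simp: loops_at_def)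
  have x: "x \<in> topspace X" using path_start_in_topspace[OF pin(1)] pin by simp
  have 1: "path_chain p + path_chain (path_rev q) - path_chain (loop_join p (path_rev q)) \<in> boundaries X"
    using pin by (intro path_chain_join) auto
  have 2: "path_chain q + path_chain (path_rev q) - path_chain (loop_join q (path_rev q)) \<in> boundaries X"
    using pin by (intro path_chain_join) auto
  have 3: "path_chain (loop_join q (path_rev q)) - path_chain (\<lambda>_. x) \<in> boundaries X"
    using R_loop_rev[OF q] by (simp add: path_homologous_def)
  have "path_chain p - path_chain q - path_chain (loop_join p (path_rev q)) =
     (path_chain p + path_chain (path_rev q) - path_chain (loop_join p (path_rev q)))
     - (path_chain q + path_chain (path_rev q) - path_chain (loop_join q (path_rev q)))
     - (path_chain (loop_join q (path_rev q)) - path_chain (\<lambda>_. x)) - path_chain (\<lambda>_. x)"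
    by simp
  also have "\<dots> \<in> boundaries X"
    by (rule boundaries_diff[OF boundaries_diff[OF boundaries_diff[OF 1 2] 3] const_path_chain_boundary[OF x]])
  finally show ?thesis .
qed

text \<open>Surjectivity of the Hurewicz map: after joining the end points of each simplex to the base
  point, the auxiliary paths cancel in a cycle.\<close>
lemma cycle_homologous_to_loop:
  assumes X: "path_connected_space X" and x: "x \<in> topspace X"
    and c: "singular_chain 1 X c" "chain_boundary 1 c = 0"
  obtains p where "p \<in> loops_at X x" "c - path_chain p \<in> boundaries X"
proof -
  have "\<forall>y\<in>topspace X. \<exists>g. pathin X g \<and> g 0 = x \<and> g 1 = y"
    using X x unfolding path_connected_space_def by blast
  then obtain \<gamma> where \<gamma>: "\<And>y. y \<in> topspace X \<Longrightarrow> pathin X (\<gamma> y)" "\<And>y. y \<in> topspace X \<Longrightarrow> \<gamma> y 0 = x"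
      "\<And>y. y \<in> topspace X \<Longrightarrow> \<gamma> y 1 = y"
    by metis
  define loop where "loop f = loop_join (loop_join (\<gamma> (simplex_path f 0)) (simplex_path f)) (path_rev (\<gamma> (simplex_path f 1)))" for f
  \<comment> \<open>The contribution of the auxiliary paths to the base point: start minus
    end.\<close>
  define \<delta> where "\<delta> f = path_chain (\<gamma> (simplex_path f 0)) - path_chain (\<gamma> (simplex_path f 1))" for f
  have simp_path: "pathin X (simplex_path f)" "simplex_path f 0 \<in> topspace X" "simplex_path f 1 \<in> topspace X"
    if "singular_simplex 1 X f" for f
    using pathin_simplex_path[OF that] path_start_in_topspace path_finish_in_topspace by blast+
  have loop: "loop f \<in> loops_at X x" if "singular_simplex 1 X f" for f
    using simp_path[OF that] \<gamma> by (auto simp: loop_def loops_at_def intro!: pathin_loop_join)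
  have loop_chain: "path_chain (loop f) - frag_of f - \<delta> f \<in> boundaries X" if f: "singular_simplex 1 X f" for f
  proof -
    interpret path_congruence X "path_homologous X" by (rule path_homologous_congruence)
    let ?a = "\<gamma> (simplex_path f 0)" and ?b = "\<gamma> (simplex_path f 1)" and ?f = "simplex_path f"
    have a: "pathin X ?a" "?a 0 = x" "?a 1 = ?f 0" and b: "pathin X ?b" "?b 0 = x" "?b 1 = ?f 1" and p: "pathin X ?f"
      using simp_path[OF f] \<gamma> by auto
    have 1: "path_chain ?a + path_chain ?f - path_chain (loop_join ?a ?f) \<in> boundaries X"
      using a p by (intro path_chain_join)
    have 2: "path_chain (loop f) + path_chain ?b - path_chain (loop_join (loop f) ?b) \<in> boundaries X"
      using loop[OF f] b by (intro path_chain_join) (auto simp: loops_at_def)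
    have "path_homologous X (loop_join (loop_join (loop_join ?a ?f) (path_rev ?b)) (path_rev (path_rev ?b))) (loop_join ?a ?f)"
      using a b p by (intro R_sym[OF R_insert_right] pathin_loop_join) auto
    then have 3: "path_chain (loop_join (loop f) ?b) - path_chain (loop_join ?a ?f) \<in> boundaries X"
      by (simp add: loop_def path_homologous_def)
    have f_eq: "path_chain ?f = frag_of f" using path_simplex_simplex_path[OF f] by simp
    have "path_chain (loop f) - frag_of f - \<delta> f =
      (path_chain (loop f) + path_chain ?b - path_chain (loop_join (loop f) ?b))
      + (path_chain (loop_join (loop f) ?b) - path_chain (loop_join ?a ?f))
      - (path_chain ?a + path_chain ?f - path_chain (loop_join ?a ?f))"
      unfolding f_eq \<delta>_def by simp
    also have "\<dots> \<in> boundaries X" by (rule boundaries_diff[OF boundaries_add[OF 2 3] 1])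
    finally show ?thesis .
  qed
  have keys: "Poly_Mapping.keys c \<subseteq> Collect (singular_simplex 1 X)" using c(1) by (simp add: singular_chain_def)
  have 1: "frag_extend (\<lambda>f. path_chain (loop f)) c - c - frag_extend \<delta> c \<in> boundaries X"
    using keys
  proof (induction c rule: frag_induction)
    case (diff a b)
    have "frag_extend (\<lambda>f. path_chain (loop f)) (a - b) - (a - b) - frag_extend \<delta> (a - b) =
      (frag_extend (\<lambda>f. path_chain (loop f)) a - a - frag_extend \<delta> a)
      - (frag_extend (\<lambda>f. path_chain (loop f)) b - b - frag_extend \<delta> b)"
      by (simp add: frag_extend_diff)
    also have "\<dots> \<in> boundaries X" by (rule boundaries_diff[OF diff])
    finally show ?case .
  qed (simp_all add: boundaries_zero loop_chain)
  have "\<exists>p\<in>loops_at X x. frag_extend (\<lambda>f. path_chain (loop f)) c - path_chain p \<in> boundaries X"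
    using keys
  proof (induction c rule: frag_induction)
    case zero
    have "(\<lambda>_. x) \<in> loops_at X x" using x by (simp add: loops_at_def)
    then show ?case using boundaries_minus[OF const_path_chain_boundary[OF x]] by (intro bexI[of _ "\<lambda>_. x"]) simp_all
  next
    case (one f)
    then show ?case using loop by (intro bexI[of _ "loop f"]) (simp_all add: boundaries_zero)
  next
    case (diff a b)
    then obtain p q where p: "p \<in> loops_at X x" "frag_extend (\<lambda>f. path_chain (loop f)) a - path_chain p \<in> boundaries X"
      and q: "q \<in> loops_at X x" "frag_extend (\<lambda>f. path_chain (loop f)) b - path_chain q \<in> boundaries X" by blast
    have "frag_extend (\<lambda>f. path_chain (loop f)) (a - b) - path_chain (loop_join p (path_rev q)) =
      (frag_extend (\<lambda>f. path_chain (loop f)) a - path_chain p)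
      - (frag_extend (\<lambda>f. path_chain (loop f)) b - path_chain q)
      + (path_chain p - path_chain q - path_chain (loop_join p (path_rev q)))"
      by (simp add: frag_extend_diff)
    also have "\<dots> \<in> boundaries X"
      by (rule boundaries_add[OF boundaries_diff[OF p(2) q(2)] path_chain_loop_diff[OF p(1) q(1)]])
    finally show ?case
      using p(1) q(1) by (intro bexI[of _ "loop_join p (path_rev q)"]) (auto simp: loops_at_def intro!: pathin_loop_join)
  qed
  then obtain p where p: "p \<in> loops_at X x" "frag_extend (\<lambda>f. path_chain (loop f)) c - path_chain p \<in> boundaries X" by blast
  \<comment> \<open>The correction factors through the boundary, since it depends only on the end
    points of each simplex; on a cycle it therefore vanishes. The boundary is end minus start,
    whence the sign.\<close>
  have "frag_extend \<delta> c = - frag_extend (\<lambda>v. path_chain (\<gamma> (v (\<lambda>j. if j = 0 then 1 else 0)))) (chain_boundary 1 c)"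
    using subset_UNIV
  proof (induction c rule: frag_induction)
    case zero
    then show ?case by (simp add: chain_boundary_def)
  next
    case (one f)
    let ?e = "\<lambda>j::nat. if j = 0 then 1 else 0 :: real"
    have e: "?e \<in> standard_simplex (1 - Suc 0)" by (simp add: standard_simplex_def)
    have "simplical_face 0 ?e = (\<lambda>i. if i = 0 then 1 - 1 else if i = 1 then 1 else 0)"
      "simplical_face 1 ?e = (\<lambda>i. if i = 0 then 1 - 0 else if i = 1 then 0 else 0)"
      by (auto simp: simplical_face_def)
    then have "singular_face 1 0 f ?e = simplex_path f 1" "singular_face 1 1 f ?e = simplex_path f 0"
      unfolding singular_face_def simplex_path_def restrict_apply'[OF e] comp_apply by (simp_all only:)
    then show ?case unfolding chain_boundary_1_frag_of by (simp add: frag_extend_diff \<delta>_def)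
  next
    case (diff a b)
    then show ?case by (simp add: frag_extend_diff chain_boundary_diff)
  qed
  then have \<delta>: "frag_extend \<delta> c = 0" unfolding c(2) by simp
  have "c - path_chain p = (frag_extend (\<lambda>f. path_chain (loop f)) c - path_chain p)
      - (frag_extend (\<lambda>f. path_chain (loop f)) c - c - frag_extend \<delta> c)"
    by (simp add: \<delta>)
  also have "\<dots> \<in> boundaries X" by (rule boundaries_diff[OF p(2) 1])
  finally show ?thesis using that p(1) by blast
qed

lemma boundary_coset_eq_iff:
  "{b + c | b. b \<in> boundaries X} = {b + c' | b. b \<in> boundaries X} \<longleftrightarrow> c - c' \<in> boundaries X"
proof
  assume "{b + c | b. b \<in> boundaries X} = {b + c' | b. b \<in> boundaries X}"
  moreover have "c \<in> {b + c | b. b \<in> boundaries X}" using boundaries_zero by force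
  ultimately obtain b where "c = b + c'" "b \<in> boundaries X" by blast
  then show "c - c' \<in> boundaries X" by simp
next
  have sub: "{b + c | b. b \<in> boundaries X} \<subseteq> {b + c' | b. b \<in> boundaries X}" if "c - c' \<in> boundaries X" for c c'
  proof
    fix a assume "a \<in> {b + c | b. b \<in> boundaries X}"
    then obtain b where b: "a = b + c" "b \<in> boundaries X" by blast
    have "a = (b + (c - c')) + c'" using b(1) by simp
    then show "a \<in> {b + c' | b. b \<in> boundaries X}" using boundaries_add[OF b(2) that] by blast
  qed
  assume "c - c' \<in> boundaries X"
  moreover from this have "c' - c \<in> boundaries X" using boundaries_minus by fastforce
  ultimately show "{b + c | b. b \<in> boundaries X} = {b + c' | b. b \<in> boundaries X}"
    by (rule equalityI[OF sub sub])
qed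

text \<open>Every homology class contains a loop at \<open>x\<close>, and two such loops have the
  same coset exactly when they are homologous, as their end points agree anyway.\<close>

lemma homology_group_eqpoll_loop_classes:
  assumes X: "path_connected_space X" and x: "x \<in> topspace X"
  shows "carrier (homology_group 1 X) \<approx> path_congruence.loop_classes X (path_homologous X) x"
proof -
  interpret path_congruence X "path_homologous X" by (rule path_homologous_congruence)
  let ?coset = "\<lambda>c. {b + c | b. b \<in> boundaries X}"
  have "carrier (homology_group 1 X) = (\<lambda>p. ?coset (path_chain p)) ` loops_at X x"
    unfolding homology_group_carrier
  proof (intro equalityI image_subsetI)
    fix c assume "c \<in> {c. singular_chain 1 X c \<and> chain_boundary 1 c = 0}"
    then obtain p where "p \<in> loops_at X x" "c - path_chain p \<in> boundaries X"
      using cycle_homologous_to_loop[OF X x] by blast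
    then show "?coset c \<in> (\<lambda>p. ?coset (path_chain p)) ` loops_at X x"
      unfolding boundary_coset_eq_iff[symmetric] by blast
  next
    fix p assume "p \<in> loops_at X x"
    then have "path_chain p \<in> {c. singular_chain 1 X c \<and> chain_boundary 1 c = 0}"
      by (intro CollectI conjI path_chain_cycle)
    then show "?coset (path_chain p) \<in> ?coset ` {c. singular_chain 1 X c \<and> chain_boundary 1 c = 0}"
      by (rule imageI)
  qed
  also have "\<dots> \<approx> (\<lambda>p. {q \<in> loops_at X x. path_homologous X p q}) ` loops_at X x"
  proof (rule eqpoll_images_same_kernel)
    fix p q assume pq: "p \<in> loops_at X x" "q \<in> loops_at X x"
    have "?coset (path_chain p) = ?coset (path_chain q) \<longleftrightarrow> path_homologous X p q"
      unfolding boundary_coset_eq_iff using pq by (auto simp: path_homologous_def loops_at_def)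
    also have "\<dots> \<longleftrightarrow> {r \<in> loops_at X x. path_homologous X p r} = {r \<in> loops_at X x. path_homologous X q r}"
    proof
      assume "path_homologous X p q"
      then show "{r \<in> loops_at X x. path_homologous X p r} = {r \<in> loops_at X x. path_homologous X q r}" by (rule loop_class_eq)
    next
      assume eq: "{r \<in> loops_at X x. path_homologous X p r} = {r \<in> loops_at X x. path_homologous X q r}"
      have "path_homologous X q q" using pq(2) by (intro R_refl) (simp add: loops_at_def)
      then show "path_homologous X p q" using eq pq(2) by blast
    qed
    finally show "?coset (path_chain p) = ?coset (path_chain q) \<longleftrightarrow>
        {r \<in> loops_at X x. path_homologous X p r} = {r \<in> loops_at X x. path_homologous X q r}" .
  qed
  finally show ?thesis unfolding loop_classes_def .
qed

lemma homology_group_empty: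
  assumes "topspace X = {}"
  shows "countable (carrier (homology_group 1 X))"
proof -
  have "X = trivial_topology" using assms by simp
  then have "c = 0" if "singular_chain 1 X c" for c
    using that singular_chain_trivial_iff[of 1 c] by simp
  then have "{c. singular_chain 1 X c \<and> chain_boundary 1 c = 0} \<subseteq> {0}" by blast
  then have "countable {c. singular_chain 1 X c \<and> chain_boundary 1 c = 0}" by (rule countable_subset) simp
  then show ?thesis unfolding homology_group_carrier by (rule countable_image)
qed

theorem theorem4p3:
  fixes X :: "'a topology"
  assumes "connected_space X"
    and "locally_path_connected_space X"
    and "Polish_space X"
  shows "(\<forall>x \<in> topspace X.
            countable (carrier (fundamental_group X x)) \<or>
            carrier (fundamental_group X x) \<approx> (UNIV :: real set))
       \<and> (countable (carrier (homology_group 1 X)) \<or>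
            carrier (homology_group 1 X) \<approx> (UNIV :: real set))"
proof -
  have haus: "Hausdorff_space X"
    using assms(3) unfolding Polish_space_def
    by (intro metrizable_imp_Hausdorff_space completely_metrizable_imp_metrizable_space) simp
  interpret htpy: analytic_path_congruence X "path_homotopic X" "top_of_set ({0..1} \<times> {0..1})"
    "\<lambda>_ g p q. \<forall>t\<in>{0..1}. g 0 (0, t) = p t \<and> g 0 (1, t) = q t \<and> g 0 (t, 0) = p 0 \<and> g 0 (t, 1) = p 1"
    by (rule analytic_path_homotopic[OF haus])
  interpret hom: analytic_path_congruence X "path_homologous X" "top_of_set (standard_simplex 2)" homology_witness
    by (rule analytic_path_homologous[OF haus])
  show ?thesis
  proof (intro conjI ballI)
    fix x assume "x \<in> topspace X"
    then show "countable (carrier (fundamental_group X x)) \<or> carrier (fundamental_group X x) \<approx> (UNIV :: real set)"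
      unfolding fundamental_group_carrier by (rule htpy.loop_classes_dichotomy[OF assms])
  next
    show "countable (carrier (homology_group 1 X)) \<or> carrier (homology_group 1 X) \<approx> (UNIV :: real set)"
    \<comment> \<open>H_1 comes without a base point, and the empty space offers none; its only
      chain is 0.\<close>
    proof (cases "topspace X = {}")
      case True
      then show ?thesis using homology_group_empty by blast
    next
      case False
      then obtain x where x: "x \<in> topspace X" by blast
      have "path_connected_space X" using assms(1,2) path_connected_eq_connected_space by blast
      from homology_group_eqpoll_loop_classes[OF this x] hom.loop_classes_dichotomy[OF assms x]
      show ?thesis by (meson countable_eqpoll eqpoll_trans eqpoll_sym)
    qed
  qed
qed

end
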